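(* Let $(\mathsf{T},\mathsf{U},Q,D)$ be an Auslander--Gruson--Jensen (AGJ) duality triple. If $\mathcal{D}$ is a definable subcategory of $\mathsf{T}$, then $(\mathcal{D},\mathcal{D}^{d})$ is a symmetric product closed duality pair on the duality triple $(\mathsf{T},\mathsf{U},Q)$.
   Context: For a compactly generated triangulated category $\mathsf{T}$ with compact objects $\mathsf{T}^{\mathrm{c}}$, $\mathrm{Mod}(\mathsf{T}^{\mathrm{c}})$ is the category of additive functors $(\mathsf{T}^{\mathrm{c}})^{\mathrm{op}}\to\mathbf{Ab}$ and $\mathbf{y}X=\mathrm{Hom}_{\mathsf{T}}(-,X)|_{\mathsf{T}^{\mathrm{c}}}$. A morphism $X\to Y$ is a pure monomorphism if it sits in a triangle $X\to Y\to Z\to\Sigma X$ with $0\to\mathbf{y}X\to\mathbf{y}Y\to\mathbf{y}Z\to0$ exact; $X$ is pure injective if $\mathbf{y}X$ is injective. A duality triple $(\mathsf{T},\mathsf{U},Q)$ consists of two compactly generated triangulated categories $\mathsf{T},\mathsf{U}$ and exact functors $Q\colon\mathsf{T}^{\mathrm{op}}\to\mathsf{U}$ and $Q\colon\mathsf{U}^{\mathrm{op}}\to\mathsf{T}$ (both denoted $Q$) such that: (1) $Q(X)$ is pure injective for every $X$ in $\mathsf{T}$ or $\mathsf{U}$; (2) for every $X$ in $\mathsf{T}$ or $\mathsf{U}$ there is a natural map $i_X\colon X\to Q^2(X)$ which is a pure monomorphism; (3) $Q(i_X)\circ i_{Q(X)}$ is the identity for every $X$ in $\mathsf{T}$ or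 $\mathsf{U}$; (4) $Q(\bigoplus_I X_i)\simeq\prod_I Q(X_i)$ for every set of objects $\{X_i\}_I$ in $\mathsf{T}$ or in $\mathsf{U}$. An AGJ duality triple $(\mathsf{T},\mathsf{U},Q,D)$ is a duality triple together with functors $D\colon(\mathsf{T}^{\mathrm{c}})^{\mathrm{op}}\to\mathsf{U}^{\mathrm{c}}$ and $D\colon(\mathsf{U}^{\mathrm{c}})^{\mathrm{op}}\to\mathsf{T}^{\mathrm{c}}$ such that: (1) they form an adjoint equivalence between $\mathsf{T}^{\mathrm{c}}$ and $(\mathsf{U}^{\mathrm{c}})^{\mathrm{op}}$; (2) for all $C\in\mathsf{T}^{\mathrm{c}}$, $X\in\mathsf{T}$, $C'\in\mathsf{U}^{\mathrm{c}}$, $Y\in\mathsf{U}$ there are isomorphisms $\mathrm{Hom}_{\mathbb{Z}}(\mathrm{Hom}_{\mathsf{T}}(C,X),\mathbb{Q}/\mathbb{Z})\cong\mathrm{Hom}_{\mathsf{U}}(DC,QX)$ and $\mathrm{Hom}_{\mathbb{Z}}(\mathrm{Hom}_{\mathsf{U}}(C',Y),\mathbb{Q}/\mathbb{Z})\cong\mathrm{Hom}_{\mathsf{T}}(DC',QY)$, natural in both variables. A duality pair on $(\mathsf{T},\mathsf{U},Q)$ is a pair of classes $\mathsf{A}\subseteq\mathsf{T}$, $\mathsf{B}\subseteq\mathsf{U}$ with $X\in\mathsf{A}$ iff $Q(X)\in\mathsf{B}$ and $\mathsf{B}$ closed under finite coproducts and retracts. It is symmetric if $(\mathsf{B},\mathsf{A})$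 is also a duality pair, and product closed if $\mathsf{A}$ is closed under products. A class $\mathcal{D}\subseteq\mathsf{T}$ is definable if there is a set of maps $f_i\colon A_i\to B_i$ in $\mathsf{T}^{\mathrm{c}}$ with $\mathcal{D}=\{X:\mathrm{Hom}_{\mathsf{T}}(f_i,X)\text{ is surjective for all }i\}$. $(\mathsf{T}^{\mathrm{c}},\mathbf{Ab})^{\mathrm{fp}}$ is the category of finitely presented functors $G=\mathrm{coker}(\mathrm{Hom}_{\mathsf{T}}(f,-)|_{\mathsf{T}^{\mathrm{c}}})$, $f$ a map in $\mathsf{T}^{\mathrm{c}}$; $\widetilde{G}\colon\mathsf{T}\to\mathbf{Ab}$ is the same cokernel computed on $\mathsf{T}$. Put $\mathcal{S}_{\mathcal{D}}=\{G\in(\mathsf{T}^{\mathrm{c}},\mathbf{Ab})^{\mathrm{fp}}:\widetilde{G}(X)=0\ \forall X\in\mathcal{D}\}$ and $(\delta G)(Y)=\mathrm{Hom}_{(\mathsf{T}^{\mathrm{c}},\mathbf{Ab})}(G,\mathrm{Hom}_{\mathsf{T}}(DY,-))$, which defines an exact contravariant equivalence $\delta\colon(\mathsf{T}^{\mathrm{c}},\mathbf{Ab})^{\mathrm{fp}}\to(\mathsf{U}^{\mathrm{c}},\mathbf{Ab})^{\mathrm{fp}}$. The dual definable category is $\mathcal{D}^{d}=\{Y\in\mathsf{U}:\widetilde{H}(Y)=0\ \forall H\in\delta\mathcal{S}_{\mathcal{D}}\}$, a definable subcategory of $\mathsf{U}$. *)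

theory Defs
  imports "HOL-Algebra.Free_Abelian_Groups" "HOL-Library.Equipollence"
begin

section \<open>Smallness\<close>

text \<open>
  The word ``set'', as opposed to ``class'', is read relative to a type \<open>'u\<close>, passed as
  \<open>TYPE('u)\<close>: a set is small if it has fewer elements than \<open>'u\<close>. If the cardinality of \<open>'u\<close> is
  (strongly) inaccessible, these are the cardinalities of the members of a Grothendieck universe.
  No closure property of \<open>'u\<close> is built into the definitions. Some bound of this kind is needed:
  a category with coproducts indexed by arbitrary sets of HOL elements would be a preorder.
  Small index sets are, up to bijection, small subsets of \<open>'u\<close>, and small abelian groups are,
  up to isomorphism, those with a small subset of \<open>'u\<close> as carrier.
\<close>

definition small :: "'u itself \<Rightarrow> 'a set \<Rightarrow> bool" where
  "small u A \<longleftrightarrow> A \<prec> (UNIV :: 'u set)"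

section \<open>Additive categories\<close>

record ('o, 'm) precat =
  Obj :: "'o set"
  Arr :: "'m set"
  Dom :: "'m \<Rightarrow> 'o"
  Cod :: "'m \<Rightarrow> 'o"
  Ident :: "'o \<Rightarrow> 'm"
  Comp :: "'m \<Rightarrow> 'm \<Rightarrow> 'm" (infixr "\<bullet>\<index>" 75)
  Add :: "'m \<Rightarrow> 'm \<Rightarrow> 'm"
  Zero :: "'o \<Rightarrow> 'o \<Rightarrow> 'm"

definition Hom :: "('o, 'm, 'z) precat_scheme \<Rightarrow> 'o \<Rightarrow> 'o \<Rightarrow> 'm set" where
  "Hom C A B = {f \<in> Arr C. Dom C f = A \<and> Cod C f = B}"

text \<open>The abelian group of maps, written multiplicatively as everywhere in HOL-Algebra.\<close>

definition homgrp :: "('o, 'm, 'z) precat_scheme \<Rightarrow> 'o \<Rightarrow> 'o \<Rightarrow> 'm monoid" where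
  "homgrp C A B = \<lparr>carrier = Hom C A B, monoid.mult = Add C, one = Zero C A B\<rparr>"

definition Neg :: "('o, 'm, 'z) precat_scheme \<Rightarrow> 'm \<Rightarrow> 'm" where
  "Neg C f = inv\<^bsub>homgrp C (Dom C f) (Cod C f)\<^esub> f"

definition opp :: "('o, 'm, 'z) precat_scheme \<Rightarrow> ('o, 'm) precat" where
  "opp C = \<lparr>Obj = Obj C, Arr = Arr C, Dom = Cod C, Cod = Dom C, Ident = Ident C,
     Comp = (\<lambda>g f. f \<bullet>\<^bsub>C\<^esub> g), Add = Add C, Zero = (\<lambda>A B. Zero C B A)\<rparr>"

definition full_sub :: "('o, 'm, 'z) precat_scheme \<Rightarrow> 'o set \<Rightarrow> ('o, 'm) precat" where
  "full_sub C S = \<lparr>Obj = S, Arr = {f \<in> Arr C. Dom C f \<in> S \<and> Cod C f \<in> S}, Dom = Dom C,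
     Cod = Cod C, Ident = Ident C, Comp = Comp C, Add = Add C, Zero = Zero C\<rparr>"

definition isomorphism :: "('o, 'm, 'z) precat_scheme \<Rightarrow> 'm \<Rightarrow> bool" where
  "isomorphism C f \<longleftrightarrow> f \<in> Arr C \<and> (\<exists>g \<in> Hom C (Cod C f) (Dom C f).
     g \<bullet>\<^bsub>C\<^esub> f = Ident C (Dom C f) \<and> f \<bullet>\<^bsub>C\<^esub> g = Ident C (Cod C f))"

definition zero_object :: "('o, 'm, 'z) precat_scheme \<Rightarrow> 'o \<Rightarrow> bool" where
  "zero_object C Z \<longleftrightarrow> Z \<in> Obj C \<and>
     (\<forall>A \<in> Obj C. (\<exists>!f. f \<in> Hom C Z A) \<and> (\<exists>!f. f \<in> Hom C A Z))"

definition is_coproduct ::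
  "('o, 'm, 'z) precat_scheme \<Rightarrow> 'i set \<Rightarrow> ('i \<Rightarrow> 'o) \<Rightarrow> 'o \<Rightarrow> ('i \<Rightarrow> 'm) \<Rightarrow> bool" where
  "is_coproduct C I X P \<iota> \<longleftrightarrow> P \<in> Obj C \<and>
     (\<forall>i \<in> I. X i \<in> Obj C \<and> \<iota> i \<in> Hom C (X i) P) \<and>
     (\<forall>Z \<in> Obj C. \<forall>f. (\<forall>i \<in> I. f i \<in> Hom C (X i) Z) \<longrightarrow>
        (\<exists>!u. u \<in> Hom C P Z \<and> (\<forall>i \<in> I. u \<bullet>\<^bsub>C\<^esub> \<iota> i = f i)))"

definition is_product ::
  "('o, 'm, 'z) precat_scheme \<Rightarrow> 'i set \<Rightarrow> ('i \<Rightarrow> 'o) \<Rightarrow> 'o \<Rightarrow> ('i \<Rightarrow> 'm) \<Rightarrow> bool" where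
  "is_product C = is_coproduct (opp C)"

locale preadditive_category =
  fixes C :: "('o, 'm, 'z) precat_scheme" (structure)
  assumes dom_cod: "f \<in> Arr C \<Longrightarrow> Dom C f \<in> Obj C \<and> Cod C f \<in> Obj C"
    and ident: "A \<in> Obj C \<Longrightarrow> Ident C A \<in> Hom C A A"
    and comp: "f \<in> Hom C A B \<Longrightarrow> g \<in> Hom C B E \<Longrightarrow> g \<bullet> f \<in> Hom C A E"
    and comp_ident: "f \<in> Hom C A B \<Longrightarrow> f \<bullet> Ident C A = f"
    and ident_comp: "f \<in> Hom C A B \<Longrightarrow> Ident C B \<bullet> f = f"
    and comp_assoc: "f \<in> Hom C A B \<Longrightarrow> g \<in> Hom C B E \<Longrightarrow> h \<in> Hom C E F \<Longrightarrow>
      (h \<bullet> g) \<bullet> f = h \<bullet> (g \<bullet> f)"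
    and hom_group: "A \<in> Obj C \<Longrightarrow> B \<in> Obj C \<Longrightarrow> comm_group (homgrp C A B)"
    and comp_add_left: "f \<in> Hom C A B \<Longrightarrow> g \<in> Hom C B E \<Longrightarrow> g' \<in> Hom C B E \<Longrightarrow>
      Add C g g' \<bullet> f = Add C (g \<bullet> f) (g' \<bullet> f)"
    and comp_add_right: "f \<in> Hom C A B \<Longrightarrow> f' \<in> Hom C A B \<Longrightarrow> g \<in> Hom C B E \<Longrightarrow>
      g \<bullet> Add C f f' = Add C (g \<bullet> f) (g \<bullet> f')"

locale additive_category = preadditive_category +
  assumes finite_coproducts: "finite (I :: nat set) \<Longrightarrow> (\<And>i. i \<in> I \<Longrightarrow> X i \<in> Obj C) \<Longrightarrow>
    \<exists>P \<iota>. is_coproduct C I X P \<iota>"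

section \<open>Functors between categories\<close>

record ('o, 'm, 'p, 'n) fctr =
  OM :: "'o \<Rightarrow> 'p"
  AM :: "'m \<Rightarrow> 'n"

definition is_fctr ::
  "('o, 'm, 'y) precat_scheme \<Rightarrow> ('p, 'n, 'z) precat_scheme \<Rightarrow> ('o, 'm, 'p, 'n) fctr \<Rightarrow> bool" where
  "is_fctr C E F \<longleftrightarrow>
     (\<forall>A \<in> Obj C. OM F A \<in> Obj E \<and> AM F (Ident C A) = Ident E (OM F A)) \<and>
     (\<forall>f \<in> Arr C. AM F f \<in> Hom E (OM F (Dom C f)) (OM F (Cod C f))) \<and>
     (\<forall>f \<in> Arr C. \<forall>g \<in> Arr C. Dom C g = Cod C f \<longrightarrow> AM F (g \<bullet>\<^bsub>C\<^esub> f) = AM F g \<bullet>\<^bsub>E\<^esub> AM F f)"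

definition is_additive_fctr ::
  "('o, 'm, 'y) precat_scheme \<Rightarrow> ('p, 'n, 'z) precat_scheme \<Rightarrow> ('o, 'm, 'p, 'n) fctr \<Rightarrow> bool" where
  "is_additive_fctr C E F \<longleftrightarrow> is_fctr C E F \<and>
     (\<forall>A B f g. f \<in> Hom C A B \<longrightarrow> g \<in> Hom C A B \<longrightarrow>
        AM F (Add C f g) = Add E (AM F f) (AM F g))"

definition id_fctr :: "('o, 'm, 'o, 'm) fctr" where
  "id_fctr = \<lparr>OM = (\<lambda>A. A), AM = (\<lambda>f. f)\<rparr>"

definition comp_fctr ::
  "('p, 'n, 'q, 'k) fctr \<Rightarrow> ('o, 'm, 'p, 'n) fctr \<Rightarrow> ('o, 'm, 'q, 'k) fctr" where
  "comp_fctr G F = \<lparr>OM = OM G \<circ> OM F, AM = AM G \<circ> AM F\<rparr>"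

definition is_nat ::
  "('o, 'm, 'y) precat_scheme \<Rightarrow> ('p, 'n, 'z) precat_scheme \<Rightarrow>
   ('o, 'm, 'p, 'n) fctr \<Rightarrow> ('o, 'm, 'p, 'n) fctr \<Rightarrow> ('o \<Rightarrow> 'n) \<Rightarrow> bool" where
  "is_nat C E F G \<eta> \<longleftrightarrow>
     (\<forall>A \<in> Obj C. \<eta> A \<in> Hom E (OM F A) (OM G A)) \<and>
     (\<forall>f \<in> Arr C. AM G f \<bullet>\<^bsub>E\<^esub> \<eta> (Dom C f) = \<eta> (Cod C f) \<bullet>\<^bsub>E\<^esub> AM F f)"

definition is_nat_iso ::
  "('o, 'm, 'y) precat_scheme \<Rightarrow> ('p, 'n, 'z) precat_scheme \<Rightarrow>
   ('o, 'm, 'p, 'n) fctr \<Rightarrow> ('o, 'm, 'p, 'n) fctr \<Rightarrow> ('o \<Rightarrow> 'n) \<Rightarrow> bool" where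
  "is_nat_iso C E F G \<eta> \<longleftrightarrow> is_nat C E F G \<eta> \<and> (\<forall>A \<in> Obj C. isomorphism E (\<eta> A))"

definition adjoint_equivalence ::
  "('o, 'm, 'y) precat_scheme \<Rightarrow> ('p, 'n, 'z) precat_scheme \<Rightarrow>
   ('o, 'm, 'p, 'n) fctr \<Rightarrow> ('p, 'n, 'o, 'm) fctr \<Rightarrow> bool" where
  "adjoint_equivalence C E F G \<longleftrightarrow> is_fctr C E F \<and> is_fctr E C G \<and>
     (\<exists>\<eta> \<epsilon>. is_nat_iso C C id_fctr (comp_fctr G F) \<eta> \<and>
            is_nat_iso E E (comp_fctr F G) id_fctr \<epsilon> \<and>
            (\<forall>A \<in> Obj C. \<epsilon> (OM F A) \<bullet>\<^bsub>E\<^esub> AM F (\<eta> A) = Ident E (OM F A)) \<and>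
            (\<forall>B \<in> Obj E. AM G (\<epsilon> B) \<bullet>\<^bsub>C\<^esub> \<eta> (OM G B) = Ident C (OM G B)))"

section \<open>Triangulated categories\<close>

text \<open>A triple \<open>(f, g, h)\<close> stands for the triangle \<open>X \<rightarrow> Y \<rightarrow> Z \<rightarrow> \<Sigma>X\<close> with these three maps.\<close>

record ('o, 'm) tricat = "('o, 'm) precat" +
  Shift :: "('o, 'm, 'o, 'm) fctr"
  Tri :: "('m \<times> 'm \<times> 'm) set"

abbreviation ShO :: "('o, 'm, 'z) tricat_scheme \<Rightarrow> 'o \<Rightarrow> 'o" where
  "ShO T \<equiv> OM (Shift T)"

abbreviation ShA :: "('o, 'm, 'z) tricat_scheme \<Rightarrow> 'm \<Rightarrow> 'm" where
  "ShA T \<equiv> AM (Shift T)"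

locale triangulated_category = additive_category T
  for T :: "('o, 'm, 'z) tricat_scheme" (structure) +
  assumes shift_additive: "is_additive_fctr T T (Shift T)"
    and shift_fully_faithful: "A \<in> Obj T \<Longrightarrow> B \<in> Obj T \<Longrightarrow>
      bij_betw (ShA T) (Hom T A B) (Hom T (ShO T A) (ShO T B))"
    and shift_essentially_surjective: "B \<in> Obj T \<Longrightarrow>
      \<exists>A \<in> Obj T. \<exists>e \<in> Hom T (ShO T A) B. isomorphism T e"
    and triangle_maps: "(f, g, h) \<in> Tri T \<Longrightarrow>
      \<exists>X Y Z. f \<in> Hom T X Y \<and> g \<in> Hom T Y Z \<and> h \<in> Hom T Z (ShO T X)"
    and TR1_identity: "X \<in> Obj T \<Longrightarrow> zero_object T Z \<Longrightarrow>
      (Ident T X, Zero T X Z, Zero T Z (ShO T X)) \<in> Tri T"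
    and TR1_cone: "f \<in> Arr T \<Longrightarrow> \<exists>g h. (f, g, h) \<in> Tri T"
    and TR1_iso: "\<lbrakk>(f, g, h) \<in> Tri T;
        f \<in> Hom T X Y; g \<in> Hom T Y Z; h \<in> Hom T Z (ShO T X);
        f' \<in> Hom T X' Y'; g' \<in> Hom T Y' Z'; h' \<in> Hom T Z' (ShO T X');
        a \<in> Hom T X X'; b \<in> Hom T Y Y'; c \<in> Hom T Z Z';
        isomorphism T a; isomorphism T b; isomorphism T c;
        b \<bullet> f = f' \<bullet> a; c \<bullet> g = g' \<bullet> b; ShA T a \<bullet> h = h' \<bullet> c\<rbrakk>
      \<Longrightarrow> (f', g', h') \<in> Tri T"
    and TR2: "\<lbrakk>f \<in> Hom T X Y; g \<in> Hom T Y Z; h \<in> Hom T Z (ShO T X)\<rbrakk>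
      \<Longrightarrow> (f, g, h) \<in> Tri T \<longleftrightarrow> (g, h, Neg T (ShA T f)) \<in> Tri T"
    and TR3: "\<lbrakk>(f, g, h) \<in> Tri T; (f', g', h') \<in> Tri T;
        a \<in> Hom T (Dom T f) (Dom T f'); b \<in> Hom T (Cod T f) (Cod T f'); b \<bullet> f = f' \<bullet> a\<rbrakk>
      \<Longrightarrow> \<exists>c \<in> Hom T (Cod T g) (Cod T g'). c \<bullet> g = g' \<bullet> b \<and> ShA T a \<bullet> h = h' \<bullet> c"
    and TR4: "\<lbrakk>f \<in> Hom T X Y; g \<in> Hom T Y Z;
        (f, i, j) \<in> Tri T; (g, k, l) \<in> Tri T; (g \<bullet> f, m, n) \<in> Tri T\<rbrakk>
      \<Longrightarrow> \<exists>u \<in> Hom T (Cod T i) (Cod T m). \<exists>v \<in> Hom T (Cod T m) (Cod T k).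
        (u, v, ShA T i \<bullet> l) \<in> Tri T \<and>
        u \<bullet> i = m \<bullet> g \<and> n \<bullet> u = j \<and> v \<bullet> m = k \<and> l \<bullet> v = ShA T f \<bullet> n"

text \<open>
  Exactness of \<open>Q : T\<^sup>o\<^sup>p \<rightarrow> U\<close>: the suspension of \<open>T\<^sup>o\<^sup>p\<close> is a quasi-inverse of \<open>\<Sigma>\<close>, so commuting with
  suspensions amounts to a natural isomorphism \<open>\<theta>\<^sub>X : Q X \<rightarrow> \<Sigma> Q \<Sigma> X\<close>, and \<open>X \<rightarrow> Y \<rightarrow> Z \<rightarrow> \<Sigma>X\<close> has to be
  sent to the triangle \<open>Q Z \<rightarrow> Q Y \<rightarrow> Q X \<rightarrow> \<Sigma> Q Z\<close>. The sign convention for the triangles of \<open>T\<^sup>o\<^sup>p\<close>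
  does not matter, as \<open>\<theta>\<close> may be replaced by \<open>-\<theta>\<close>.
\<close>

definition is_contra_exact ::
  "('o, 'm, 'y) tricat_scheme \<Rightarrow> ('p, 'n, 'z) tricat_scheme \<Rightarrow> ('o, 'm, 'p, 'n) fctr \<Rightarrow> bool" where
  "is_contra_exact T U Q \<longleftrightarrow> is_additive_fctr (opp T) U Q \<and>
     (\<exists>\<theta>. is_nat_iso (opp T) U Q (comp_fctr (Shift U) (comp_fctr Q (Shift T))) \<theta> \<and>
       (\<forall>f g h. (f, g, h) \<in> Tri T \<longrightarrow>
          (AM Q g, AM Q f, ShA U (AM Q h) \<bullet>\<^bsub>U\<^esub> \<theta> (Dom T f)) \<in> Tri U))"

section \<open>Compactly generated triangulated categories\<close>

definition locally_small :: "'u itself \<Rightarrow> ('o, 'm, 'z) precat_scheme \<Rightarrow> bool" where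
  "locally_small u C \<longleftrightarrow> (\<forall>A \<in> Obj C. \<forall>B \<in> Obj C. small u (Hom C A B))"

definition has_small_coproducts :: "'u itself \<Rightarrow> ('o, 'm, 'z) precat_scheme \<Rightarrow> bool" where
  "has_small_coproducts u C \<longleftrightarrow>
     (\<forall>(I :: 'u set) X. small u I \<longrightarrow> (\<forall>i \<in> I. X i \<in> Obj C) \<longrightarrow> (\<exists>P \<iota>. is_coproduct C I X P \<iota>))"

text \<open>\<open>C\<close> is compact if the canonical map \<open>\<Oplus>\<^sub>i Hom(C, X\<^sub>i) \<rightarrow> Hom(C, \<Oplus>\<^sub>i X\<^sub>i)\<close> is always bijective.\<close>

definition compacts :: "'u itself \<Rightarrow> ('o, 'm, 'z) precat_scheme \<Rightarrow> 'o set" where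
  "compacts u T = {C \<in> Obj T. \<forall>(I :: 'u set) X P \<iota>. small u I \<longrightarrow> is_coproduct T I X P \<iota> \<longrightarrow>
     (\<lambda>x. gfinprod (homgrp T C P) (\<lambda>i. \<iota> i \<bullet>\<^bsub>T\<^esub> x i) I)
       \<in> iso (sum_group I (\<lambda>i. homgrp T C (X i))) (homgrp T C P)}"

definition cpt :: "'u itself \<Rightarrow> ('o, 'm, 'z) precat_scheme \<Rightarrow> ('o, 'm) precat" where
  "cpt u T = full_sub T (compacts u T)"

text \<open>
  Since shifts of compact objects are compact, a generating set may be enlarged to one closed
  under all shifts; hence no shifts of \<open>X\<close> are mentioned below.
\<close>

definition compactly_generated :: "'u itself \<Rightarrow> ('o, 'm, 'z) tricat_scheme \<Rightarrow> bool" where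
  "compactly_generated u T \<longleftrightarrow> triangulated_category T \<and> locally_small u T \<and>
     has_small_coproducts u T \<and>
     (\<exists>\<G> \<subseteq> compacts u T. small u \<G> \<and>
        (\<forall>X \<in> Obj T. (\<forall>G \<in> \<G>. trivial_group (homgrp T G X)) \<longrightarrow> zero_object T X))"

section \<open>Functors to abelian groups\<close>

record ('o, 'm, 'g) abfun =
  FObj :: "'o \<Rightarrow> 'g monoid"
  FArr :: "'m \<Rightarrow> 'g \<Rightarrow> 'g"

definition is_abfun :: "('o, 'm, 'z) precat_scheme \<Rightarrow> ('o, 'm, 'g) abfun \<Rightarrow> bool" where
  "is_abfun C F \<longleftrightarrow>
     (\<forall>A \<in> Obj C. comm_group (FObj F A) \<and> (\<forall>x \<in> carrier (FObj F A). FArr F (Ident C A) x = x)) \<and>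
     (\<forall>f \<in> Arr C. FArr F f \<in> hom (FObj F (Dom C f)) (FObj F (Cod C f))) \<and>
     (\<forall>f \<in> Arr C. \<forall>g \<in> Arr C. Dom C g = Cod C f \<longrightarrow>
        (\<forall>x \<in> carrier (FObj F (Dom C f)). FArr F (g \<bullet>\<^bsub>C\<^esub> f) x = FArr F g (FArr F f x))) \<and>
     (\<forall>A B f g. f \<in> Hom C A B \<longrightarrow> g \<in> Hom C A B \<longrightarrow> (\<forall>x \<in> carrier (FObj F A).
        FArr F (Add C f g) x = FArr F f x \<otimes>\<^bsub>FObj F B\<^esub> FArr F g x))"

definition is_small_abfun ::
  "'u itself \<Rightarrow> ('o, 'm, 'z) precat_scheme \<Rightarrow> ('o, 'm, 'u) abfun \<Rightarrow> bool" where
  "is_small_abfun u C F \<longleftrightarrow> is_abfun C F \<and> (\<forall>A \<in> Obj C. small u (carrier (FObj F A)))"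

definition is_abnat ::
  "('o, 'm, 'z) precat_scheme \<Rightarrow> ('o, 'm, 'g) abfun \<Rightarrow> ('o, 'm, 'h) abfun \<Rightarrow>
   ('o \<Rightarrow> 'g \<Rightarrow> 'h) \<Rightarrow> bool" where
  "is_abnat C F G \<tau> \<longleftrightarrow>
     (\<forall>A \<in> Obj C. \<tau> A \<in> hom (FObj F A) (FObj G A)) \<and>
     (\<forall>f \<in> Arr C. \<forall>x \<in> carrier (FObj F (Dom C f)).
        FArr G f (\<tau> (Dom C f) x) = \<tau> (Cod C f) (FArr F f x))"

definition is_abnat_iso ::
  "('o, 'm, 'z) precat_scheme \<Rightarrow> ('o, 'm, 'g) abfun \<Rightarrow> ('o, 'm, 'h) abfun \<Rightarrow>
   ('o \<Rightarrow> 'g \<Rightarrow> 'h) \<Rightarrow> bool" where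
  "is_abnat_iso C F G \<tau> \<longleftrightarrow> is_abnat C F G \<tau> \<and> (\<forall>A \<in> Obj C. \<tau> A \<in> iso (FObj F A) (FObj G A))"

text \<open>The group of natural transformations; restricting them makes equality extensional.\<close>

definition nat_group ::
  "('o, 'm, 'z) precat_scheme \<Rightarrow> ('o, 'm, 'g) abfun \<Rightarrow> ('o, 'm, 'h) abfun \<Rightarrow>
   ('o \<Rightarrow> 'g \<Rightarrow> 'h) monoid" where
  "nat_group C F G = \<lparr>
     carrier = {\<tau>. is_abnat C F G \<tau> \<and> \<tau> \<in> extensional (Obj C) \<and>
                   (\<forall>A \<in> Obj C. \<tau> A \<in> extensional (carrier (FObj F A)))},
     monoid.mult = (\<lambda>\<sigma> \<tau>. \<lambda>A \<in> Obj C. \<lambda>x \<in> carrier (FObj F A). \<sigma> A x \<otimes>\<^bsub>FObj G A\<^esub> \<tau> A x),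
     one = (\<lambda>A \<in> Obj C. \<lambda>x \<in> carrier (FObj F A). \<one>\<^bsub>FObj G A\<^esub>)\<rparr>"

definition hom_fun :: "('o, 'm, 'z) precat_scheme \<Rightarrow> 'o \<Rightarrow> ('o, 'm, 'm) abfun" where
  "hom_fun C A = \<lparr>FObj = homgrp C A, FArr = (\<lambda>f g. f \<bullet>\<^bsub>C\<^esub> g)\<rparr>"

text \<open>
  Covariant functors on \<open>opp (cpt u T)\<close> with values in small abelian groups are the objects of
  \<open>Mod(T\<^sup>c)\<close>. The values of \<open>yoneda T X\<close> are carried by sets of maps of \<open>T\<close> instead of subsets of
  \<open>'u\<close>, which is why the functor tested for injectivity may have any type of elements.
\<close>

definition yoneda :: "('o, 'm, 'z) precat_scheme \<Rightarrow> 'o \<Rightarrow> ('o, 'm, 'm) abfun" where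
  "yoneda T X = hom_fun (opp T) X"

definition yoneda_map :: "('o, 'm, 'z) precat_scheme \<Rightarrow> 'm \<Rightarrow> 'o \<Rightarrow> 'm \<Rightarrow> 'm" where
  "yoneda_map T f = (\<lambda>C g. f \<bullet>\<^bsub>T\<^esub> g)"

definition is_short_exact ::
  "('o, 'm, 'z) precat_scheme \<Rightarrow> ('o, 'm, 'g) abfun \<Rightarrow> ('o, 'm, 'h) abfun \<Rightarrow> ('o, 'm, 'k) abfun \<Rightarrow>
   ('o \<Rightarrow> 'g \<Rightarrow> 'h) \<Rightarrow> ('o \<Rightarrow> 'h \<Rightarrow> 'k) \<Rightarrow> bool" where
  "is_short_exact C F G H \<sigma> \<tau> \<longleftrightarrow> is_abnat C F G \<sigma> \<and> is_abnat C G H \<tau> \<and>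
     (\<forall>A \<in> Obj C. inj_on (\<sigma> A) (carrier (FObj F A)) \<and>
        \<sigma> A ` carrier (FObj F A) = kernel (FObj G A) (FObj H A) (\<tau> A) \<and>
        \<tau> A ` carrier (FObj G A) = carrier (FObj H A))"

definition is_injective ::
  "'u itself \<Rightarrow> ('o, 'm, 'z) precat_scheme \<Rightarrow> ('o, 'm, 'g) abfun \<Rightarrow> bool" where
  "is_injective u C E \<longleftrightarrow>
     (\<forall>(M :: ('o, 'm, 'u) abfun) (N :: ('o, 'm, 'u) abfun) \<mu> \<phi>.
        is_small_abfun u C M \<longrightarrow> is_small_abfun u C N \<longrightarrow>
        is_abnat C M N \<mu> \<longrightarrow> (\<forall>A \<in> Obj C. inj_on (\<mu> A) (carrier (FObj M A))) \<longrightarrow>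
        is_abnat C M E \<phi> \<longrightarrow>
        (\<exists>\<psi>. is_abnat C N E \<psi> \<and>
           (\<forall>A \<in> Obj C. \<forall>x \<in> carrier (FObj M A). \<psi> A (\<mu> A x) = \<phi> A x)))"

definition pure_mono :: "'u itself \<Rightarrow> ('o, 'm, 'z) tricat_scheme \<Rightarrow> 'm \<Rightarrow> bool" where
  "pure_mono u T f \<longleftrightarrow> (\<exists>g h. (f, g, h) \<in> Tri T \<and>
     is_short_exact (opp (cpt u T))
       (yoneda T (Dom T f)) (yoneda T (Cod T f)) (yoneda T (Cod T g))
       (yoneda_map T f) (yoneda_map T g))"

definition pure_injective :: "'u itself \<Rightarrow> ('o, 'm, 'z) tricat_scheme \<Rightarrow> 'o \<Rightarrow> bool" where
  "pure_injective u T X \<longleftrightarrow> X \<in> Obj T \<and> is_injective u (opp (cpt u T)) (yoneda T X)"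

section \<open>Duality triples and AGJ duality triples\<close>

definition duality_triple ::
  "'u itself \<Rightarrow> ('o, 'm) tricat \<Rightarrow> ('p, 'n) tricat \<Rightarrow>
   ('o, 'm, 'p, 'n) fctr \<Rightarrow> ('p, 'n, 'o, 'm) fctr \<Rightarrow> bool" where
  "duality_triple u T U QT QU \<longleftrightarrow>
     compactly_generated u T \<and> compactly_generated u U \<and>
     is_contra_exact T U QT \<and> is_contra_exact U T QU \<and>
     (\<forall>X \<in> Obj T. pure_injective u U (OM QT X)) \<and>
     (\<forall>Y \<in> Obj U. pure_injective u T (OM QU Y)) \<and>
     (\<exists>iT iU.
        is_nat T T id_fctr (comp_fctr QU QT) iT \<and> (\<forall>X \<in> Obj T. pure_mono u T (iT X)) \<and>
        is_nat U U id_fctr (comp_fctr QT QU) iU \<and> (\<forall>Y \<in> Obj U. pure_mono u U (iU Y)) \<and>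
        (\<forall>X \<in> Obj T. AM QT (iT X) \<bullet>\<^bsub>U\<^esub> iU (OM QT X) = Ident U (OM QT X)) \<and>
        (\<forall>Y \<in> Obj U. AM QU (iU Y) \<bullet>\<^bsub>T\<^esub> iT (OM QU Y) = Ident T (OM QU Y))) \<and>
     (\<forall>(I :: 'u set) X P \<iota>. small u I \<longrightarrow> is_coproduct T I X P \<iota> \<longrightarrow>
        (\<exists>\<pi>. is_product U I (\<lambda>i. OM QT (X i)) (OM QT P) \<pi>)) \<and>
     (\<forall>(I :: 'u set) Y P \<iota>. small u I \<longrightarrow> is_coproduct U I Y P \<iota> \<longrightarrow>
        (\<exists>\<pi>. is_product T I (\<lambda>i. OM QU (Y i)) (OM QU P) \<pi>))"

definition hom_group :: "('a, 'y) monoid_scheme \<Rightarrow> ('b, 'z) monoid_scheme \<Rightarrow> ('a \<Rightarrow> 'b) monoid" where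
  "hom_group G H = \<lparr>carrier = hom G H \<inter> extensional (carrier G),
     monoid.mult = (\<lambda>\<phi> \<psi>. \<lambda>x \<in> carrier G. \<phi> x \<otimes>\<^bsub>H\<^esub> \<psi> x),
     one = (\<lambda>x \<in> carrier G. \<one>\<^bsub>H\<^esub>)\<rparr>"

definition QmodZ :: "rat set monoid" where
  "QmodZ = \<lparr>carrier = (UNIV :: rat set), monoid.mult = (+), one = 0\<rparr> Mod \<int>"

text \<open>
  \<open>Hom\<^sub>\<int>(Hom(C, X), \<rat>/\<int>) \<cong> Hom(D C, Q X)\<close>, naturally in \<open>C\<close> and \<open>X\<close>. For \<open>c : C \<rightarrow> C'\<close> and
  \<open>a : X \<rightarrow> X'\<close> the left side maps \<open>Hom(C, X')\<^sup>* \<rightarrow> Hom(C', X)\<^sup>*\<close>.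
\<close>

definition AGJ_isos ::
  "'u itself \<Rightarrow> ('o, 'm, 'y) tricat_scheme \<Rightarrow> ('p, 'n, 'z) tricat_scheme \<Rightarrow>
   ('o, 'm, 'p, 'n) fctr \<Rightarrow> ('o, 'm, 'p, 'n) fctr \<Rightarrow> bool" where
  "AGJ_isos u T U Q D \<longleftrightarrow> (\<exists>\<Phi>.
     (\<forall>C \<in> compacts u T. \<forall>X \<in> Obj T.
        \<Phi> C X \<in> iso (hom_group (homgrp T C X) QmodZ) (homgrp U (OM D C) (OM Q X))) \<and>
     (\<forall>C \<in> compacts u T. \<forall>C' \<in> compacts u T. \<forall>X \<in> Obj T. \<forall>X' \<in> Obj T.
        \<forall>c \<in> Hom T C C'. \<forall>a \<in> Hom T X X'. \<forall>\<phi> \<in> carrier (hom_group (homgrp T C X') QmodZ).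
          \<Phi> C' X (\<lambda>g \<in> Hom T C' X. \<phi> (a \<bullet>\<^bsub>T\<^esub> g \<bullet>\<^bsub>T\<^esub> c)) = AM Q a \<bullet>\<^bsub>U\<^esub> \<Phi> C X' \<phi> \<bullet>\<^bsub>U\<^esub> AM D c))"

definition AGJ_duality_triple ::
  "'u itself \<Rightarrow> ('o, 'm) tricat \<Rightarrow> ('p, 'n) tricat \<Rightarrow>
   ('o, 'm, 'p, 'n) fctr \<Rightarrow> ('p, 'n, 'o, 'm) fctr \<Rightarrow>
   ('o, 'm, 'p, 'n) fctr \<Rightarrow> ('p, 'n, 'o, 'm) fctr \<Rightarrow> bool" where
  "AGJ_duality_triple u T U QT QU DT DU \<longleftrightarrow> duality_triple u T U QT QU \<and>
     is_fctr (opp (cpt u T)) (cpt u U) DT \<and> is_fctr (opp (cpt u U)) (cpt u T) DU \<and>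
     adjoint_equivalence (cpt u T) (opp (cpt u U)) DT DU \<and>
     AGJ_isos u T U QT DT \<and> AGJ_isos u U T QU DU"

section \<open>Duality pairs\<close>

definition closed_under_finite_coproducts :: "('o, 'm, 'z) precat_scheme \<Rightarrow> 'o set \<Rightarrow> bool" where
  "closed_under_finite_coproducts C S \<longleftrightarrow>
     (\<forall>(I :: nat set) X P \<iota>. finite I \<longrightarrow> (\<forall>i \<in> I. X i \<in> S) \<longrightarrow> is_coproduct C I X P \<iota> \<longrightarrow> P \<in> S)"

definition closed_under_retracts :: "('o, 'm, 'z) precat_scheme \<Rightarrow> 'o set \<Rightarrow> bool" where
  "closed_under_retracts C S \<longleftrightarrow>
     (\<forall>X \<in> S. \<forall>Y \<in> Obj C. \<forall>s \<in> Hom C Y X. \<forall>r \<in> Hom C X Y. r \<bullet>\<^bsub>C\<^esub> s = Ident C Y \<longrightarrow> Y \<in> S)"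

definition closed_under_products :: "'u itself \<Rightarrow> ('o, 'm, 'z) precat_scheme \<Rightarrow> 'o set \<Rightarrow> bool" where
  "closed_under_products u C S \<longleftrightarrow>
     (\<forall>(I :: 'u set) X P \<pi>. small u I \<longrightarrow> (\<forall>i \<in> I. X i \<in> S) \<longrightarrow> is_product C I X P \<pi> \<longrightarrow> P \<in> S)"

definition duality_pair ::
  "('o, 'm) tricat \<Rightarrow> ('p, 'n) tricat \<Rightarrow> ('o, 'm, 'p, 'n) fctr \<Rightarrow> 'o set \<Rightarrow> 'p set \<Rightarrow> bool" where
  "duality_pair T U Q \<A> \<B> \<longleftrightarrow> \<A> \<subseteq> Obj T \<and> \<B> \<subseteq> Obj U \<and>
     (\<forall>X \<in> Obj T. X \<in> \<A> \<longleftrightarrow> OM Q X \<in> \<B>) \<and>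
     closed_under_finite_coproducts U \<B> \<and> closed_under_retracts U \<B>"

definition symmetric_duality_pair ::
  "('o, 'm) tricat \<Rightarrow> ('p, 'n) tricat \<Rightarrow> ('o, 'm, 'p, 'n) fctr \<Rightarrow> ('p, 'n, 'o, 'm) fctr \<Rightarrow>
   'o set \<Rightarrow> 'p set \<Rightarrow> bool" where
  "symmetric_duality_pair T U QT QU \<A> \<B> \<longleftrightarrow>
     duality_pair T U QT \<A> \<B> \<and> duality_pair U T QU \<B> \<A>"

definition product_closed_duality_pair ::
  "'u itself \<Rightarrow> ('o, 'm) tricat \<Rightarrow> ('p, 'n) tricat \<Rightarrow> ('o, 'm, 'p, 'n) fctr \<Rightarrow>
   'o set \<Rightarrow> 'p set \<Rightarrow> bool" where
  "product_closed_duality_pair u T U Q \<A> \<B> \<longleftrightarrow>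
     duality_pair T U Q \<A> \<B> \<and> closed_under_products u T \<A>"

section \<open>Definable subcategories and their duals\<close>

definition definable :: "'u itself \<Rightarrow> ('o, 'm, 'z) precat_scheme \<Rightarrow> 'o set \<Rightarrow> bool" where
  "definable u T \<D> \<longleftrightarrow> (\<exists>F \<subseteq> Arr (cpt u T). small u F \<and>
     \<D> = {X \<in> Obj T. \<forall>f \<in> F. (\<lambda>g. g \<bullet>\<^bsub>T\<^esub> f) ` Hom T (Cod T f) X = Hom T (Dom T f) X})"

text \<open>The maps \<open>Dom f \<rightarrow> X\<close> which factor through \<open>f\<close>, and the cokernel functor of
  \<open>Hom(f, -) : Hom(Cod f, -) \<rightarrow> Hom(Dom f, -)\<close>, whose values consist of cosets.\<close>

definition factoring :: "('o, 'm, 'z) precat_scheme \<Rightarrow> 'm \<Rightarrow> 'o \<Rightarrow> 'm set" where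
  "factoring C f X = (\<lambda>g. g \<bullet>\<^bsub>C\<^esub> f) ` Hom C (Cod C f) X"

definition coker_fun :: "('o, 'm, 'z) precat_scheme \<Rightarrow> 'm \<Rightarrow> ('o, 'm, 'm set) abfun" where
  "coker_fun C f = \<lparr>FObj = (\<lambda>X. homgrp C (Dom C f) X Mod factoring C f X),
     FArr = (\<lambda>h c. \<Union>x \<in> c.
       factoring C f (Cod C h) #>\<^bsub>homgrp C (Dom C f) (Cod C h)\<^esub> (h \<bullet>\<^bsub>C\<^esub> x))\<rparr>"

definition presents :: "('o, 'm, 'z) precat_scheme \<Rightarrow> 'm \<Rightarrow> ('o, 'm, 'g) abfun \<Rightarrow> bool" where
  "presents C f G \<longleftrightarrow> f \<in> Arr C \<and> (\<exists>\<tau>. is_abnat_iso C G (coker_fun C f) \<tau>)"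

definition fp_funs :: "'u itself \<Rightarrow> ('o, 'm, 'z) precat_scheme \<Rightarrow> ('o, 'm, 'u) abfun set" where
  "fp_funs u C = {G. is_small_abfun u C G \<and> (\<exists>f. presents C f G)}"

text \<open>The extension of a finitely presented functor from \<open>T\<^sup>c\<close> to \<open>T\<close>. Up to isomorphism it does not
  depend on the choice of the presentation.\<close>

definition tilde ::
  "'u itself \<Rightarrow> ('o, 'm, 'z) precat_scheme \<Rightarrow> ('o, 'm, 'g) abfun \<Rightarrow> ('o, 'm, 'm set) abfun" where
  "tilde u T G = coker_fun T (SOME f. presents (cpt u T) f G)"

definition annihilator ::
  "'u itself \<Rightarrow> ('o, 'm, 'z) precat_scheme \<Rightarrow> 'o set \<Rightarrow> ('o, 'm, 'u) abfun set" where
  "annihilator u T \<D> =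
     {G \<in> fp_funs u (cpt u T). \<forall>X \<in> \<D>. trivial_group (FObj (tilde u T G) X)}"

text \<open>\<open>(\<delta> G)(Y) = Hom(G, Hom\<^sub>T(D Y, -))\<close>; a map \<open>v : Y \<rightarrow> Y'\<close> acts by precomposition with
  \<open>D v : D Y' \<rightarrow> D Y\<close>.\<close>

definition delta ::
  "'u itself \<Rightarrow> ('o, 'm, 'y) precat_scheme \<Rightarrow> ('p, 'n, 'o, 'm) fctr \<Rightarrow>
   ('o, 'm, 'g) abfun \<Rightarrow> ('p, 'n, 'o \<Rightarrow> 'g \<Rightarrow> 'm) abfun" where
  "delta u T DU G = \<lparr>FObj = (\<lambda>Y. nat_group (cpt u T) G (hom_fun (cpt u T) (OM DU Y))),
     FArr = (\<lambda>v \<tau>. \<lambda>A \<in> compacts u T. \<lambda>x \<in> carrier (FObj G A). \<tau> A x \<bullet>\<^bsub>T\<^esub> AM DU v)\<rparr>"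

definition dual_definable ::
  "'u itself \<Rightarrow> ('o, 'm, 'y) precat_scheme \<Rightarrow> ('p, 'n, 'z) precat_scheme \<Rightarrow>
   ('p, 'n, 'o, 'm) fctr \<Rightarrow> 'o set \<Rightarrow> 'p set" where
  "dual_definable u T U DU \<D> =
     {Y \<in> Obj U. \<forall>H \<in> delta u T DU ` annihilator u T \<D>. trivial_group (FObj (tilde u U H) Y)}"

end

theory Submission
  imports Defs
begin

text \<open>
  For a map \<open>f\<close> of compact objects call \<open>X\<close> injective with respect to \<open>f\<close> if \<open>Hom(f, X)\<close> is
  surjective, and separated if it is injective. Since \<open>\<rat>/\<int>\<close> is an injective cogenerator of abelian
  groups, the isomorphisms \<open>Hom(C, X)\<^sup>* \<cong> Hom(D C, Q X)\<close> show that \<open>X\<close> is injective with respect to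
  \<open>f\<close> iff \<open>Q X\<close> is separated with respect to \<open>D f\<close>, and conversely. A functor \<open>G\<close> presented by
  \<open>f : A \<rightarrow> B\<close> has \<open>(\<delta> G)(Y) \<cong> {g : D Y \<rightarrow> A. f g = 0} \<cong> {y : D A \<rightarrow> Y. y (D f) = 0}\<close>, so for the
  triangle \<open>D B \<rightarrow> D A \<rightarrow> M \<rightarrow> \<Sigma> D B\<close> on \<open>D f\<close> the functor \<open>\<delta> G\<close> is presented by \<open>M \<rightarrow> \<Sigma> D B\<close>, and
  its extension vanishes on \<open>Y\<close> iff \<open>Y\<close> is separated with respect to \<open>D f\<close>. If \<open>S\<close> is the class of
  maps with respect to which all objects of \<open>\<D>\<close> are injective, then \<open>\<D>\<close> consists of the objects
  injective, and \<open>\<D>\<^sup>d\<close> of the objects separated, with respect to \<open>S\<close> and \<open>D S\<close>, which gives both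
  halves of the symmetric duality pair.
\<close>

section \<open>Extending homomorphisms into divisible groups\<close>

text \<open>Three obstacles shape the proof. \<open>tilde\<close> is computed from an arbitrarily
  chosen presentation, so its vanishing on objects that are not compact has to be shown independent
  of the choice; presentations are handled as universal elements for this purpose. The map M ->
  \<Sigma> D B can present a functor on the compacts only if both of its ends are compact, so
  compacts must be closed under shifts and cones; compactness is therefore rewritten as absorption
  by finite truncations of a coproduct. Finally, \<open>delta\<close> yields additive functors only
  if D is additive, which is derived from the AGJ isomorphisms and the pure monomorphisms X -> Q Q
  X. Taking for S all maps along which \<D> is injective, instead of one defining set, matches the
  annihilator: its members are exactly the functors with small values that are presented by maps in
  S. Conversely every map in S presents such a functor, because Hom sets are small. For the second
  half of the symmetry, separatedness of Y along D f becomes injectivity of Q Y along D D f, and the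
  unit of the equivalence identifies D D f with f.\<close>

locale partial_homs = G: comm_group G + E: comm_group E
  for G :: "('a, 'y) monoid_scheme" and E :: "('b, 'z) monoid_scheme"
begin

text \<open>Homomorphisms on subgroups are encoded by their graphs: extension becomes inclusion, and
  Zorn's lemma applies to unions of chains. For a subgroup of the product, being single-valued need
  only be required over the identity.\<close>

definition partial_hom :: "('a \<times> 'b) set \<Rightarrow> bool" where
  "partial_hom R \<longleftrightarrow> subgroup R (G \<times>\<times> E) \<and> (\<forall>e. (\<one>\<^bsub>G\<^esub>, e) \<in> R \<longrightarrow> e = \<one>\<^bsub>E\<^esub>)"

lemma partial_hom_subgroup: "partial_hom R \<Longrightarrow> subgroup R (G \<times>\<times> E)"
  by (simp add: partial_hom_def)

lemma partial_hom_one_unique: "partial_hom R \<Longrightarrow> (\<one>\<^bsub>G\<^esub>, e) \<in> R \<Longrightarrow> e = \<one>\<^bsub>E\<^esub>"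
  by (simp add: partial_hom_def)

lemma group_DirProd: "group (G \<times>\<times> E)"
  by (simp add: DirProd_group G.is_group E.is_group)

lemma comm_group_DirProd: "comm_group (G \<times>\<times> E)"
  by (rule group.group_comm_groupI[OF group_DirProd]) (auto simp: G.m_comm E.m_comm)

lemma partial_hom_closed:
  assumes "partial_hom R" "(x, e) \<in> R"
  shows "x \<in> carrier G" "e \<in> carrier E"
  using assms(2) subgroup.subset[OF partial_hom_subgroup[OF assms(1)]] by auto

lemma partial_hom_mult:
  assumes "partial_hom R" "(x, e) \<in> R" "(x', e') \<in> R"
  shows "(x \<otimes>\<^bsub>G\<^esub> x', e \<otimes>\<^bsub>E\<^esub> e') \<in> R"
  using subgroup.m_closed[OF partial_hom_subgroup[OF assms(1)] assms(2,3)] by simp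

lemma partial_hom_one:
  assumes "partial_hom R"
  shows "(\<one>\<^bsub>G\<^esub>, \<one>\<^bsub>E\<^esub>) \<in> R"
  using subgroup.one_closed[OF partial_hom_subgroup[OF assms]] by simp

lemma partial_hom_inv:
  assumes "partial_hom R" "(x, e) \<in> R"
  shows "(inv\<^bsub>G\<^esub> x, inv\<^bsub>E\<^esub> e) \<in> R"
  using subgroup.m_inv_closed[OF partial_hom_subgroup[OF assms(1)] assms(2)] partial_hom_closed[OF assms] assms(1)
  by (simp add: G.is_group E.is_group)

lemma partial_hom_fun:
  assumes R: "partial_hom R" "(x, e) \<in> R" "(x, e') \<in> R"
  shows "e = e'"
proof -
  have "(inv\<^bsub>G\<^esub> x \<otimes>\<^bsub>G\<^esub> x, inv\<^bsub>E\<^esub> e \<otimes>\<^bsub>E\<^esub> e') \<in> R"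
    using assms by (intro partial_hom_mult partial_hom_inv)
  then have "inv\<^bsub>E\<^esub> e \<otimes>\<^bsub>E\<^esub> e' = \<one>\<^bsub>E\<^esub>"
    using partial_hom_one_unique[OF R(1)] partial_hom_closed[OF R(1,2)] by simp
  then show ?thesis
    using partial_hom_closed[OF R(1,2)] partial_hom_closed[OF R(1,3)]
    by (metis E.inv_closed E.inv_equality E.inv_inv)
qed

lemma nat_pow_DirProd: "(x, e) [^]\<^bsub>G \<times>\<times> E\<^esub> (n :: nat) = (x [^]\<^bsub>G\<^esub> n, e [^]\<^bsub>E\<^esub> n)"
  by (induction n) auto

lemma int_pow_DirProd:
  assumes "x \<in> carrier G" "e \<in> carrier E"
  shows "(x, e) [^]\<^bsub>G \<times>\<times> E\<^esub> (k :: int) = (x [^]\<^bsub>G\<^esub> k, e [^]\<^bsub>E\<^esub> k)"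
  using assms by (simp add: int_pow_def2 nat_pow_DirProd G.is_group E.is_group del: pow_nat)

lemma partial_hom_int_pow:
  assumes "partial_hom R" "(x, e) \<in> R"
  shows "(x [^]\<^bsub>G\<^esub> (k :: int), e [^]\<^bsub>E\<^esub> k) \<in> R"
  using group.subgroup_int_pow_closed[OF group_DirProd, of R "(x, e)" k] assms
    int_pow_DirProd[of x e k] partial_hom_closed[OF assms] by (simp add: partial_hom_subgroup)

text \<open>The new graph is \<open>R\<close> multiplied by the cyclic group generated by
  \<open>(x, e)\<close>. It could fail to be single-valued only through a power of \<open>x\<close>
  that lies in the domain of \<open>R\<close>, and \<open>compat\<close> says that \<open>e\<close>
  respects all such relations.\<close>

lemma partial_hom_adjoin:
  assumes R: "partial_hom R" and x: "x \<in> carrier G" and e: "e \<in> carrier E"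
    and compat: "\<And>k :: int. x [^]\<^bsub>G\<^esub> k \<in> Domain R \<Longrightarrow> (x [^]\<^bsub>G\<^esub> k, e [^]\<^bsub>E\<^esub> k) \<in> R"
  obtains R' where "partial_hom R'" "R \<subseteq> R'" "(x, e) \<in> R'"
proof
  interpret GE: comm_group "G \<times>\<times> E" by (rule comm_group_DirProd)
  let ?Z = "generate (G \<times>\<times> E) {(x, e)}"
  let ?R = "R <#>\<^bsub>G \<times>\<times> E\<^esub> ?Z"
  have subR: "subgroup R (G \<times>\<times> E)" using R by (rule partial_hom_subgroup)
  have subZ: "subgroup ?Z (G \<times>\<times> E)" using x e by (intro GE.generate_is_subgroup) auto
  have oneR: "\<one>\<^bsub>G \<times>\<times> E\<^esub> \<in> R" using subR by (rule subgroup.one_closed)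
  show "partial_hom ?R"
    unfolding partial_hom_def
  proof (intro conjI allI impI)
    show "subgroup ?R (G \<times>\<times> E)" using subR subZ by (rule GE.mult_subgroups)
    fix d assume "(\<one>\<^bsub>G\<^esub>, d) \<in> ?R"
    then obtain r z where rz: "r \<in> R" "z \<in> ?Z" "(\<one>\<^bsub>G\<^esub>, d) = r \<otimes>\<^bsub>G \<times>\<times> E\<^esub> z"
      by (auto simp: set_mult_def)
    obtain y d' where r: "r = (y, d')" by (cases r)
    from rz(2) obtain k :: int where z: "z = (x [^]\<^bsub>G\<^esub> k, e [^]\<^bsub>E\<^esub> k)"
      using x e GE.generate_pow[of "(x, e)"] by (auto simp: int_pow_DirProd)
    have y: "y \<in> carrier G" using partial_hom_closed R rz(1) r by blast
    have eq: "y \<otimes>\<^bsub>G\<^esub> x [^]\<^bsub>G\<^esub> k = \<one>\<^bsub>G\<^esub>" "d = d' \<otimes>\<^bsub>E\<^esub> e [^]\<^bsub>E\<^esub> k" using rz(3) r z by auto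
    \<comment> \<open>Since the product of \<open>y\<close> and the \<open>k\<close>-th power of
      \<open>x\<close> is 1, this power lies in the domain of \<open>R\<close>. By
      \<open>compat\<close> the factor \<open>z\<close> is then itself in \<open>R\<close>, hence so
      is the pair over the identity.\<close>
    have "x [^]\<^bsub>G\<^esub> k = inv\<^bsub>G\<^esub> y"
      using eq(1) x y by (metis G.int_pow_closed G.inv_equality G.m_comm)
    moreover have "(inv\<^bsub>G\<^esub> y, inv\<^bsub>E\<^esub> d') \<in> R" using partial_hom_inv R rz(1) r by blast
    ultimately have "x [^]\<^bsub>G\<^esub> k \<in> Domain R" by auto
    then have "(y \<otimes>\<^bsub>G\<^esub> x [^]\<^bsub>G\<^esub> k, d) \<in> R"
      unfolding eq(2) using compat partial_hom_mult[OF R] rz(1) r by blast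
    then show "d = \<one>\<^bsub>E\<^esub>" using partial_hom_one_unique[OF R] eq(1) by simp
  qed
  show "R \<subseteq> ?R"
  proof
    fix r assume "r \<in> R"
    then have "r = r \<otimes>\<^bsub>G \<times>\<times> E\<^esub> \<one>\<^bsub>G \<times>\<times> E\<^esub>" using GE.r_one[of r] subgroup.mem_carrier[OF subR, of r] by presburger
    then show "r \<in> ?R" using \<open>r \<in> R\<close> subgroup.one_closed[OF subZ] by (auto simp: set_mult_def)
  qed
  have "(x, e) = \<one>\<^bsub>G \<times>\<times> E\<^esub> \<otimes>\<^bsub>G \<times>\<times> E\<^esub> (x, e)" using x e by simp
  moreover have "(x, e) \<in> ?Z" by (simp add: generate.incl)
  ultimately show "(x, e) \<in> ?R" using oneR unfolding set_mult_def by blast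
qed

text \<open>\<open>n\<close> is the order of \<open>x\<close> modulo \<open>H\<close>, the
  nonnegative generator of the ideal of exponents \<open>k\<close> whose power lies in
  \<open>H\<close>. The value 0 stands for infinite order: divisibility by 0 says
  \<open>k = 0\<close>.\<close>

lemma subgroup_int_pows:
  assumes H: "subgroup H G" and x: "x \<in> carrier G"
  obtains n :: nat where "x [^]\<^bsub>G\<^esub> n \<in> H" "\<And>k :: int. x [^]\<^bsub>G\<^esub> k \<in> H \<Longrightarrow> int n dvd k"
proof (cases "\<exists>n :: nat. n > 0 \<and> x [^]\<^bsub>G\<^esub> n \<in> H")
  case True
  define n where "n = (LEAST n :: nat. n > 0 \<and> x [^]\<^bsub>G\<^esub> n \<in> H)"
  have n: "n > 0" "x [^]\<^bsub>G\<^esub> n \<in> H" using LeastI_ex[OF True] by (simp_all only: n_def)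
  have "int n dvd k" if k: "x [^]\<^bsub>G\<^esub> k \<in> H" for k :: int
  proof -
    define m where "m = nat (k mod int n)"
    have m: "int m = k - int n * (k div int n)" "m < n"
      using n(1) by (simp_all add: m_def minus_mult_div_eq_mod nat_less_iff)
    have "x [^]\<^bsub>G\<^esub> (int n * (k div int n)) = (x [^]\<^bsub>G\<^esub> n) [^]\<^bsub>G\<^esub> (k div int n)"
      using x by (simp add: int_pow_int flip: G.int_pow_pow)
    also have "\<dots> \<in> H"
      by (rule G.subgroup_int_pow_closed[OF H n(2)])
    finally have "x [^]\<^bsub>G\<^esub> k \<otimes>\<^bsub>G\<^esub> inv\<^bsub>G\<^esub> (x [^]\<^bsub>G\<^esub> (int n * (k div int n))) \<in> H"
      using H k by (intro subgroup.m_closed[OF H] subgroup.m_inv_closed[OF H])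
    then have "x [^]\<^bsub>G\<^esub> (int m) \<in> H" using x by (simp only: m(1) G.int_pow_diff)
    then have "m = 0"
      using m(2) not_less_Least[of m "\<lambda>n :: nat. n > 0 \<and> x [^]\<^bsub>G\<^esub> n \<in> H"] by (auto simp: n_def int_pow_int)
    then show ?thesis using m(1) by (metis diff_eq_eq add_0 dvd_triv_left of_nat_0)
  qed
  then show ?thesis using n that by blast
next
  case False
  have "k = 0" if k: "x [^]\<^bsub>G\<^esub> k \<in> H" for k :: int
  proof (rule ccontr)
    assume "k \<noteq> 0"
    have "x [^]\<^bsub>G\<^esub> (- k) \<in> H" using subgroup.m_inv_closed[OF H k] x by (simp add: G.int_pow_neg)
    then have "x [^]\<^bsub>G\<^esub> \<bar>k\<bar> \<in> H" using k by (simp add: abs_if)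
    then have "x [^]\<^bsub>G\<^esub> (nat \<bar>k\<bar>) \<in> H" by (metis int_pow_int abs_ge_zero int_nat_eq)
    moreover have "nat \<bar>k\<bar> > 0" using \<open>k \<noteq> 0\<close> by simp
    ultimately show False using False by blast
  qed
  then show ?thesis using that[of 0] subgroup.one_closed[OF H] by auto
qed

lemma subgroup_Domain:
  assumes R: "partial_hom R"
  shows "subgroup (Domain R) G"
proof
  show "Domain R \<subseteq> carrier G" using partial_hom_closed R by blast
  show "\<one>\<^bsub>G\<^esub> \<in> Domain R" using partial_hom_one R by blast
  show "inv\<^bsub>G\<^esub> x \<in> Domain R" if "x \<in> Domain R" for x using that partial_hom_inv R by blast
  show "x \<otimes>\<^bsub>G\<^esub> y \<in> Domain R" if "x \<in> Domain R" "y \<in> Domain R" for x y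
    using that partial_hom_mult R by blast
qed

lemma partial_hom_Union:
  assumes chain: "subset.chain {R. partial_hom R} \<C>" and "\<C> \<noteq> {}"
  shows "partial_hom (\<Union>\<C>)"
proof -
  have \<C>: "partial_hom R" if "R \<in> \<C>" for R using chain that by (auto simp: subset.chain_def)
  have lin: "R \<subseteq> S \<or> S \<subseteq> R" if "R \<in> \<C>" "S \<in> \<C>" for R S
    using chain that by (auto simp: subset.chain_def)
  have sub: "subgroup R (G \<times>\<times> E)" if "R \<in> \<C>" for R using \<C>[OF that] by (rule partial_hom_subgroup)
  interpret GE: group "G \<times>\<times> E" by (rule group_DirProd)
  have "subgroup (\<Union>\<C>) (G \<times>\<times> E)"
  proof
    show "\<Union>\<C> \<subseteq> carrier (G \<times>\<times> E)"
      using subgroup.subset[OF sub] by (rule Union_least)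
    show "\<one>\<^bsub>G \<times>\<times> E\<^esub> \<in> \<Union>\<C>"
      using subgroup.one_closed[OF sub] \<open>\<C> \<noteq> {}\<close> by blast
    show "inv\<^bsub>G \<times>\<times> E\<^esub> r \<in> \<Union>\<C>" if "r \<in> \<Union>\<C>" for r
      using that subgroup.m_inv_closed[OF sub] by blast
    show "r \<otimes>\<^bsub>G \<times>\<times> E\<^esub> s \<in> \<Union>\<C>" if rs: "r \<in> \<Union>\<C>" "s \<in> \<Union>\<C>" for r s
    proof -
      obtain R where "R \<in> \<C>" "r \<in> R" "s \<in> R" using rs lin by blast
      then show ?thesis
        using subgroup.m_closed[OF sub] by blast
    qed
  qed
  then show ?thesis using \<C> unfolding partial_hom_def by blast
qed

text \<open>Baer's argument that divisible abelian groups are injective: Zorn's lemma gives a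
  maximal graph, and it is total because a value can be adjoined at every \<open>x\<close>.\<close>

lemma partial_hom_extend:
  assumes div: "\<And>e n. e \<in> carrier E \<Longrightarrow> n > 0 \<Longrightarrow> \<exists>d \<in> carrier E. d [^]\<^bsub>E\<^esub> (n :: nat) = e"
    and R: "partial_hom R"
  obtains \<phi> where "\<phi> \<in> hom G E" "\<And>x e. (x, e) \<in> R \<Longrightarrow> \<phi> x = e"
proof -
  let ?A = "{S. partial_hom S \<and> R \<subseteq> S}"
  have "\<exists>M \<in> ?A. \<forall>X \<in> ?A. M \<subseteq> X \<longrightarrow> X = M"
  proof (rule subset_Zorn_nonempty)
    show "?A \<noteq> {}" using R by auto
    fix \<C> assume "\<C> \<noteq> {}" and ch: "subset.chain ?A \<C>"
    then have "subset.chain {S. partial_hom S} \<C>" by (auto simp: subset.chain_def)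
    then have "partial_hom (\<Union>\<C>)" using \<open>\<C> \<noteq> {}\<close> by (rule partial_hom_Union)
    moreover have "\<forall>S \<in> \<C>. R \<subseteq> S" using ch by (auto simp: subset.chain_def)
    ultimately show "\<Union>\<C> \<in> ?A" using \<open>\<C> \<noteq> {}\<close> by blast
  qed
  then obtain M where M: "partial_hom M" "R \<subseteq> M"
    and max: "\<And>S. partial_hom S \<Longrightarrow> M \<subseteq> S \<Longrightarrow> S = M"
    by (smt (verit) mem_Collect_eq subset_trans)
  have total: "x \<in> Domain M" if x: "x \<in> carrier G" for x
  proof -
    obtain n :: nat where n: "x [^]\<^bsub>G\<^esub> n \<in> Domain M"
        "\<And>k :: int. x [^]\<^bsub>G\<^esub> k \<in> Domain M \<Longrightarrow> int n dvd k"
      using subgroup_int_pows[OF subgroup_Domain[OF M(1)] x] by blast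
    then obtain d where d: "(x [^]\<^bsub>G\<^esub> n, d) \<in> M" by blast
    \<comment> \<open>Divisibility provides a root of the value \<open>d\<close> already forced at
      the \<open>n\<close>-th power of \<open>x\<close>. For \<open>n = 0\<close> that value is 1
      and every element is a root.\<close>
    have "\<exists>e \<in> carrier E. e [^]\<^bsub>E\<^esub> n = d"
    proof (cases "n = 0")
      case True
      then show ?thesis using partial_hom_one_unique[OF M(1)] d by auto
    qed (use div partial_hom_closed[OF M(1) d] in auto)
    then obtain e where e: "e \<in> carrier E" "e [^]\<^bsub>E\<^esub> n = d" by blast
    have "(x [^]\<^bsub>G\<^esub> k, e [^]\<^bsub>E\<^esub> k) \<in> M" if k: "x [^]\<^bsub>G\<^esub> k \<in> Domain M" for k :: int
    proof -
      obtain q where "k = int n * q" using n(2)[OF k] by (elim dvdE)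
      then have "x [^]\<^bsub>G\<^esub> k = (x [^]\<^bsub>G\<^esub> n) [^]\<^bsub>G\<^esub> q" "e [^]\<^bsub>E\<^esub> k = d [^]\<^bsub>E\<^esub> q"
        using x e by (simp_all add: int_pow_int flip: G.int_pow_pow E.int_pow_pow)
      then show ?thesis using partial_hom_int_pow[OF M(1) d] by simp
    qed
    then obtain S where "partial_hom S" "M \<subseteq> S" "(x, e) \<in> S"
      using partial_hom_adjoin[OF M(1) x e(1)] by blast
    then show ?thesis using max by blast
  qed
  define \<phi> where "\<phi> x = (THE e. (x, e) \<in> M)" for x
  have eq: "\<phi> x = e" if "(x, e) \<in> M" for x e
    unfolding \<phi>_def by (rule the_equality, rule that, rule partial_hom_fun[OF M(1) _ that])
  have graph: "(x, \<phi> x) \<in> M" if "x \<in> carrier G" for x using total[OF that] eq by auto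
  have "\<phi> \<in> hom G E"
  proof (rule homI)
    show "\<phi> x \<in> carrier E" if "x \<in> carrier G" for x
      using partial_hom_closed(2)[OF M(1) graph[OF that]] .
    show "\<phi> (x \<otimes>\<^bsub>G\<^esub> y) = \<phi> x \<otimes>\<^bsub>E\<^esub> \<phi> y" if "x \<in> carrier G" "y \<in> carrier G" for x y
      using eq[OF partial_hom_mult[OF M(1) graph[OF that(1)] graph[OF that(2)]]] .
  qed
  then show ?thesis using that eq M(2) by blast
qed

end

section \<open>The group of rationals modulo integers\<close>

abbreviation rat_group :: "rat monoid" where
  "rat_group \<equiv> \<lparr>carrier = UNIV, monoid.mult = (+), one = 0\<rparr>"

lemma comm_group_rat: "comm_group rat_group"
  by (rule comm_groupI) (auto simp: algebra_simps intro: exI[of _ "- _"])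

lemma subgroup_Ints_rat: "subgroup \<int> rat_group"
proof (rule group.subgroupI)
  show "group rat_group" by (simp add: comm_group.axioms comm_group_rat)
  have "inv\<^bsub>rat_group\<^esub> a = - a" for a
    by (rule group.inv_equality) (auto simp: comm_group.axioms comm_group_rat)
  then show "inv\<^bsub>rat_group\<^esub> a \<in> \<int>" if "a \<in> \<int>" for a using that by simp
qed auto

lemma comm_group_QmodZ: "comm_group QmodZ"
  unfolding QmodZ_def by (rule comm_group.abelian_FactGroup[OF comm_group_rat subgroup_Ints_rat])

definition rat_coset :: "rat \<Rightarrow> rat set" where
  "rat_coset q = \<int> #>\<^bsub>rat_group\<^esub> q"

lemma carrier_QmodZ: "carrier QmodZ = range rat_coset"
  by (simp add: QmodZ_def carrier_FactGroup rat_coset_def[abs_def])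

lemma rat_coset_eq_one_iff: "rat_coset q = \<one>\<^bsub>QmodZ\<^esub> \<longleftrightarrow> q \<in> \<int>"
proof -
  have "rat_coset q = \<int> \<longleftrightarrow> q \<in> \<int>"
    using group.coset_join1[of rat_group \<int> q] group.coset_join2[of rat_group q \<int>]
      comm_group_rat subgroup_Ints_rat by (auto simp: rat_coset_def comm_group.axioms)
  then show ?thesis by (simp add: QmodZ_def)
qed

lemma rat_coset_nat_pow: "rat_coset q [^]\<^bsub>QmodZ\<^esub> (n :: nat) = rat_coset (of_nat n * q)"
proof -
  interpret normal \<int> rat_group
    using comm_group.subgroup_imp_normal[OF comm_group_rat subgroup_Ints_rat] .
  have "q [^]\<^bsub>rat_group\<^esub> n = of_nat n * q" by (induction n) (auto simp: algebra_simps)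
  then show ?thesis using FactGroup_pow[of q n] by (simp add: QmodZ_def rat_coset_def)
qed

lemma QmodZ_divisible:
  assumes "e \<in> carrier QmodZ" "n > 0"
  shows "\<exists>d \<in> carrier QmodZ. d [^]\<^bsub>QmodZ\<^esub> (n :: nat) = e"
proof -
  obtain q where "e = rat_coset q" using assms(1) by (auto simp: carrier_QmodZ)
  then have "rat_coset (q / of_nat n) [^]\<^bsub>QmodZ\<^esub> n = e"
    using assms(2) by (simp add: rat_coset_nat_pow)
  then show ?thesis by (auto simp: carrier_QmodZ)
qed

lemma QmodZ_extend_hom:
  assumes G: "comm_group G" and K: "subgroup K G" and \<phi>: "\<phi> \<in> hom (G\<lparr>carrier := K\<rparr>) QmodZ"
  obtains \<psi> where "\<psi> \<in> hom G QmodZ" "\<And>x. x \<in> K \<Longrightarrow> \<psi> x = \<phi> x"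
proof -
  interpret partial_homs G QmodZ using G comm_group_QmodZ by (simp add: partial_homs_def)
  have KG: "group (G\<lparr>carrier := K\<rparr>)" using K G.subgroup_imp_group by blast
  interpret h: group_hom "G\<lparr>carrier := K\<rparr>" QmodZ \<phi>
    using \<phi> KG by (simp add: group_hom_def group_hom_axioms_def E.is_group)
  let ?R = "(\<lambda>x. (x, \<phi> x)) ` K"
  have "subgroup ?R (G \<times>\<times> QmodZ)"
  proof
    show "?R \<subseteq> carrier (G \<times>\<times> QmodZ)" using subgroup.subset[OF K] h.hom_closed by auto
    show "\<one>\<^bsub>G \<times>\<times> QmodZ\<^esub> \<in> ?R" using h.hom_one subgroup.one_closed[OF K] by force
    show "r \<otimes>\<^bsub>G \<times>\<times> QmodZ\<^esub> s \<in> ?R" if rs: "r \<in> ?R" "s \<in> ?R" for r s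
    proof -
      obtain x y where "x \<in> K" "y \<in> K" "r = (x, \<phi> x)" "s = (y, \<phi> y)" using rs by auto
      then show ?thesis
        using h.hom_mult subgroup.m_closed[OF K] by (auto intro!: rev_image_eqI[of "x \<otimes>\<^bsub>G\<^esub> y"])
    qed
    show "inv\<^bsub>G \<times>\<times> QmodZ\<^esub> r \<in> ?R" if r: "r \<in> ?R" for r
    proof -
      obtain x where x: "x \<in> K" "r = (x, \<phi> x)" using r by auto
      have "inv\<^bsub>G\<^esub> x \<in> K" "\<phi> (inv\<^bsub>G\<^esub> x) = inv\<^bsub>QmodZ\<^esub> \<phi> x"
        using x(1) K h.hom_inv[of x] G.m_inv_consistent[OF K] by (auto simp: subgroup.m_inv_closed)
      moreover have "x \<in> carrier G" "\<phi> x \<in> carrier QmodZ"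
        using x(1) subgroup.mem_carrier[OF K] h.hom_closed[of x] by simp_all
      then have "inv\<^bsub>G \<times>\<times> QmodZ\<^esub> r = (inv\<^bsub>G\<^esub> x, inv\<^bsub>QmodZ\<^esub> \<phi> x)"
        by (simp add: x(2) G.is_group E.is_group)
      ultimately show ?thesis by (intro image_eqI[of _ _ "inv\<^bsub>G\<^esub> x"]) simp_all
    qed
  qed
  then have "partial_hom ?R" using h.hom_one unfolding partial_hom_def by auto
  then obtain \<psi> where "\<psi> \<in> hom G QmodZ" "\<And>x e. (x, e) \<in> ?R \<Longrightarrow> \<psi> x = e"
    using partial_hom_extend[OF QmodZ_divisible, of ?R] by blast
  then show ?thesis using that by blast
qed

lemma QmodZ_cogenerator:
  assumes G: "comm_group G" and K: "subgroup K G" and x: "x \<in> carrier G" "x \<notin> K"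
  obtains \<psi> where "\<psi> \<in> hom G QmodZ" "\<And>y. y \<in> K \<Longrightarrow> \<psi> y = \<one>\<^bsub>QmodZ\<^esub>" "\<psi> x \<noteq> \<one>\<^bsub>QmodZ\<^esub>"
proof -
  interpret partial_homs G QmodZ using G comm_group_QmodZ by (simp add: partial_homs_def)
  let ?R = "K \<times> {\<one>\<^bsub>QmodZ\<^esub>}"
  have "subgroup ?R (G \<times>\<times> QmodZ)"
    by (intro DirProd_subgroups G.is_group E.is_group K E.triv_subgroup)
  then have R: "partial_hom ?R" unfolding partial_hom_def by blast
  have dom: "Domain ?R = K" by auto
  obtain n :: nat where n: "x [^]\<^bsub>G\<^esub> n \<in> K" "\<And>k :: int. x [^]\<^bsub>G\<^esub> k \<in> K \<Longrightarrow> int n dvd k"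
    using subgroup_int_pows[OF K x(1)] by blast
  \<comment> \<open>The value at \<open>x\<close> must be nonzero and killed by the order
    \<open>n\<close> of \<open>x\<close> modulo \<open>K\<close>, to be compatible with the zero map
    on \<open>K\<close>. For finite order, which exceeds 1 as \<open>x\<close> is not in
    \<open>K\<close>, the class of 1/n qualifies; for infinite order any nonzero class does, and 1/2
    is taken.\<close>
  define q :: rat where "q = (if n = 0 then 1 / 2 else 1 / of_nat n)"
  have half: "(1 :: rat) / of_nat m \<notin> \<int>" if "m > 1" for m
  proof
    assume "(1 :: rat) / of_nat m \<in> \<int>"
    then obtain k :: int where "(1 :: rat) / of_nat m = of_int k" by (auto elim: Ints_cases)
    then have "(1 :: rat) = of_int (k * int m)" using that by (simp add: field_simps)
    then have "k * int m = 1" by (metis of_int_eq_1_iff)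
    then show False using that by (simp add: zmult_eq_1_iff)
  qed
  have "n \<noteq> 1" using n(1) x by auto
  then have q: "q \<notin> \<int>" using half[of 2] half[of n] by (auto simp: q_def)
  let ?e = "rat_coset q"
  have e: "?e \<in> carrier QmodZ" by (simp add: carrier_QmodZ)
  have en: "?e [^]\<^bsub>QmodZ\<^esub> n = \<one>\<^bsub>QmodZ\<^esub>" by (simp add: rat_coset_nat_pow rat_coset_eq_one_iff q_def)
  have "(x [^]\<^bsub>G\<^esub> k, ?e [^]\<^bsub>QmodZ\<^esub> k) \<in> ?R" if k: "x [^]\<^bsub>G\<^esub> k \<in> Domain ?R" for k :: int
  proof -
    obtain j where "k = int n * j" using n(2)[OF k[unfolded dom]] by (elim dvdE)
    then have "?e [^]\<^bsub>QmodZ\<^esub> k = (?e [^]\<^bsub>QmodZ\<^esub> n) [^]\<^bsub>QmodZ\<^esub> j"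
      using e by (simp add: int_pow_int flip: E.int_pow_pow)
    then have "?e [^]\<^bsub>QmodZ\<^esub> k = \<one>\<^bsub>QmodZ\<^esub>" by (simp add: en)
    then show ?thesis using k unfolding dom by simp
  qed
  then obtain R' where R': "partial_hom R'" "?R \<subseteq> R'" "(x, ?e) \<in> R'"
    using partial_hom_adjoin[OF R x(1) e] by blast
  obtain \<psi> where \<psi>: "\<psi> \<in> hom G QmodZ" "\<And>y d. (y, d) \<in> R' \<Longrightarrow> \<psi> y = d"
    using partial_hom_extend[OF QmodZ_divisible R'(1)] by blast
  show ?thesis
  proof (rule that[OF \<psi>(1)])
    show "\<psi> y = \<one>\<^bsub>QmodZ\<^esub>" if "y \<in> K" for y using \<psi>(2) R'(2) that by blast
    show "\<psi> x \<noteq> \<one>\<^bsub>QmodZ\<^esub>" using \<psi>(2)[OF R'(3)] q by (simp add: rat_coset_eq_one_iff)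
  qed
qed

text \<open>The right side says that the dual of \<open>p\<close>, precomposition on homomorphisms
  to Q/Z, has trivial kernel. An element missed by \<open>p\<close> is separated from the image by
  some homomorphism, which is then a nonzero kernel element.\<close>

lemma QmodZ_dual_inj_iff_surj:
  assumes G: "comm_group G" and H: "comm_group H" and p: "p \<in> hom G H"
  shows "p ` carrier G = carrier H \<longleftrightarrow>
    (\<forall>\<phi> \<in> hom H QmodZ. (\<forall>x \<in> carrier G. \<phi> (p x) = \<one>\<^bsub>QmodZ\<^esub>) \<longrightarrow> (\<forall>y \<in> carrier H. \<phi> y = \<one>\<^bsub>QmodZ\<^esub>))"
    (is "?L \<longleftrightarrow> ?R")
proof
  show ?R if ?L
    unfolding that[symmetric] by simp
  show ?L if r: ?R
  proof (rule ccontr)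
    interpret p: group_hom G H p
      using assms by (simp add: group_hom_def group_hom_axioms_def comm_group.axioms)
    assume "\<not> ?L"
    then obtain y where "y \<in> carrier H" "y \<notin> p ` carrier G" using p.hom_closed by blast
    then obtain \<psi> where "\<psi> \<in> hom H QmodZ" "\<And>z. z \<in> p ` carrier G \<Longrightarrow> \<psi> z = \<one>\<^bsub>QmodZ\<^esub>" "\<psi> y \<noteq> \<one>\<^bsub>QmodZ\<^esub>"
      using QmodZ_cogenerator[OF H p.img_is_subgroup] by blast
    moreover from this have "\<psi> y = \<one>\<^bsub>QmodZ\<^esub>"
      by (intro r[rule_format, of \<psi> y] \<open>y \<in> carrier H\<close>) (simp_all add: imageI)
    ultimately show False by simp
  qed
qed

text \<open>The right side is surjectivity of the dual of \<open>p\<close>. An injective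
  \<open>p\<close> identifies \<open>G\<close> with a subgroup of \<open>H\<close>, from which
  homomorphisms to Q/Z extend; conversely, a homomorphism that is nonzero on a kernel element cannot
  factor through \<open>p\<close>.\<close>

lemma QmodZ_dual_surj_iff_inj:
  assumes G: "comm_group G" and H: "comm_group H" and p: "p \<in> hom G H"
  shows "inj_on p (carrier G) \<longleftrightarrow> (\<forall>\<phi> \<in> hom G QmodZ. \<exists>\<psi> \<in> hom H QmodZ. \<forall>x \<in> carrier G. \<psi> (p x) = \<phi> x)"
    (is "?L \<longleftrightarrow> ?R")
proof
  interpret p: group_hom G H p
    using assms by (simp add: group_hom_def group_hom_axioms_def comm_group.axioms)
  interpret E: comm_group QmodZ by (rule comm_group_QmodZ)
  show ?R if inj: ?L
  proof
    fix \<phi> assume \<phi>: "\<phi> \<in> hom G QmodZ"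
    let ?K = "p ` carrier G"
    let ?i = "inv_into (carrier G) p"
    have sub: "subgroup ?K H" by (rule p.img_is_subgroup)
    have inv: "?i (p x) = x" if "x \<in> carrier G" for x using inj that by (rule inv_into_f_f)
    have "\<phi> \<circ> ?i \<in> hom (H\<lparr>carrier := ?K\<rparr>) QmodZ"
      using \<phi> by (auto simp: hom_def inv simp flip: p.hom_mult)
    then obtain \<psi> where \<psi>: "\<psi> \<in> hom H QmodZ" "\<And>y. y \<in> ?K \<Longrightarrow> \<psi> y = (\<phi> \<circ> ?i) y"
      using QmodZ_extend_hom[OF H sub] by blast
    have "\<psi> (p x) = \<phi> x" if "x \<in> carrier G" for x
      using \<psi>(2)[of "p x"] inv[OF that] that by simp
    then show "\<exists>\<psi> \<in> hom H QmodZ. \<forall>x \<in> carrier G. \<psi> (p x) = \<phi> x" using \<psi>(1) by blast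
  qed
  show ?L if r: ?R
  proof (rule ccontr)
    assume "\<not> ?L"
    then obtain x where x: "x \<in> carrier G" "p x = \<one>\<^bsub>H\<^esub>" "x \<notin> {\<one>\<^bsub>G\<^esub>}"
      using p.inj_on_one_iff by auto
    obtain \<phi> where \<phi>: "\<phi> \<in> hom G QmodZ" "\<phi> x \<noteq> \<one>\<^bsub>QmodZ\<^esub>"
      using QmodZ_cogenerator[OF G group.triv_subgroup[OF p.G.is_group] x(1,3)] by blast
    obtain \<psi> where \<psi>: "\<psi> \<in> hom H QmodZ" "\<forall>x \<in> carrier G. \<psi> (p x) = \<phi> x"
      using bspec[OF r \<phi>(1)] ..
    have "\<phi> x = \<psi> \<one>\<^bsub>H\<^esub>" using \<psi>(2) x(1,2) by metis
    also have "\<dots> = \<one>\<^bsub>QmodZ\<^esub>" by (rule hom_one[OF \<psi>(1) p.H.is_group E.is_group])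
    finally show False using \<phi>(2) by simp
  qed
qed

section \<open>Preadditive categories\<close>

lemma hom_finprod:
  assumes "comm_group G" "comm_group H" and h: "h \<in> hom G H"
    and "finite I" and "x \<in> I \<rightarrow> carrier G"
  shows "h (finprod G x I) = finprod H (\<lambda>i. h (x i)) I"
  using assms(4,5)
proof (induction I rule: finite_induct)
  case empty
  then show ?case
    using assms(1-3) by (simp add: comm_group.axioms hom_one comm_monoid.finprod_empty)
next
  case (insert i I)
  interpret G: comm_group G by fact
  interpret H: comm_group H by fact
  have "h (x j) \<in> carrier H" if "j \<in> insert i I" for j
    using that insert.prems h by (auto simp: hom_def)
  then show ?case
    using insert h by (simp add: hom_mult Pi_iff)
qed

text \<open>\<open>gfinprod\<close> adds over the support of a family, and \<open>h\<close> may
  shrink the support; both sides are therefore compared with the sum over the fixed finite set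
  \<open>?F\<close>.\<close>

lemma hom_gfinprod:
  assumes G: "comm_group G" and H: "comm_group H" and h: "h \<in> hom G H"
    and x: "x \<in> I \<rightarrow> carrier G" and fin: "finite {i \<in> I. x i \<noteq> \<one>\<^bsub>G\<^esub>}"
  shows "h (gfinprod G x I) = gfinprod H (\<lambda>i. h (x i)) I"
proof -
  interpret G: comm_group G by fact
  interpret H: comm_group H by fact
  let ?F = "{i \<in> I. x i \<noteq> \<one>\<^bsub>G\<^esub>}"
  have hx: "h (x i) \<in> carrier H" if "i \<in> I" for i using that x h by (auto simp: hom_def)
  have "h (gfinprod G x I) = finprod H (\<lambda>i. h (x i)) ?F"
    unfolding gfinprod_def using hom_finprod[OF G H h fin] x fin by auto
  also have "\<dots> = gfinprod H (\<lambda>i. h (x i)) ?F"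
    using fin hx by (intro H.gfinprod_eq_finprod[symmetric]) auto
  also have "\<dots> = gfinprod H (\<lambda>i. h (x i)) I"
    using hx hom_one[OF h G.is_group H.is_group] by (intro H.gfinprod_mono_neutral_cong_left) auto
  finally show ?thesis .
qed

lemma (in comm_group) gfinprod_single:
  assumes "j \<in> I" "y \<in> I \<rightarrow> carrier G" "\<And>i. i \<in> I \<Longrightarrow> i \<noteq> j \<Longrightarrow> y i = \<one>"
  shows "gfinprod G y I = y j"
proof -
  have "gfinprod G y I = gfinprod G y {j}"
    using assms by (intro gfinprod_mono_neutral_cong_right) auto
  also have "\<dots> = y j" using assms(1,2) by (auto simp: Pi_iff)
  finally show ?thesis .
qed

lemma homgrp_simps [simp]:
  "carrier (homgrp C A B) = Hom C A B"
  "x \<otimes>\<^bsub>homgrp C A B\<^esub> y = Add C x y"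
  "\<one>\<^bsub>homgrp C A B\<^esub> = Zero C A B"
  by (simp_all add: homgrp_def)

lemma HomD:
  assumes "f \<in> Hom C A B"
  shows "f \<in> Arr C" "Dom C f = A" "Cod C f = B"
  using assms by (auto simp: Hom_def)

lemma Arr_Hom: "f \<in> Arr C \<Longrightarrow> f \<in> Hom C (Dom C f) (Cod C f)"
  by (simp add: Hom_def)

lemma full_sub_simps [simp]:
  "Obj (full_sub C S) = S" "Dom (full_sub C S) = Dom C" "Cod (full_sub C S) = Cod C"
  "Ident (full_sub C S) = Ident C" "Comp (full_sub C S) = Comp C"
  "Add (full_sub C S) = Add C" "Zero (full_sub C S) = Zero C"
  "f \<in> Arr (full_sub C S) \<longleftrightarrow> f \<in> Arr C \<and> Dom C f \<in> S \<and> Cod C f \<in> S"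
  by (simp_all add: full_sub_def)

lemma Hom_full_sub: "f \<in> Hom (full_sub C S) A B \<longleftrightarrow> f \<in> Hom C A B \<and> A \<in> S \<and> B \<in> S"
  by (auto simp: Hom_def)

lemma homgrp_full_sub: "A \<in> S \<Longrightarrow> B \<in> S \<Longrightarrow> homgrp (full_sub C S) A B = homgrp C A B"
  by (auto simp: homgrp_def Hom_def)

section \<open>Injectivity and separatedness along a map; arithmetic of Hom groups\<close>

definition injective_wrt :: "('o, 'm, 'z) precat_scheme \<Rightarrow> 'm \<Rightarrow> 'o \<Rightarrow> bool" where
  "injective_wrt C f X \<longleftrightarrow> factoring C f X = Hom C (Dom C f) X"

definition separated_wrt :: "('o, 'm, 'z) precat_scheme \<Rightarrow> 'm \<Rightarrow> 'o \<Rightarrow> bool" where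
  "separated_wrt C f X \<longleftrightarrow>
     (\<forall>g \<in> Hom C (Cod C f) X. g \<bullet>\<^bsub>C\<^esub> f = Zero C (Dom C f) X \<longrightarrow> g = Zero C (Cod C f) X)"

context preadditive_category
begin

lemma Hom_Obj:
  assumes "f \<in> Hom C A B"
  shows "A \<in> Obj C" "B \<in> Obj C"
  using assms dom_cod by (auto simp: Hom_def)

lemma add_closed:
  assumes "f \<in> Hom C A B" "g \<in> Hom C A B"
  shows "Add C f g \<in> Hom C A B"
proof -
  interpret H: comm_group "homgrp C A B" by (rule hom_group[OF Hom_Obj[OF assms(1)]])
  show ?thesis using H.m_closed[of f g] assms by simp
qed

lemma zero_closed: "A \<in> Obj C \<Longrightarrow> B \<in> Obj C \<Longrightarrow> Zero C A B \<in> Hom C A B"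
  using monoid.one_closed[of "homgrp C A B"] hom_group[of A B] by (simp add: comm_group.axioms group.is_monoid)

lemma add_assoc:
  assumes "f \<in> Hom C A B" "g \<in> Hom C A B" "h \<in> Hom C A B"
  shows "Add C (Add C f g) h = Add C f (Add C g h)"
proof -
  interpret H: comm_group "homgrp C A B" by (rule hom_group[OF Hom_Obj[OF assms(1)]])
  show ?thesis using H.m_assoc[of f g h] assms by simp
qed

lemma add_zero:
  assumes "f \<in> Hom C A B"
  shows "Add C f (Zero C A B) = f" "Add C (Zero C A B) f = f"
proof -
  interpret H: comm_group "homgrp C A B" by (rule hom_group[OF Hom_Obj[OF assms]])
  show "Add C f (Zero C A B) = f" using H.r_one[of f] assms by simp
  show "Add C (Zero C A B) f = f" using H.l_one[of f] assms by simp
qed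

lemma Neg_eq: "f \<in> Hom C A B \<Longrightarrow> Neg C f = inv\<^bsub>homgrp C A B\<^esub> f"
  by (simp add: Neg_def HomD)

lemma neg_closed:
  assumes "f \<in> Hom C A B"
  shows "Neg C f \<in> Hom C A B"
proof -
  interpret H: comm_group "homgrp C A B" by (rule hom_group[OF Hom_Obj[OF assms]])
  show ?thesis using H.inv_closed[of f] assms by (simp add: Neg_eq)
qed

lemma add_neg:
  assumes "f \<in> Hom C A B"
  shows "Add C f (Neg C f) = Zero C A B" "Add C (Neg C f) f = Zero C A B"
proof -
  interpret H: comm_group "homgrp C A B" by (rule hom_group[OF Hom_Obj[OF assms]])
  show "Add C f (Neg C f) = Zero C A B" using H.r_inv[of f] assms by (simp add: Neg_eq)
  show "Add C (Neg C f) f = Zero C A B" using H.l_inv[of f] assms by (simp add: Neg_eq)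
qed

lemma add_idem_zero:
  assumes "f \<in> Hom C A B" "Add C f f = f"
  shows "f = Zero C A B"
proof -
  interpret H: comm_group "homgrp C A B" by (rule hom_group[OF Hom_Obj[OF assms(1)]])
  show ?thesis using H.r_cancel_one[of f f] assms by simp
qed

lemma neg_zero:
  assumes "A \<in> Obj C" "B \<in> Obj C"
  shows "Neg C (Zero C A B) = Zero C A B"
  using add_neg(2)[OF zero_closed[OF assms]] add_zero(1)[OF neg_closed[OF zero_closed[OF assms]]] by simp

lemma comp_zero:
  assumes "g \<in> Hom C B E" "A \<in> Obj C"
  shows "g \<bullet> Zero C A B = Zero C A E"
proof -
  have z: "Zero C A B \<in> Hom C A B" using assms Hom_Obj by (blast intro: zero_closed)
  show ?thesis
    using comp_add_right[OF z z assms(1)] add_zero(1)[OF z] comp[OF z assms(1)]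
    by (intro add_idem_zero) auto
qed

lemma zero_comp:
  assumes "f \<in> Hom C A B" "E \<in> Obj C"
  shows "Zero C B E \<bullet> f = Zero C A E"
proof -
  have z: "Zero C B E \<in> Hom C B E" using assms Hom_Obj by (blast intro: zero_closed)
  show ?thesis
    using comp_add_left[OF assms(1) z z] add_zero(1)[OF z] comp[OF assms(1) z]
    by (intro add_idem_zero) auto
qed

lemma neg_unique:
  assumes "f \<in> Hom C A B" "g \<in> Hom C A B" "Add C f g = Zero C A B"
  shows "g = Neg C f"
  using assms add_assoc[OF neg_closed[OF assms(1)] assms(1,2)] add_neg(2)[OF assms(1)]
    add_zero(2)[OF assms(2)] add_zero(1)[OF neg_closed[OF assms(1)]] by simp

lemma neg_comp:
  assumes "f \<in> Hom C A B" "g \<in> Hom C B E"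
  shows "Neg C g \<bullet> f = Neg C (g \<bullet> f)"
  using comp_add_left[OF assms neg_closed[OF assms(2)]] add_neg(1)[OF assms(2)]
    zero_comp[OF assms(1)] Hom_Obj(2)[OF assms(2)]
  by (intro neg_unique[OF comp[OF assms] comp[OF assms(1) neg_closed[OF assms(2)]]]) simp

lemma diff_zero_eq:
  assumes "f \<in> Hom C A B" "g \<in> Hom C A B" "Add C f (Neg C g) = Zero C A B"
  shows "f = g"
  using assms add_assoc[OF assms(1) neg_closed[OF assms(2)] assms(2)] add_neg(2)[OF assms(2)]
    add_zero(1)[OF assms(1)] add_zero(2)[OF assms(2)] by simp

lemma diff_comp_zero_iff:
  assumes f: "f \<in> Hom C A B" and g: "g \<in> Hom C B E" "h \<in> Hom C B E"
  shows "Add C g (Neg C h) \<bullet> f = Zero C A E \<longleftrightarrow> g \<bullet> f = h \<bullet> f"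
proof -
  have "Add C g (Neg C h) \<bullet> f = Add C (g \<bullet> f) (Neg C (h \<bullet> f))"
    using comp_add_left[OF f g(1) neg_closed[OF g(2)]] neg_comp[OF f g(2)] by simp
  then show ?thesis
    using diff_zero_eq[OF comp[OF f g(1)] comp[OF f g(2)]] add_neg(1)[OF comp[OF f g(2)]] by auto
qed

lemma separated_wrt_iff_inj:
  assumes f: "f \<in> Hom C A B" and X: "X \<in> Obj C"
  shows "separated_wrt C f X \<longleftrightarrow> inj_on (\<lambda>g. g \<bullet> f) (Hom C B X)"
proof
  assume sep: "separated_wrt C f X"
  show "inj_on (\<lambda>g. g \<bullet> f) (Hom C B X)"
  proof (rule inj_onI)
    fix g h assume gh: "g \<in> Hom C B X" "h \<in> Hom C B X" "g \<bullet> f = h \<bullet> f"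
    then have "Add C g (Neg C h) \<bullet> f = Zero C A X" using diff_comp_zero_iff f by blast
    then have "Add C g (Neg C h) = Zero C B X"
      using sep HomD[OF f] add_closed[OF gh(1) neg_closed[OF gh(2)]] by (simp add: separated_wrt_def)
    then show "g = h" using diff_zero_eq gh by blast
  qed
next
  assume inj: "inj_on (\<lambda>g. g \<bullet> f) (Hom C B X)"
  have "Zero C B X \<bullet> f = Zero C A X" using f X by (rule zero_comp)
  then show "separated_wrt C f X"
    using inj_onD[OF inj _ _ zero_closed[of B X]] HomD[OF f] Hom_Obj[OF f] X
    by (auto simp: separated_wrt_def)
qed

lemma precomp_hom:
  assumes "f \<in> Hom C A B" "X \<in> Obj C"
  shows "(\<lambda>g. g \<bullet> f) \<in> hom (homgrp C B X) (homgrp C A X)"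
  using assms by (intro homI) (simp_all add: comp comp_add_left)

lemma postcomp_hom:
  assumes "f \<in> Hom C A B" "X \<in> Obj C"
  shows "(\<lambda>g. f \<bullet> g) \<in> hom (homgrp C X A) (homgrp C X B)"
  using assms by (intro homI) (simp_all add: comp comp_add_right)

lemma comp_gfinprod:
  assumes g: "g \<in> Hom C B E" and A: "A \<in> Obj C" and x: "\<And>i. i \<in> I \<Longrightarrow> x i \<in> Hom C A B"
    and fin: "finite {i \<in> I. x i \<noteq> Zero C A B}"
  shows "g \<bullet> gfinprod (homgrp C A B) x I = gfinprod (homgrp C A E) (\<lambda>i. g \<bullet> x i) I"
  using hom_gfinprod[OF _ _ postcomp_hom[OF g A], of x I] assms Hom_Obj[OF g] by (simp add: hom_group Pi_iff)

lemma gfinprod_comp: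
  assumes f: "f \<in> Hom C A B" and E: "E \<in> Obj C" and x: "\<And>i. i \<in> I \<Longrightarrow> x i \<in> Hom C B E"
    and fin: "finite {i \<in> I. x i \<noteq> Zero C B E}"
  shows "gfinprod (homgrp C B E) x I \<bullet> f = gfinprod (homgrp C A E) (\<lambda>i. x i \<bullet> f) I"
  using hom_gfinprod[OF _ _ precomp_hom[OF f E], of x I] assms Hom_Obj[OF f] by (simp add: hom_group Pi_iff)

lemma gfinprod_Hom:
  assumes "A \<in> Obj C" "B \<in> Obj C" "\<And>i. i \<in> I \<Longrightarrow> x i \<in> Hom C A B"
  shows "gfinprod (homgrp C A B) x I \<in> Hom C A B"
proof -
  interpret H: comm_group "homgrp C A B" by (rule hom_group[OF assms(1,2)])
  show ?thesis using H.gfinprod_closed[of x I] assms(3) by (simp add: Pi_iff)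
qed

lemma full_sub_preadditive:
  assumes "S \<subseteq> Obj C"
  shows "preadditive_category (full_sub C S)"
  using assms
  by (unfold preadditive_category_def)
    (auto simp: Hom_full_sub homgrp_full_sub hom_group subset_eq comp_assoc comp_add_left
      comp_add_right dom_cod comp_ident ident_comp ident intro: comp)

end

section \<open>Coproducts and compact objects\<close>

locale coproduct = preadditive_category C
  for C :: "('o, 'm, 'z) precat_scheme" (structure) +
  fixes I :: "'i set" and X :: "'i \<Rightarrow> 'o" and P :: 'o and \<iota> :: "'i \<Rightarrow> 'm"
  assumes is_coproduct: "is_coproduct C I X P \<iota>"
begin

lemma P_Obj: "P \<in> Obj C"
  using is_coproduct by (simp add: is_coproduct_def)

lemma X_Obj: "i \<in> I \<Longrightarrow> X i \<in> Obj C"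
  using is_coproduct by (simp add: is_coproduct_def)

lemma inj_Hom: "i \<in> I \<Longrightarrow> \<iota> i \<in> Hom C (X i) P"
  using is_coproduct by (simp add: is_coproduct_def)

lemma ex_cotuple:
  assumes "Z \<in> Obj C" "\<And>i. i \<in> I \<Longrightarrow> f i \<in> Hom C (X i) Z"
  shows "\<exists>u. u \<in> Hom C P Z \<and> (\<forall>i \<in> I. u \<bullet> \<iota> i = f i)"
  using is_coproduct assms unfolding is_coproduct_def by blast

lemma cotuple_unique:
  assumes "u \<in> Hom C P Z" "v \<in> Hom C P Z" "\<And>i. i \<in> I \<Longrightarrow> u \<bullet> \<iota> i = v \<bullet> \<iota> i"
  shows "u = v"
proof -
  have "\<exists>!w. w \<in> Hom C P Z \<and> (\<forall>i \<in> I. w \<bullet> \<iota> i = v \<bullet> \<iota> i)"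
    using is_coproduct assms(2) Hom_Obj(2)[OF assms(2)] comp[OF inj_Hom assms(2)]
    by (simp add: is_coproduct_def)
  then show ?thesis using assms by blast
qed

section \<open>Projections, truncations and finitely supported maps of a coproduct\<close>

definition proj :: "'i \<Rightarrow> 'm" where
  "proj j = (SOME p. p \<in> Hom C P (X j) \<and>
     (\<forall>i \<in> I. p \<bullet> \<iota> i = (if i = j then Ident C (X j) else Zero C (X i) (X j))))"

lemma proj:
  assumes j: "j \<in> I"
  shows "proj j \<in> Hom C P (X j)"
    and "i \<in> I \<Longrightarrow> proj j \<bullet> \<iota> i = (if i = j then Ident C (X j) else Zero C (X i) (X j))"
proof -
  have "proj j \<in> Hom C P (X j) \<and>
     (\<forall>i \<in> I. proj j \<bullet> \<iota> i = (if i = j then Ident C (X j) else Zero C (X i) (X j)))"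
    unfolding proj_def by (rule someI_ex, rule ex_cotuple) (use X_Obj j in \<open>auto simp: ident zero_closed\<close>)
  then show "proj j \<in> Hom C P (X j)"
    and "i \<in> I \<Longrightarrow> proj j \<bullet> \<iota> i = (if i = j then Ident C (X j) else Zero C (X i) (X j))"
    by blast+
qed

text \<open>The idempotent of the coproduct that projects onto the summands indexed by
  \<open>F\<close> and kills the others. The universal property gives it for every \<open>F\<close>,
  so partial sums need not be introduced as separate objects.\<close>

definition trunc :: "'i set \<Rightarrow> 'm" where
  "trunc F = (SOME e. e \<in> Hom C P P \<and> (\<forall>i \<in> I. e \<bullet> \<iota> i = (if i \<in> F then \<iota> i else Zero C (X i) P)))"

lemma trunc:
  shows trunc_Hom: "trunc F \<in> Hom C P P"
    and trunc_inj: "i \<in> I \<Longrightarrow> trunc F \<bullet> \<iota> i = (if i \<in> F then \<iota> i else Zero C (X i) P)"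
proof -
  have "trunc F \<in> Hom C P P \<and> (\<forall>i \<in> I. trunc F \<bullet> \<iota> i = (if i \<in> F then \<iota> i else Zero C (X i) P))"
    unfolding trunc_def
    by (rule someI_ex, rule ex_cotuple) (use X_Obj P_Obj inj_Hom in \<open>auto simp: zero_closed\<close>)
  then show "trunc F \<in> Hom C P P"
    and "i \<in> I \<Longrightarrow> trunc F \<bullet> \<iota> i = (if i \<in> F then \<iota> i else Zero C (X i) P)"
    by blast+
qed

lemma trunc_unique:
  assumes "e \<in> Hom C P P" "\<And>i. i \<in> I \<Longrightarrow> e \<bullet> \<iota> i = (if i \<in> F then \<iota> i else Zero C (X i) P)"
  shows "trunc F = e"
  using assms trunc by (intro cotuple_unique[OF trunc_Hom]) auto

lemma trunc_trunc: "trunc F \<bullet> trunc G = trunc (F \<inter> G)"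
proof (rule trunc_unique[symmetric])
  show "trunc F \<bullet> trunc G \<in> Hom C P P" by (rule comp[OF trunc_Hom trunc_Hom])
  show "(trunc F \<bullet> trunc G) \<bullet> \<iota> i = (if i \<in> F \<inter> G then \<iota> i else Zero C (X i) P)" if "i \<in> I" for i
    using that comp_assoc[OF inj_Hom trunc_Hom trunc_Hom, of i F G] comp_zero[OF trunc_Hom X_Obj]
    by (auto simp: trunc_inj)
qed

lemma trunc_fixes_mono:
  assumes "F \<subseteq> G" "f \<in> Hom C A P" "trunc F \<bullet> f = f"
  shows "trunc G \<bullet> f = f"
  using comp_assoc[OF assms(2) trunc_Hom trunc_Hom, of G F] assms by (simp add: trunc_trunc Int_absorb1)

lemma trunc_empty: "trunc {} = Zero C P P"
  using zero_comp[OF inj_Hom] P_Obj by (intro trunc_unique) (auto simp: zero_closed)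

lemma trunc_insert:
  assumes "i \<in> I" "i \<notin> F"
  shows "trunc (insert i F) = Add C (\<iota> i \<bullet> proj i) (trunc F)"
proof (rule trunc_unique)
  have p: "\<iota> i \<bullet> proj i \<in> Hom C P P" by (rule comp[OF proj(1) inj_Hom]) fact+
  then show "Add C (\<iota> i \<bullet> proj i) (trunc F) \<in> Hom C P P" by (rule add_closed[OF _ trunc_Hom])
  fix j assume j: "j \<in> I"
  have "(\<iota> i \<bullet> proj i) \<bullet> \<iota> j = (if j = i then \<iota> i else Zero C (X j) P)"
    using comp_assoc[OF inj_Hom[OF j] proj(1)[OF assms(1)] inj_Hom[OF assms(1)]] proj(2)[OF assms(1) j]
      comp_ident[OF inj_Hom[OF assms(1)]] comp_zero[OF inj_Hom[OF assms(1)] X_Obj[OF j]] by simp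
  then show "Add C (\<iota> i \<bullet> proj i) (trunc F) \<bullet> \<iota> j = (if j \<in> insert i F then \<iota> j else Zero C (X j) P)"
    using comp_add_left[OF inj_Hom[OF j] p trunc_Hom[of F]] trunc_inj[OF j, of F] assms(2)
      add_zero[OF inj_Hom[OF j]] add_zero[OF zero_closed[OF X_Obj[OF j] P_Obj]] by auto
qed

lemma trunc_eq_gfinprod:
  assumes "finite F" "F \<subseteq> I"
  shows "trunc F = gfinprod (homgrp C P P) (\<lambda>i. \<iota> i \<bullet> proj i) F"
  using assms
proof (induction F rule: finite_induct)
  interpret H: comm_group "homgrp C P P" by (rule hom_group[OF P_Obj P_Obj])
  case empty
  then show ?case by (simp add: trunc_empty)
next
  interpret H: comm_group "homgrp C P P" by (rule hom_group[OF P_Obj P_Obj])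
  case (insert i F)
  have "\<iota> j \<bullet> proj j \<in> Hom C P P" if "j \<in> I" for j using comp[OF proj(1) inj_Hom] that by blast
  then have "gfinprod (homgrp C P P) (\<lambda>i. \<iota> i \<bullet> proj i) (insert i F) =
      Add C (\<iota> i \<bullet> proj i) (gfinprod (homgrp C P P) (\<lambda>i. \<iota> i \<bullet> proj i) F)"
    using insert(1,2,4) H.gfinprod_insert[of F "\<lambda>i. \<iota> i \<bullet> proj i" i]
    by (simp del: H.gfinprod_insert H.gfinprod_eq_finprod add: Pi_iff subset_eq)
  then show ?case using insert trunc_insert[of i F] by simp
qed

text \<open>Says that \<open>f\<close> comes from the direct sum of the groups Hom(A, X_i), without
  naming components. The condition survives precomposition and, since truncations can be enlarged,
  addition; this is what makes it convenient for arguments with triangles.\<close>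

definition finitely_supported :: "'m \<Rightarrow> bool" where
  "finitely_supported f \<longleftrightarrow> (\<exists>F. finite F \<and> F \<subseteq> I \<and> trunc F \<bullet> f = f)"

lemma finitely_supported_gfinprod:
  assumes A: "A \<in> Obj C" and x: "\<And>i. i \<in> I \<Longrightarrow> x i \<in> Hom C A (X i)"
    and fin: "finite {i \<in> I. x i \<noteq> Zero C A (X i)}"
  shows "finitely_supported (gfinprod (homgrp C A P) (\<lambda>i. \<iota> i \<bullet> x i) I)"
proof -
  interpret H: comm_group "homgrp C A P" by (rule hom_group[OF A P_Obj])
  let ?F = "{i \<in> I. x i \<noteq> Zero C A (X i)}"
  have ix: "\<iota> i \<bullet> x i \<in> Hom C A P" if "i \<in> I" for i using comp[OF x inj_Hom] that by blast
  have sub: "finite {i \<in> I. \<iota> i \<bullet> x i \<noteq> Zero C A P}"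
    using comp_zero[OF inj_Hom A] by (intro finite_subset[OF _ fin]) auto
  have eq: "trunc ?F \<bullet> (\<iota> i \<bullet> x i) = \<iota> i \<bullet> x i" if i: "i \<in> I" for i
    using comp_assoc[OF x[OF i] inj_Hom[OF i] trunc_Hom, of ?F] trunc_inj[OF i, of ?F]
      zero_comp[OF x[OF i] P_Obj] comp_zero[OF inj_Hom[OF i] A] i by (auto split: if_splits)
  have "trunc ?F \<bullet> gfinprod (homgrp C A P) (\<lambda>i. \<iota> i \<bullet> x i) I =
      gfinprod (homgrp C A P) (\<lambda>i. trunc ?F \<bullet> (\<iota> i \<bullet> x i)) I"
    by (rule comp_gfinprod[OF trunc_Hom A ix sub])
  also have "\<dots> = gfinprod (homgrp C A P) (\<lambda>i. \<iota> i \<bullet> x i) I"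
    using ix eq by (intro H.gfinprod_cong) (auto simp: simp_implies_def)
  finally show ?thesis using fin unfolding finitely_supported_def by blast
qed

lemma proj_gfinprod:
  assumes A: "A \<in> Obj C" and x: "\<And>i. i \<in> I \<Longrightarrow> x i \<in> Hom C A (X i)"
    and fin: "finite {i \<in> I. x i \<noteq> Zero C A (X i)}" and j: "j \<in> I"
  shows "proj j \<bullet> gfinprod (homgrp C A P) (\<lambda>i. \<iota> i \<bullet> x i) I = x j"
proof -
  interpret H: comm_group "homgrp C A (X j)" by (rule hom_group[OF A X_Obj[OF j]])
  have ix: "\<iota> i \<bullet> x i \<in> Hom C A P" if "i \<in> I" for i using comp[OF x inj_Hom] that by blast
  have sub: "finite {i \<in> I. \<iota> i \<bullet> x i \<noteq> Zero C A P}"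
    using comp_zero[OF inj_Hom A] by (intro finite_subset[OF _ fin]) auto
  have eq: "proj j \<bullet> (\<iota> i \<bullet> x i) = (if i = j then x j else Zero C A (X j))" if i: "i \<in> I" for i
    using comp_assoc[OF x[OF i] inj_Hom[OF i] proj(1)[OF j]] proj(2)[OF j i]
      zero_comp[OF x[OF i] X_Obj[OF j]] ident_comp[OF x[OF j]] by auto
  have "proj j \<bullet> gfinprod (homgrp C A P) (\<lambda>i. \<iota> i \<bullet> x i) I =
      gfinprod (homgrp C A (X j)) (\<lambda>i. proj j \<bullet> (\<iota> i \<bullet> x i)) I"
    by (rule comp_gfinprod[OF proj(1)[OF j] A ix sub])
  also have "\<dots> = proj j \<bullet> (\<iota> j \<bullet> x j)"
    using eq comp[OF ix proj(1)[OF j]] j by (intro H.gfinprod_single) auto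
  finally show ?thesis using eq[OF j] by simp
qed

lemma finitely_supported_sum:
  assumes f: "f \<in> Hom C A P" and "finitely_supported f"
  obtains x where "x \<in> (\<Pi>\<^sub>E i \<in> I. Hom C A (X i))" "finite {i \<in> I. x i \<noteq> Zero C A (X i)}"
    "gfinprod (homgrp C A P) (\<lambda>i. \<iota> i \<bullet> x i) I = f"
proof -
  obtain F where F: "finite F" "F \<subseteq> I" "trunc F \<bullet> f = f"
    using assms(2) by (auto simp: finitely_supported_def)
  have A: "A \<in> Obj C" using Hom_Obj f by blast
  interpret H: comm_group "homgrp C A P" by (rule hom_group[OF A P_Obj])
  \<comment> \<open>Components outside \<open>F\<close> are set to zero, which bounds the support;
    the restriction to \<open>I\<close> gives an extensional function, as membership in
    \<open>sum_group\<close> demands.\<close>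
  define x where "x = (\<lambda>i \<in> I. if i \<in> F then proj i \<bullet> f else Zero C A (X i))"
  have x: "x i \<in> Hom C A (X i)" if "i \<in> I" for i
    using that comp[OF f proj(1)] zero_closed[OF A X_Obj] by (auto simp: x_def)
  have ip: "\<iota> i \<bullet> proj i \<in> Hom C P P" if "i \<in> I" for i using comp[OF proj(1) inj_Hom] that by blast
  have eq: "\<iota> i \<bullet> x i = (if i \<in> F then (\<iota> i \<bullet> proj i) \<bullet> f else Zero C A P)" if "i \<in> I" for i
    using comp_assoc[OF f proj(1)[OF that] inj_Hom[OF that]] comp_zero[OF inj_Hom[OF that] A] that
    by (auto simp: x_def)
  have "gfinprod (homgrp C A P) (\<lambda>i. \<iota> i \<bullet> x i) I = gfinprod (homgrp C A P) (\<lambda>i. (\<iota> i \<bullet> proj i) \<bullet> f) F"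
  proof (rule H.gfinprod_mono_neutral_cong_right)
    show "F \<subseteq> I" by (rule F(2))
    show "(\<lambda>i. \<iota> i \<bullet> x i) \<in> I \<rightarrow> carrier (homgrp C A P)" using comp[OF x inj_Hom] by simp
    show "\<iota> i \<bullet> x i = \<one>\<^bsub>homgrp C A P\<^esub>" if "i \<in> I - F" for i using that eq[of i] by simp
    show "\<iota> i \<bullet> x i = (\<iota> i \<bullet> proj i) \<bullet> f" if "i \<in> F" for i using that eq[of i] F(2) by auto
  qed
  also have "\<dots> = trunc F \<bullet> f"
    unfolding trunc_eq_gfinprod[OF F(1,2)] using F(1,2) ip
    by (intro gfinprod_comp[OF f P_Obj, symmetric]) auto
  finally have "gfinprod (homgrp C A P) (\<lambda>i. \<iota> i \<bullet> x i) I = f" using F(3) by simp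
  moreover have "finite {i \<in> I. x i \<noteq> Zero C A (X i)}"
    by (rule finite_subset[OF _ F(1)]) (auto simp: x_def)
  moreover have "x \<in> (\<Pi>\<^sub>E i \<in> I. Hom C A (X i))" using x by (auto simp: x_def)
  ultimately show ?thesis using that by blast
qed

text \<open>The canonical map is always an injective homomorphism, because the projections recover
  the components of a finite sum. Only surjectivity is at stake, and a map is hit exactly if it is
  finitely supported.\<close>

lemma canonical_map_iso_iff:
  assumes A: "A \<in> Obj C"
  shows "(\<lambda>x. gfinprod (homgrp C A P) (\<lambda>i. \<iota> i \<bullet> x i) I)
      \<in> iso (sum_group I (\<lambda>i. homgrp C A (X i))) (homgrp C A P) \<longleftrightarrow>
    (\<forall>f \<in> Hom C A P. finitely_supported f)" (is "?c \<in> iso ?S ?H \<longleftrightarrow> _")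
proof -
  interpret H: comm_group ?H by (rule hom_group[OF A P_Obj])
  have S: "carrier ?S = {x \<in> \<Pi>\<^sub>E i\<in>I. Hom C A (X i). finite {i \<in> I. x i \<noteq> Zero C A (X i)}}"
    using hom_group[OF A X_Obj] by (subst carrier_sum_group) (auto simp: comm_group.axioms)
  have xi: "x i \<in> Hom C A (X i)" if "x \<in> carrier ?S" "i \<in> I" for x i
    using that by (simp add: S PiE_iff)
  have ix: "\<iota> i \<bullet> x i \<in> Hom C A P" if "x \<in> carrier ?S" "i \<in> I" for x i
    by (rule comp[OF xi[OF that] inj_Hom[OF that(2)]])
  have fin: "finite {i \<in> I. \<iota> i \<bullet> x i \<noteq> Zero C A P}" if "x \<in> carrier ?S" for x
  proof (rule finite_subset)
    show "finite {i \<in> I. x i \<noteq> Zero C A (X i)}" using that by (simp add: S)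
    show "{i \<in> I. \<iota> i \<bullet> x i \<noteq> Zero C A P} \<subseteq> {i \<in> I. x i \<noteq> Zero C A (X i)}"
      using comp_zero[OF inj_Hom A] by auto
  qed
  have closed: "?c x \<in> Hom C A P" if "x \<in> carrier ?S" for x
    by (rule gfinprod_Hom[OF A P_Obj ix[OF that]])
  have hom: "?c \<in> hom ?S ?H"
  proof (rule homI)
    show "?c x \<in> carrier ?H" if "x \<in> carrier ?S" for x using closed[OF that] by simp
    fix x y assume xy: "x \<in> carrier ?S" "y \<in> carrier ?S"
    have "?c (x \<otimes>\<^bsub>?S\<^esub> y) = gfinprod ?H (\<lambda>i. \<iota> i \<bullet> x i \<otimes>\<^bsub>?H\<^esub> \<iota> i \<bullet> y i) I"
      using add_closed[OF ix[OF xy(1)] ix[OF xy(2)]]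
        comp_add_right[OF xi[OF xy(1)] xi[OF xy(2)] inj_Hom]
      by (intro H.gfinprod_cong) (simp_all add: simp_implies_def)
    also have "\<dots> = ?c x \<otimes>\<^bsub>?H\<^esub> ?c y"
      using fin[OF xy(1)] fin[OF xy(2)] ix[OF xy(1)] ix[OF xy(2)]
      by (intro H.gfinprod_distrib) (auto simp: Pi_iff)
    finally show "?c (x \<otimes>\<^bsub>?S\<^esub> y) = ?c x \<otimes>\<^bsub>?H\<^esub> ?c y" .
  qed
  have pr: "proj j \<bullet> ?c x = x j" if "x \<in> carrier ?S" "j \<in> I" for x j
    using that(1) by (intro proj_gfinprod[OF A xi[OF that(1)] _ that(2)]) (simp_all add: S)
  have inj: "inj_on ?c (carrier ?S)"
  proof (rule inj_onI)
    fix x y assume xy: "x \<in> carrier ?S" "y \<in> carrier ?S" "?c x = ?c y"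
    have "x j = y j" if "j \<in> I" for j using pr[OF xy(1) that] pr[OF xy(2) that] xy(3) by simp
    then show "x = y" using xy(1,2) unfolding S by (auto intro: PiE_ext)
  qed
  have "?c ` carrier ?S = Hom C A P \<longleftrightarrow> (\<forall>f \<in> Hom C A P. finitely_supported f)"
  proof
    assume surj: "?c ` carrier ?S = Hom C A P"
    show "\<forall>f \<in> Hom C A P. finitely_supported f"
      unfolding surj[symmetric] using finitely_supported_gfinprod[OF A] by (auto simp: S)
  next
    assume fs: "\<forall>f \<in> Hom C A P. finitely_supported f"
    show "?c ` carrier ?S = Hom C A P"
    proof
      show "?c ` carrier ?S \<subseteq> Hom C A P" using closed by blast
      show "Hom C A P \<subseteq> ?c ` carrier ?S"
      proof
        fix f assume f: "f \<in> Hom C A P"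
        with fs obtain x where "x \<in> (\<Pi>\<^sub>E i \<in> I. Hom C A (X i))"
          "finite {i \<in> I. x i \<noteq> Zero C A (X i)}" "?c x = f"
          using finitely_supported_sum by blast
        then show "f \<in> ?c ` carrier ?S" unfolding S by blast
      qed
    qed
  qed
  then show ?thesis using hom inj by (simp add: iso_iff)
qed

end

lemma compacts_iff:
  fixes T :: "('o, 'm, 'z) precat_scheme"
  assumes "preadditive_category T"
  shows "A \<in> compacts TYPE('u) T \<longleftrightarrow> A \<in> Obj T \<and>
    (\<forall>(I :: 'u set) X P \<iota>. small TYPE('u) I \<longrightarrow> is_coproduct T I X P \<iota> \<longrightarrow>
       (\<forall>f \<in> Hom T A P. coproduct.finitely_supported T I X P \<iota> f))"
proof -
  have "coproduct T I X P \<iota>" if "is_coproduct T I X P \<iota>" for I :: "'u set" and X P \<iota>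
    using assms that by (simp add: coproduct_def coproduct_axioms_def)
  then have "((\<lambda>x. gfinprod (homgrp T A P) (\<lambda>i. \<iota> i \<bullet>\<^bsub>T\<^esub> x i) I)
        \<in> iso (sum_group I (\<lambda>i. homgrp T A (X i))) (homgrp T A P)) =
      (\<forall>f \<in> Hom T A P. coproduct.finitely_supported T I X P \<iota> f)"
    if "A \<in> Obj T" "is_coproduct T I X P \<iota>" for I :: "'u set" and X P \<iota>
    using that by (intro coproduct.canonical_map_iso_iff)
  then show ?thesis
    unfolding compacts_def by (simp cong: conj_cong imp_cong)
qed

section \<open>Triangulated categories\<close>

lemma isomorphismE:
  assumes "isomorphism C e" "e \<in> Hom C A B"
  obtains e' where "e' \<in> Hom C B A" "e' \<bullet>\<^bsub>C\<^esub> e = Ident C A" "e \<bullet>\<^bsub>C\<^esub> e' = Ident C B"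
  using assms unfolding isomorphism_def by (auto simp: HomD)

context triangulated_category
begin

text \<open>The empty coproduct is initial, so its identity is the zero map, and this makes it
  terminal as well.\<close>

lemma ex_zero_object: "\<exists>N. zero_object T N"
proof -
  obtain P \<iota> where P: "is_coproduct T {} (\<lambda>_ :: nat. undefined) P \<iota>"
    using finite_coproducts[of "{}" "\<lambda>_ :: nat. undefined"] by auto
  have P_Obj: "P \<in> Obj T" using P by (simp add: is_coproduct_def)
  have init: "\<exists>!f. f \<in> Hom T P A" if "A \<in> Obj T" for A using P that by (simp add: is_coproduct_def)
  have id: "Ident T P = Zero T P P" using init[OF P_Obj] ident[OF P_Obj] zero_closed[OF P_Obj P_Obj] by blast
  have "f = Zero T A P" if f: "f \<in> Hom T A P" for A f
    using ident_comp[OF f] zero_comp[OF f P_Obj] id by simp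
  then have "zero_object T P"
    using init P_Obj zero_closed[OF _ P_Obj] unfolding zero_object_def by blast
  then show ?thesis ..
qed

lemma zero_object_Obj: "zero_object T N \<Longrightarrow> N \<in> Obj T"
  by (simp add: zero_object_def)

lemma zero_objectI:
  assumes N: "N \<in> Obj T" and id: "Ident T N = Zero T N N"
  shows "zero_object T N"
proof -
  have "f = Zero T A N" if f: "f \<in> Hom T A N" for A f
    using ident_comp[OF f] zero_comp[OF f N] id by simp
  moreover have "f = Zero T N A" if f: "f \<in> Hom T N A" for A f
    using comp_ident[OF f] comp_zero[OF f N] id by simp
  ultimately show ?thesis
    using N zero_closed unfolding zero_object_def by blast
qed

lemma zero_object_ident:
  assumes "zero_object T N"
  shows "Ident T N = Zero T N N"
proof -
  have N: "N \<in> Obj T" using assms by (rule zero_object_Obj)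
  have "\<exists>!f. f \<in> Hom T N N" using assms N by (simp add: zero_object_def)
  then show ?thesis using ident[OF N] zero_closed[OF N N] by blast
qed

lemma shift_Obj: "A \<in> Obj T \<Longrightarrow> ShO T A \<in> Obj T"
  using shift_additive by (simp add: is_additive_fctr_def is_fctr_def)

lemma shift_ident: "A \<in> Obj T \<Longrightarrow> ShA T (Ident T A) = Ident T (ShO T A)"
  using shift_additive by (simp add: is_additive_fctr_def is_fctr_def)

lemma shift_Hom:
  assumes "f \<in> Hom T A B"
  shows "ShA T f \<in> Hom T (ShO T A) (ShO T B)"
  using shift_additive HomD[OF assms] by (auto simp: is_additive_fctr_def is_fctr_def)

lemma shift_comp:
  assumes "f \<in> Hom T A B" "g \<in> Hom T B E"
  shows "ShA T (g \<bullet> f) = ShA T g \<bullet> ShA T f"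
  using shift_additive HomD[OF assms(1)] HomD[OF assms(2)] by (simp add: is_additive_fctr_def is_fctr_def)

lemma shift_zero:
  assumes "A \<in> Obj T" "B \<in> Obj T"
  shows "ShA T (Zero T A B) = Zero T (ShO T A) (ShO T B)"
proof (rule add_idem_zero)
  have z: "Zero T A B \<in> Hom T A B" using assms by (rule zero_closed)
  then show "ShA T (Zero T A B) \<in> Hom T (ShO T A) (ShO T B)" by (rule shift_Hom)
  show "Add T (ShA T (Zero T A B)) (ShA T (Zero T A B)) = ShA T (Zero T A B)"
    using shift_additive z add_zero(1)[OF z] unfolding is_additive_fctr_def by metis
qed

lemma shift_zero_object:
  assumes "zero_object T N"
  shows "zero_object T (ShO T N)"
  using zero_object_Obj[OF assms] zero_object_ident[OF assms]
  by (intro zero_objectI) (auto simp: shift_Obj shift_zero simp flip: shift_ident)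

lemma shift_faithful:
  assumes "f \<in> Hom T A B" "g \<in> Hom T A B" "ShA T f = ShA T g"
  shows "f = g"
  using shift_fully_faithful[OF Hom_Obj[OF assms(1)]] assms by (auto simp: bij_betw_def inj_on_def)

lemma shift_full:
  assumes "A \<in> Obj T" "B \<in> Obj T" "g \<in> Hom T (ShO T A) (ShO T B)"
  obtains f where "f \<in> Hom T A B" "ShA T f = g"
proof -
  have "g \<in> ShA T ` Hom T A B"
    using shift_fully_faithful[OF assms(1,2)] assms(3) by (simp add: bij_betw_def)
  then show ?thesis using that by blast
qed

section \<open>Exactness of triangles; compactness of cones and shifts\<close>

lemma triangle_comp_zero:
  assumes tri: "(f, g, h) \<in> Tri T" and f: "f \<in> Hom T X Y" and g: "g \<in> Hom T Y Z"
  shows "g \<bullet> f = Zero T X Z"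
proof -
  obtain N where N: "zero_object T N" using ex_zero_object by blast
  have X: "X \<in> Obj T" using Hom_Obj[OF f] by blast
  have z: "Zero T X N \<in> Hom T X N" using X zero_object_Obj[OF N] by (rule zero_closed)
  \<comment> \<open>The identity of \<open>X\<close> and the map \<open>f\<close> go from the
    triangle on \<open>Ident T X\<close>, whose third object \<open>N\<close> is zero, to the given
    one. TR3 completes them, so \<open>g \<bullet> f\<close> factors through
    \<open>N\<close>.\<close>
  have "\<exists>c \<in> Hom T (Cod T (Zero T X N)) (Cod T g).
      c \<bullet> Zero T X N = g \<bullet> f \<and> ShA T (Ident T X) \<bullet> Zero T N (ShO T X) = h \<bullet> c"
    using ident[OF X] f by (intro TR3[OF TR1_identity[OF X N] tri]) (auto simp: HomD)
  then obtain c where "c \<in> Hom T N Z" "c \<bullet> Zero T X N = g \<bullet> f"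
    using HomD(3)[OF z] HomD(3)[OF g] by auto
  then show ?thesis using comp_zero[of c N Z X] X by simp
qed

text \<open>\<open>g\<close> is a weak cokernel of \<open>f\<close>, in other words Hom(-, W) is
  exact at \<open>Y\<close>. The extension is the third map of a morphism, given by TR3, to a
  triangle N -> W -> W with \<open>N\<close> zero.\<close>

lemma triangle_extend:
  assumes tri: "(f, g, h) \<in> Tri T" and f: "f \<in> Hom T X Y" and g: "g \<in> Hom T Y Z"
    and a: "a \<in> Hom T Y W" and af: "a \<bullet> f = Zero T X W"
  obtains c where "c \<in> Hom T Z W" "c \<bullet> g = a"
proof -
  obtain N where N: "zero_object T N" using ex_zero_object by blast
  have Obj: "N \<in> Obj T" "X \<in> Obj T" "W \<in> Obj T" "ShO T N \<in> Obj T"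
    using zero_object_Obj[OF N] Hom_Obj[OF f] Hom_Obj[OF a] shift_Obj by auto
  \<comment> \<open>The zero object \<open>ShO T N\<close> is taken as third term, so that TR2 can
    rotate this triangle backwards to one starting at \<open>N\<close>; the sign disappears because
    the map concerned is zero.\<close>
  have "(Ident T W, Zero T W (ShO T N), Zero T (ShO T N) (ShO T W)) \<in> Tri T"
    by (rule TR1_identity[OF Obj(3) shift_zero_object[OF N]])
  then have "(Ident T W, Zero T W (ShO T N), Neg T (ShA T (Zero T N W))) \<in> Tri T"
    using Obj by (simp add: shift_zero neg_zero shift_Obj)
  then have tri': "(Zero T N W, Ident T W, Zero T W (ShO T N)) \<in> Tri T"
    using TR2[OF zero_closed[OF Obj(1,3)] ident[OF Obj(3)] zero_closed[OF Obj(3,4)]] by blast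
  have z: "Zero T X N \<in> Hom T X N" "Zero T N W \<in> Hom T N W" using Obj by (auto intro: zero_closed)
  have "a \<bullet> f = Zero T N W \<bullet> Zero T X N" using af comp_zero[OF z(2) Obj(2)] by simp
  then have "\<exists>c \<in> Hom T (Cod T g) (Cod T (Ident T W)).
      c \<bullet> g = Ident T W \<bullet> a \<and> ShA T (Zero T X N) \<bullet> h = Zero T W (ShO T N) \<bullet> c"
    using z a by (intro TR3[OF tri tri']) (auto simp: HomD[OF f] HomD[OF z(2)])
  then show ?thesis
    using that HomD(3)[OF g] HomD(3)[OF ident[OF Obj(3)]] ident_comp[OF a] by auto
qed

lemma triangle_rotate:
  assumes "(f, g, h) \<in> Tri T" "f \<in> Hom T X Y" "g \<in> Hom T Y Z" "h \<in> Hom T Z (ShO T X)"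
  shows "(g, h, Neg T (ShA T f)) \<in> Tri T"
  using assms TR2 by blast

text \<open>On \<open>Y\<close> a map \<open>t\<close> from \<open>Z\<close> into a coproduct agrees
  with a finite truncation of itself. The difference vanishes on \<open>Y\<close>, so it factors
  through the shift of \<open>X\<close> and is finitely supported too; the union of the two finite
  sets then serves for \<open>t\<close>.\<close>

lemma compacts_coneI:
  assumes tri: "(f, g, h) \<in> Tri T"
    and f: "f \<in> Hom T X Y" and g: "g \<in> Hom T Y Z" and h: "h \<in> Hom T Z (ShO T X)"
    and Y: "Y \<in> compacts TYPE('u) T" and SX: "ShO T X \<in> compacts TYPE('u) T"
  shows "Z \<in> compacts TYPE('u) T"
  unfolding compacts_iff[OF preadditive_category_axioms]
proof (intro conjI allI impI ballI)
  show "Z \<in> Obj T" using Hom_Obj[OF g] by blast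
  fix I :: "'u set" and W P \<iota> t
  assume I: "small TYPE('u) I" and cop: "is_coproduct T I W P \<iota>" and t: "t \<in> Hom T Z P"
  interpret coproduct T I W P \<iota>
    using cop by unfold_locales
  have fs: "finitely_supported s" if "A \<in> compacts TYPE('u) T" "s \<in> Hom T A P" for A s
    using that I cop unfolding compacts_iff[OF preadditive_category_axioms] by blast
  obtain F where F: "finite F" "F \<subseteq> I" "trunc F \<bullet> (t \<bullet> g) = t \<bullet> g"
    using fs[OF Y comp[OF g t]] by (auto simp: finitely_supported_def)
  let ?s = "trunc F \<bullet> t"
  let ?w = "Add T t (Neg T ?s)"
  have s: "?s \<in> Hom T Z P" by (rule comp[OF t trunc_Hom])
  have w: "?w \<in> Hom T Z P" by (rule add_closed[OF t neg_closed[OF s]])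
  have "?w \<bullet> g = Zero T Y P"
    using diff_comp_zero_iff[OF g t s] comp_assoc[OF g t trunc_Hom, of F] F(3) by simp
  then obtain r where r: "r \<in> Hom T (ShO T X) P" "r \<bullet> h = ?w"
    using triangle_extend[OF triangle_rotate[OF tri f g h] g h w] by blast
  obtain G where G: "finite G" "G \<subseteq> I" "trunc G \<bullet> r = r"
    using fs[OF SX r(1)] by (auto simp: finitely_supported_def)
  have wG: "trunc G \<bullet> ?w = ?w" using comp_assoc[OF h r(1) trunc_Hom, of G] G(3) r(2) by simp
  have sF: "trunc F \<bullet> ?s = ?s" using comp_assoc[OF t trunc_Hom trunc_Hom, of F F] by (simp add: trunc_trunc)
  have t_eq: "t = Add T ?w ?s"
    using add_assoc[OF t neg_closed[OF s] s] add_neg(2)[OF s] add_zero(1)[OF t] by simp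
  have "trunc (F \<union> G) \<bullet> t = Add T (trunc (F \<union> G) \<bullet> ?w) (trunc (F \<union> G) \<bullet> ?s)"
    by (subst t_eq) (rule comp_add_right[OF w s trunc_Hom])
  also have "\<dots> = Add T ?w ?s"
    using trunc_fixes_mono[OF _ w wG, of "F \<union> G"] trunc_fixes_mono[OF _ s sF, of "F \<union> G"] by simp
  finally show "finitely_supported t"
    unfolding finitely_supported_def using F G t_eq by (intro exI[of _ "F \<union> G"]) auto
qed

text \<open>A fully faithful functor reflects coproducts: the cotuple is formed for the shifted
  maps, lifted by fullness, and compared with others by faithfulness.\<close>

lemma coproduct_unshift:
  assumes P': "P' \<in> Obj T" and X': "\<And>i. i \<in> I \<Longrightarrow> X' i \<in> Obj T"
    and cop: "is_coproduct T I (\<lambda>i. ShO T (X' i)) (ShO T P') (\<lambda>i. ShA T (\<iota>' i))"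
    and \<iota>': "\<And>i. i \<in> I \<Longrightarrow> \<iota>' i \<in> Hom T (X' i) P'"
  shows "is_coproduct T I X' P' \<iota>'"
  unfolding is_coproduct_def
proof (intro conjI ballI allI impI)
  interpret coproduct T I "\<lambda>i. ShO T (X' i)" "ShO T P'" "\<lambda>i. ShA T (\<iota>' i)"
    using cop by unfold_locales
  fix Z k assume Z: "Z \<in> Obj T" and k: "\<forall>i \<in> I. k i \<in> Hom T (X' i) Z"
  have Sk: "ShA T (k i) \<in> Hom T (ShO T (X' i)) (ShO T Z)" if "i \<in> I" for i using k that shift_Hom by blast
  obtain u where u: "u \<in> Hom T (ShO T P') (ShO T Z)" "\<forall>i \<in> I. u \<bullet> ShA T (\<iota>' i) = ShA T (k i)"
    using ex_cotuple[OF shift_Obj[OF Z] Sk] by blast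
  obtain v where v: "v \<in> Hom T P' Z" "ShA T v = u" using shift_full[OF P' Z u(1)] by blast
  show "\<exists>!u. u \<in> Hom T P' Z \<and> (\<forall>i \<in> I. u \<bullet> \<iota>' i = k i)"
  proof (intro ex1I[of _ v] conjI ballI)
    show "v \<in> Hom T P' Z" by (rule v(1))
    show "v \<bullet> \<iota>' i = k i" if i: "i \<in> I" for i
      using i k u(2) shift_comp[OF \<iota>'[OF i] v(1)] v(2)
      by (intro shift_faithful[OF comp[OF \<iota>'[OF i] v(1)]]) auto
    fix w assume w: "w \<in> Hom T P' Z \<and> (\<forall>i \<in> I. w \<bullet> \<iota>' i = k i)"
    have "ShA T w = u"
    proof (rule cotuple_unique[OF _ u(1)])
      show "ShA T w \<in> Hom T (ShO T P') (ShO T Z)" using w shift_Hom by blast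
      show "ShA T w \<bullet> ShA T (\<iota>' i) = u \<bullet> ShA T (\<iota>' i)" if i: "i \<in> I" for i
        using shift_comp[OF \<iota>'[OF i], of w Z] w i u(2) by simp
    qed
    then show "w = v" using w v shift_faithful by blast
  qed
qed (use assms in auto)

text \<open>Since \<open>\<Sigma>\<close> is an equivalence, every coproduct is isomorphic to the shift of a coproduct.\<close>

lemma compacts_shift:
  assumes A: "A \<in> compacts TYPE('u) T"
  shows "ShO T A \<in> compacts TYPE('u) T"
  unfolding compacts_iff[OF preadditive_category_axioms]
proof (intro conjI allI impI ballI)
  have A_Obj: "A \<in> Obj T" using A by (simp add: compacts_def)
  then show "ShO T A \<in> Obj T" by (rule shift_Obj)
  fix I :: "'u set" and X P \<iota> t
  assume I: "small TYPE('u) I" and cop: "is_coproduct T I X P \<iota>" and t: "t \<in> Hom T (ShO T A) P"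
  interpret coproduct T I X P \<iota> using cop by unfold_locales
  obtain P' e where P': "P' \<in> Obj T" and e: "e \<in> Hom T (ShO T P') P" "isomorphism T e"
    using shift_essentially_surjective[OF P_Obj] by blast
  obtain e' where e': "e' \<in> Hom T P (ShO T P')" "e' \<bullet> e = Ident T (ShO T P')" "e \<bullet> e' = Ident T P"
    using isomorphismE[OF e(2,1)] by blast
  have "\<forall>i \<in> I. \<exists>A \<in> Obj T. \<exists>d d'. d \<in> Hom T (ShO T A) (X i) \<and> d' \<in> Hom T (X i) (ShO T A) \<and>
      d' \<bullet> d = Ident T (ShO T A) \<and> d \<bullet> d' = Ident T (X i)"
  proof
    fix i assume "i \<in> I"
    then obtain A d where A: "A \<in> Obj T" and d: "d \<in> Hom T (ShO T A) (X i)" "isomorphism T d"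
      using shift_essentially_surjective[OF X_Obj] by blast
    then show "\<exists>A \<in> Obj T. \<exists>d d'. d \<in> Hom T (ShO T A) (X i) \<and> d' \<in> Hom T (X i) (ShO T A) \<and>
        d' \<bullet> d = Ident T (ShO T A) \<and> d \<bullet> d' = Ident T (X i)"
      using isomorphismE[OF d(2,1)] by blast
  qed
  then obtain X' d d' where X': "\<And>i. i \<in> I \<Longrightarrow> X' i \<in> Obj T"
    and d: "\<And>i. i \<in> I \<Longrightarrow> d i \<in> Hom T (ShO T (X' i)) (X i)"
    and d': "\<And>i. i \<in> I \<Longrightarrow> d' i \<in> Hom T (X i) (ShO T (X' i))"
    and d'd: "\<And>i. i \<in> I \<Longrightarrow> d' i \<bullet> d i = Ident T (ShO T (X' i))"
    and dd': "\<And>i. i \<in> I \<Longrightarrow> d i \<bullet> d' i = Ident T (X i)"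
    by metis
  have \<iota>d: "\<iota> i \<bullet> d i \<in> Hom T (ShO T (X' i)) P" if "i \<in> I" for i using comp[OF d inj_Hom] that by blast
  have "\<forall>i \<in> I. \<exists>j \<in> Hom T (X' i) P'. ShA T j = e' \<bullet> (\<iota> i \<bullet> d i)"
    using shift_full[OF X' P' comp[OF \<iota>d e'(1)]] by blast
  then obtain \<iota>' where \<iota>': "\<And>i. i \<in> I \<Longrightarrow> \<iota>' i \<in> Hom T (X' i) P'"
    and S\<iota>': "\<And>i. i \<in> I \<Longrightarrow> ShA T (\<iota>' i) = e' \<bullet> (\<iota> i \<bullet> d i)" by metis
  have e\<iota>': "e \<bullet> ShA T (\<iota>' i) = \<iota> i \<bullet> d i" if i: "i \<in> I" for i
    using S\<iota>'[OF i] comp_assoc[OF \<iota>d[OF i] e'(1) e(1)] e'(3) ident_comp[OF \<iota>d[OF i]] by simp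
  have \<iota>_eq: "\<iota> i = (e \<bullet> ShA T (\<iota>' i)) \<bullet> d' i" if i: "i \<in> I" for i
    using e\<iota>'[OF i] comp_assoc[OF d'[OF i] d[OF i] inj_Hom[OF i]] dd'[OF i] comp_ident[OF inj_Hom[OF i]] by simp
  have e'\<iota>: "e' \<bullet> \<iota> i = ShA T (\<iota>' i) \<bullet> d' i" if i: "i \<in> I" for i
  proof -
    have q: "ShA T (\<iota>' i) \<bullet> d' i \<in> Hom T (X i) (ShO T P')" by (rule comp[OF d'[OF i] shift_Hom[OF \<iota>'[OF i]]])
    show ?thesis
      using \<iota>_eq[OF i] comp_assoc[OF d'[OF i] shift_Hom[OF \<iota>'[OF i]] e(1)] comp_assoc[OF q e(1) e'(1)]
        e'(2) ident_comp[OF q] by simp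
  qed
  \<comment> \<open>Through the isomorphisms \<open>e\<close> and \<open>d i\<close> the shifted
    data are identified with the given coproduct, and the universal property is carried along
    them.\<close>
  have "is_coproduct T I (\<lambda>i. ShO T (X' i)) (ShO T P') (\<lambda>i. ShA T (\<iota>' i))"
    unfolding is_coproduct_def
  proof (intro conjI ballI allI impI)
    show "ShO T P' \<in> Obj T" using P' by (rule shift_Obj)
    show "ShO T (X' i) \<in> Obj T" if "i \<in> I" for i using X'[OF that] by (rule shift_Obj)
    show "ShA T (\<iota>' i) \<in> Hom T (ShO T (X' i)) (ShO T P')" if "i \<in> I" for i using \<iota>'[OF that] by (rule shift_Hom)
    fix Z k assume Z: "Z \<in> Obj T" and k: "\<forall>i \<in> I. k i \<in> Hom T (ShO T (X' i)) Z"
    have kd: "k i \<bullet> d' i \<in> Hom T (X i) Z" if "i \<in> I" for i using comp[OF d'] k that by blast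
    obtain u where u: "u \<in> Hom T P Z" "\<forall>i \<in> I. u \<bullet> \<iota> i = k i \<bullet> d' i"
      using ex_cotuple[OF Z kd] by blast
    show "\<exists>!u. u \<in> Hom T (ShO T P') Z \<and> (\<forall>i \<in> I. u \<bullet> ShA T (\<iota>' i) = k i)"
    proof (intro ex1I[of _ "u \<bullet> e"] conjI ballI)
      show "u \<bullet> e \<in> Hom T (ShO T P') Z" by (rule comp[OF e(1) u(1)])
      show "(u \<bullet> e) \<bullet> ShA T (\<iota>' i) = k i" if i: "i \<in> I" for i
      proof -
        have ki: "k i \<in> Hom T (ShO T (X' i)) Z" using k i by blast
        have "(u \<bullet> e) \<bullet> ShA T (\<iota>' i) = (u \<bullet> \<iota> i) \<bullet> d i"
          using comp_assoc[OF shift_Hom[OF \<iota>'[OF i]] e(1) u(1)] comp_assoc[OF d[OF i] inj_Hom[OF i] u(1)]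
            e\<iota>'[OF i] by simp
        also have "\<dots> = k i"
          using u(2) i comp_assoc[OF d[OF i] d'[OF i] ki] d'd[OF i] comp_ident[OF ki] by simp
        finally show ?thesis .
      qed
      fix w assume w: "w \<in> Hom T (ShO T P') Z \<and> (\<forall>i \<in> I. w \<bullet> ShA T (\<iota>' i) = k i)"
      then have wH: "w \<in> Hom T (ShO T P') Z" by blast
      have "w \<bullet> e' = u"
      proof (rule cotuple_unique[OF comp[OF e'(1) wH] u(1)])
        fix i assume i: "i \<in> I"
        show "(w \<bullet> e') \<bullet> \<iota> i = u \<bullet> \<iota> i"
          using e'\<iota>[OF i] comp_assoc[OF inj_Hom[OF i] e'(1) wH]
            comp_assoc[OF d'[OF i] shift_Hom[OF \<iota>'[OF i]] wH] w u(2) i by simp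
      qed
      then show "w = u \<bullet> e"
        using comp_assoc[OF e(1) e'(1) wH] e'(2) comp_ident[OF wH] by simp
    qed
  qed
  from coproduct_unshift[of P' I X' \<iota>', OF P' X' this \<iota>']
  have cop': "is_coproduct T I X' P' \<iota>'" by simp
  interpret C': coproduct T I X' P' \<iota>' using cop' by unfold_locales
  obtain s where s: "s \<in> Hom T A P'" "ShA T s = e' \<bullet> t"
    using shift_full[OF A_Obj P' comp[OF t e'(1)]] by blast
  have "C'.finitely_supported s"
    using A I cop' s(1) unfolding compacts_iff[OF preadditive_category_axioms] by blast
  then obtain F where F: "finite F" "F \<subseteq> I" "C'.trunc F \<bullet> s = s"
    by (auto simp: C'.finitely_supported_def)
  let ?S = "ShA T (C'.trunc F)"
  have S: "?S \<in> Hom T (ShO T P') (ShO T P')" by (rule shift_Hom[OF C'.trunc_Hom])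
  have Se': "?S \<bullet> e' \<in> Hom T P (ShO T P')" by (rule comp[OF e'(1) S])
  \<comment> \<open>The truncation of \<open>P\<close> is the conjugate under \<open>e\<close> of
    the shifted truncation of \<open>P'\<close>; this turns finite support of \<open>s\<close> into
    finite support of \<open>t\<close>.\<close>
  have "trunc F = e \<bullet> (?S \<bullet> e')"
  proof (rule trunc_unique)
    show "e \<bullet> (?S \<bullet> e') \<in> Hom T P P" by (rule comp[OF Se' e(1)])
    fix i assume i: "i \<in> I"
    have \<Sigma>\<iota>: "ShA T (\<iota>' i) \<in> Hom T (ShO T (X' i)) (ShO T P')" by (rule shift_Hom[OF \<iota>'[OF i]])
    have "(e \<bullet> (?S \<bullet> e')) \<bullet> \<iota> i = e \<bullet> ((?S \<bullet> ShA T (\<iota>' i)) \<bullet> d' i)"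
      using comp_assoc[OF inj_Hom[OF i] Se' e(1)] comp_assoc[OF inj_Hom[OF i] e'(1) S] e'\<iota>[OF i]
        comp_assoc[OF d'[OF i] \<Sigma>\<iota> S] by simp
    also have "\<dots> = (if i \<in> F then \<iota> i else Zero T (X i) P)"
    proof (cases "i \<in> F")
      case True
      then have "?S \<bullet> ShA T (\<iota>' i) = ShA T (\<iota>' i)"
        using C'.trunc_inj[OF i, of F] shift_comp[OF \<iota>'[OF i] C'.trunc_Hom, of F] by simp
      then show ?thesis using True \<iota>_eq[OF i] comp_assoc[OF d'[OF i] \<Sigma>\<iota> e(1)] by simp
    next
      case False
      then have "?S \<bullet> ShA T (\<iota>' i) = Zero T (ShO T (X' i)) (ShO T P')"
        using C'.trunc_inj[OF i, of F] shift_comp[OF \<iota>'[OF i] C'.trunc_Hom, of F]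
          shift_zero[OF X'[OF i] P'] by simp
      then show ?thesis
        using False zero_comp[OF d'[OF i] shift_Obj[OF P']] comp_zero[OF e(1) X_Obj[OF i]] by simp
    qed
    finally show "(e \<bullet> (?S \<bullet> e')) \<bullet> \<iota> i = (if i \<in> F then \<iota> i else Zero T (X i) P)" .
  qed
  moreover have "(e \<bullet> (?S \<bullet> e')) \<bullet> t = t"
  proof -
    have "(e \<bullet> (?S \<bullet> e')) \<bullet> t = e \<bullet> (?S \<bullet> ShA T s)"
      using comp_assoc[OF t Se' e(1)] comp_assoc[OF t e'(1) S] s(2) by simp
    also have "\<dots> = e \<bullet> (e' \<bullet> t)" using shift_comp[OF s(1) C'.trunc_Hom, of F] F(3) s(2) by simp
    also have "\<dots> = t" using comp_assoc[OF t e'(1) e(1)] e'(3) ident_comp[OF t] by simp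
    finally show ?thesis .
  qed
  ultimately show "finitely_supported t"
    unfolding finitely_supported_def using F by (intro exI[of _ F]) simp
qed

end

lemma compacts_subset_Obj: "compacts u T \<subseteq> Obj T"
  by (auto simp: compacts_def)

lemma (in preadditive_category) cpt_preadditive: "preadditive_category (cpt u C)"
  unfolding cpt_def by (rule full_sub_preadditive[OF compacts_subset_Obj])

section \<open>Finitely presented functors\<close>

lemma is_abfunD:
  assumes "is_abfun C F"
  shows abfun_group: "A \<in> Obj C \<Longrightarrow> comm_group (FObj F A)"
    and abfun_ident: "A \<in> Obj C \<Longrightarrow> x \<in> carrier (FObj F A) \<Longrightarrow> FArr F (Ident C A) x = x"
    and abfun_hom: "f \<in> Hom C A B \<Longrightarrow> FArr F f \<in> hom (FObj F A) (FObj F B)"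
    and abfun_closed: "f \<in> Hom C A B \<Longrightarrow> x \<in> carrier (FObj F A) \<Longrightarrow> FArr F f x \<in> carrier (FObj F B)"
    and abfun_comp: "f \<in> Hom C A B \<Longrightarrow> g \<in> Hom C B E \<Longrightarrow> x \<in> carrier (FObj F A) \<Longrightarrow>
      FArr F (g \<bullet>\<^bsub>C\<^esub> f) x = FArr F g (FArr F f x)"
    and abfun_add: "f \<in> Hom C A B \<Longrightarrow> g \<in> Hom C A B \<Longrightarrow> x \<in> carrier (FObj F A) \<Longrightarrow>
      FArr F (Add C f g) x = FArr F f x \<otimes>\<^bsub>FObj F B\<^esub> FArr F g x"
proof -
  show hom: "f \<in> Hom C A B \<Longrightarrow> FArr F f \<in> hom (FObj F A) (FObj F B)" for f A B
    using assms by (auto simp: is_abfun_def Hom_def)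
  show "f \<in> Hom C A B \<Longrightarrow> x \<in> carrier (FObj F A) \<Longrightarrow> FArr F f x \<in> carrier (FObj F B)"
    using hom[of f A B] by (auto simp: hom_def)
qed (use assms in \<open>auto simp: is_abfun_def Hom_def\<close>)

section \<open>Presentations of functors by maps, and universal elements\<close>

definition coker_class :: "('o, 'm, 'z) precat_scheme \<Rightarrow> 'm \<Rightarrow> 'o \<Rightarrow> 'm \<Rightarrow> 'm set" where
  "coker_class C f X x = factoring C f X #>\<^bsub>homgrp C (Dom C f) X\<^esub> x"

text \<open>By the Yoneda lemma \<open>\<xi>\<close> is a transformation from Hom(Dom f, -) to
  \<open>G\<close>. The conditions say that it is onto and that its kernel is the image of Hom(f,
  -). A presentation is thus carried by one element instead of a natural isomorphism onto sets of
  cosets.\<close>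

definition universal_element ::
  "('o, 'm, 'z) precat_scheme \<Rightarrow> 'm \<Rightarrow> ('o, 'm, 'g) abfun \<Rightarrow> 'g \<Rightarrow> bool" where
  "universal_element C f G \<xi> \<longleftrightarrow> \<xi> \<in> carrier (FObj G (Dom C f)) \<and>
     (\<forall>X \<in> Obj C. (\<lambda>x. FArr G x \<xi>) ` Hom C (Dom C f) X = carrier (FObj G X) \<and>
        (\<forall>x \<in> Hom C (Dom C f) X. FArr G x \<xi> = \<one>\<^bsub>FObj G X\<^esub> \<longleftrightarrow> x \<in> factoring C f X))"

lemma universal_elementE:
  assumes "universal_element C f G \<xi>" "X \<in> Obj C" "u \<in> carrier (FObj G X)"
  obtains x where "x \<in> Hom C (Dom C f) X" "u = FArr G x \<xi>"
  using assms unfolding universal_element_def by blast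

locale abelian_functor = preadditive_category C
  for C :: "('o, 'm, 'z) precat_scheme" (structure) and G :: "('o, 'm, 'g) abfun" +
  assumes abfun: "is_abfun C G"
begin

lemmas group = abfun_group[OF abfun]
  and map_ident = abfun_ident[OF abfun]
  and map_hom = abfun_hom[OF abfun]
  and map_closed = abfun_closed[OF abfun]
  and map_comp = abfun_comp[OF abfun]
  and map_add = abfun_add[OF abfun]

lemma map_one:
  assumes "f \<in> Hom C A B"
  shows "FArr G f \<one>\<^bsub>FObj G A\<^esub> = \<one>\<^bsub>FObj G B\<^esub>"
  using hom_one[OF map_hom[OF assms]] group Hom_Obj[OF assms] by (simp add: comm_group.axioms)

lemma evaluation_hom:
  assumes "A \<in> Obj C" "X \<in> Obj C" "\<xi> \<in> carrier (FObj G A)"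
  shows "(\<lambda>x. FArr G x \<xi>) \<in> hom (homgrp C A X) (FObj G X)"
  using assms by (intro homI) (auto simp: map_add intro: map_closed)

lemma evaluation_eq_iff:
  assumes x: "x \<in> Hom C A X" and y: "y \<in> Hom C A X" and \<xi>: "\<xi> \<in> carrier (FObj G A)"
  shows "FArr G x \<xi> = FArr G y \<xi> \<longleftrightarrow> FArr G (Add C x (Neg C y)) \<xi> = \<one>\<^bsub>FObj G X\<^esub>"
proof -
  have Obj: "A \<in> Obj C" "X \<in> Obj C" using Hom_Obj[OF x] by auto
  interpret GX: comm_group "FObj G X" by (rule group[OF Obj(2)])
  interpret ev: group_hom "homgrp C A X" "FObj G X" "\<lambda>x. FArr G x \<xi>"
    using evaluation_hom[OF Obj \<xi>] hom_group[OF Obj]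
    by (simp add: group_hom_def group_hom_axioms_def comm_group.axioms)
  have c: "FArr G x \<xi> \<in> carrier (FObj G X)" "FArr G y \<xi> \<in> carrier (FObj G X)"
    using x y \<xi> by (auto intro: map_closed)
  have "FArr G (Neg C y) \<xi> = inv\<^bsub>FObj G X\<^esub> FArr G y \<xi>"
    using ev.hom_inv[of y] y by (simp add: Neg_eq)
  then have "FArr G (Add C x (Neg C y)) \<xi> = FArr G x \<xi> \<otimes>\<^bsub>FObj G X\<^esub> inv\<^bsub>FObj G X\<^esub> FArr G y \<xi>"
    using map_add[OF x neg_closed[OF y] \<xi>] by simp
  moreover have "FArr G x \<xi> \<otimes>\<^bsub>FObj G X\<^esub> inv\<^bsub>FObj G X\<^esub> FArr G y \<xi> = \<one>\<^bsub>FObj G X\<^esub> \<longleftrightarrow> FArr G x \<xi> = FArr G y \<xi>"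
    by (metis c GX.inv_closed GX.inv_equality GX.inv_inv GX.r_inv)
  ultimately show ?thesis by simp
qed

end

context preadditive_category
begin

lemma factoring_subset: "f \<in> Arr C \<Longrightarrow> factoring C f X \<subseteq> Hom C (Dom C f) X"
  unfolding factoring_def by (auto intro: comp[OF Arr_Hom])

lemma subgroup_factoring:
  assumes "f \<in> Arr C" "X \<in> Obj C"
  shows "subgroup (factoring C f X) (homgrp C (Dom C f) X)"
proof -
  have "group_hom (homgrp C (Cod C f) X) (homgrp C (Dom C f) X) (\<lambda>g. g \<bullet> f)"
    using precomp_hom[OF Arr_Hom assms(2)] hom_group assms dom_cod
    by (simp add: group_hom_def group_hom_axioms_def comm_group.axioms)
  then show ?thesis
    using group_hom.img_is_subgroup[of "homgrp C (Cod C f) X" "homgrp C (Dom C f) X" "\<lambda>g. g \<bullet> f"]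
    by (simp add: factoring_def)
qed

lemma normal_factoring:
  assumes "f \<in> Arr C" "X \<in> Obj C"
  shows "factoring C f X \<lhd> homgrp C (Dom C f) X"
  using comm_group.subgroup_imp_normal[OF hom_group subgroup_factoring[OF assms]] assms dom_cod by blast

lemma coker_class_eq_iff:
  assumes f: "f \<in> Arr C" and x: "x \<in> Hom C (Dom C f) X" and y: "y \<in> Hom C (Dom C f) X"
  shows "coker_class C f X x = coker_class C f X y \<longleftrightarrow> Add C x (Neg C y) \<in> factoring C f X"
proof -
  have Obj: "Dom C f \<in> Obj C" "X \<in> Obj C" using Hom_Obj[OF x] by auto
  interpret H: comm_group "homgrp C (Dom C f) X" by (rule hom_group[OF Obj])
  let ?K = "factoring C f X"
  have sub: "subgroup ?K (homgrp C (Dom C f) X)" by (rule subgroup_factoring[OF f Obj(2)])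
  show ?thesis
  proof
    assume "coker_class C f X x = coker_class C f X y"
    then have "x \<in> ?K #>\<^bsub>homgrp C (Dom C f) X\<^esub> y"
      using H.rcos_self[OF _ sub, of x] x by (simp add: coker_class_def)
    then obtain k where k: "k \<in> ?K" "x = Add C k y" by (auto simp: r_coset_def)
    then have "k \<in> Hom C (Dom C f) X" using factoring_subset[OF f] by blast
    then show "Add C x (Neg C y) \<in> ?K"
      using k add_assoc[OF _ y neg_closed[OF y]] add_neg(1)[OF y] add_zero(1) by simp
  next
    assume d: "Add C x (Neg C y) \<in> ?K"
    have "x = Add C (Add C x (Neg C y)) y"
      using add_assoc[OF x neg_closed[OF y] y] add_neg(2)[OF y] add_zero(1)[OF x] by simp
    then have "x \<in> ?K #>\<^bsub>homgrp C (Dom C f) X\<^esub> y" using d by (auto simp: r_coset_def)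
    then show "coker_class C f X x = coker_class C f X y"
      using H.repr_independence[OF _ _ sub, of x y] y by (simp add: coker_class_def)
  qed
qed

lemma coker_class_self:
  assumes "f \<in> Arr C" "x \<in> Hom C (Dom C f) X"
  shows "x \<in> coker_class C f X x"
proof -
  interpret H: comm_group "homgrp C (Dom C f) X" by (rule hom_group[OF Hom_Obj[OF assms(2)]])
  show ?thesis
    using H.rcos_self[OF _ subgroup_factoring[OF assms(1) Hom_Obj(2)[OF assms(2)]], of x] assms(2)
    by (simp add: coker_class_def)
qed

lemma coker_class_subset:
  assumes "f \<in> Arr C" "x \<in> Hom C (Dom C f) X" "y \<in> coker_class C f X x"
  shows "y \<in> Hom C (Dom C f) X" "coker_class C f X y = coker_class C f X x"
proof -
  interpret H: comm_group "homgrp C (Dom C f) X" by (rule hom_group[OF Hom_Obj[OF assms(2)]])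
  note sub = subgroup_factoring[OF assms(1) Hom_Obj(2)[OF assms(2)]]
  show "y \<in> Hom C (Dom C f) X"
    using assms(2,3) H.r_coset_subset_G[OF subgroup.subset[OF sub], of x]
    by (auto simp: coker_class_def)
  show "coker_class C f X y = coker_class C f X x"
    using assms(2,3) H.repr_independence[OF _ _ sub, of y x] by (simp add: coker_class_def)
qed

lemma carrier_coker_fun: "carrier (FObj (coker_fun C f) X) = coker_class C f X ` Hom C (Dom C f) X"
  by (simp add: coker_fun_def carrier_FactGroup coker_class_def)

lemma one_coker_fun:
  assumes "f \<in> Arr C" "X \<in> Obj C"
  shows "\<one>\<^bsub>FObj (coker_fun C f) X\<^esub> = coker_class C f X (Zero C (Dom C f) X)"
proof -
  interpret H: comm_group "homgrp C (Dom C f) X" using assms dom_cod by (intro hom_group) auto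
  show ?thesis
    using H.coset_mult_one[OF subgroup.subset[OF subgroup_factoring[OF assms]]]
    by (simp add: coker_fun_def coker_class_def)
qed

lemma coker_class_hom:
  assumes "f \<in> Arr C" "X \<in> Obj C"
  shows "coker_class C f X \<in> hom (homgrp C (Dom C f) X) (FObj (coker_fun C f) X)"
  using normal.r_coset_hom_Mod[OF normal_factoring[OF assms]]
  by (simp add: coker_fun_def coker_class_def[abs_def])

lemma coker_class_add:
  assumes "f \<in> Arr C" "x \<in> Hom C (Dom C f) X" "y \<in> Hom C (Dom C f) X"
  shows "coker_class C f X (Add C x y) =
    coker_class C f X x \<otimes>\<^bsub>FObj (coker_fun C f) X\<^esub> coker_class C f X y"
  using hom_mult[OF coker_class_hom[OF assms(1) Hom_Obj(2)[OF assms(2)]], of x y] assms by simp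

lemma coker_class_comp:
  assumes f: "f \<in> Arr C" and xy: "x \<in> Hom C (Dom C f) X" "y \<in> Hom C (Dom C f) X"
    and eq: "coker_class C f X x = coker_class C f X y" and h: "h \<in> Hom C X Y"
  shows "coker_class C f Y (h \<bullet> x) = coker_class C f Y (h \<bullet> y)"
proof -
  have "Add C x (Neg C y) \<in> factoring C f X" using coker_class_eq_iff[OF f xy] eq by blast
  then obtain z where z: "z \<in> Hom C (Cod C f) X" "Add C x (Neg C y) = z \<bullet> f"
    by (auto simp: factoring_def)
  have n: "Neg C y \<in> Hom C (Dom C f) X" by (rule neg_closed[OF xy(2)])
  have "Add C (h \<bullet> y) (h \<bullet> Neg C y) = Zero C (Dom C f) Y"
    using comp_add_right[OF xy(2) n h] add_neg(1)[OF xy(2)] comp_zero[OF h] Hom_Obj[OF xy(1)] by simp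
  then have neg: "h \<bullet> Neg C y = Neg C (h \<bullet> y)" by (rule neg_unique[OF comp[OF xy(2) h] comp[OF n h]])
  have "Add C (h \<bullet> x) (Neg C (h \<bullet> y)) = h \<bullet> (z \<bullet> f)"
    using comp_add_right[OF xy(1) n h] neg z(2) by simp
  also have "\<dots> = (h \<bullet> z) \<bullet> f" using comp_assoc[OF Arr_Hom[OF f] z(1) h] by simp
  also have "\<dots> \<in> factoring C f Y" using comp[OF z(1) h] by (auto simp: factoring_def)
  finally show ?thesis using coker_class_eq_iff[OF f comp[OF xy(1) h] comp[OF xy(2) h]] by blast
qed

text \<open>The union in \<open>coker_fun\<close> runs over all representatives of a coset; by
  \<open>coker_class_comp\<close> each of them contributes the same coset.\<close>

lemma coker_fun_map:
  assumes f: "f \<in> Arr C" and x: "x \<in> Hom C (Dom C f) X" and h: "h \<in> Hom C X Y"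
  shows "FArr (coker_fun C f) h (coker_class C f X x) = coker_class C f Y (h \<bullet> x)"
proof -
  have "FArr (coker_fun C f) h (coker_class C f X x) =
      (\<Union>y \<in> coker_class C f X x. coker_class C f Y (h \<bullet> y))"
    using HomD[OF h] by (simp add: coker_fun_def coker_class_def)
  also have "\<dots> = (\<Union>y \<in> coker_class C f X x. coker_class C f Y (h \<bullet> x))"
    using coker_class_comp[OF f _ x _ h] coker_class_subset[OF f x] by (intro SUP_cong) auto
  also have "\<dots> = coker_class C f Y (h \<bullet> x)" using coker_class_self[OF f x] by auto
  finally show ?thesis .
qed

lemma coker_fun_abfun:
  assumes f: "f \<in> Arr C"
  shows "is_abfun C (coker_fun C f)"
proof -
  let ?K = "coker_fun C f"
  have A: "Dom C f \<in> Obj C" using f dom_cod by blast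
  have grp: "comm_group (FObj ?K X)" if "X \<in> Obj C" for X
    using comm_group.abelian_FactGroup[OF hom_group[OF A that] subgroup_factoring[OF f that]]
    by (simp add: coker_fun_def)
  have id: "FArr ?K (Ident C X) c = c"
    if "X \<in> Obj C" "c \<in> carrier (FObj ?K X)" for X c
    using that coker_fun_map[OF f _ ident[OF that(1)]] ident_comp by (auto simp: carrier_coker_fun)
  have hom: "FArr ?K h \<in> hom (FObj ?K X) (FObj ?K Y)"
    if h: "h \<in> Hom C X Y" for h X Y
  proof (rule homI)
    fix c d assume "c \<in> carrier (FObj ?K X)" "d \<in> carrier (FObj ?K X)"
    then obtain x y where xy: "x \<in> Hom C (Dom C f) X" "y \<in> Hom C (Dom C f) X"
      "c = coker_class C f X x" "d = coker_class C f X y" by (auto simp: carrier_coker_fun)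
    show "FArr ?K h (c \<otimes>\<^bsub>FObj ?K X\<^esub> d) =
        FArr ?K h c \<otimes>\<^bsub>FObj ?K Y\<^esub> FArr ?K h d"
      using coker_class_add[OF f xy(1,2)] coker_class_add[OF f comp[OF xy(1) h] comp[OF xy(2) h]]
        coker_fun_map[OF f xy(1) h] coker_fun_map[OF f xy(2) h]
        coker_fun_map[OF f add_closed[OF xy(1,2)] h] comp_add_right[OF xy(1,2) h] xy(3,4) by simp
  next
    fix c assume "c \<in> carrier (FObj ?K X)"
    then show "FArr ?K h c \<in> carrier (FObj ?K Y)"
      using coker_fun_map[OF f _ h] comp[OF _ h] by (auto simp: carrier_coker_fun)
  qed
  have cmp: "FArr ?K (g \<bullet> h) c = FArr ?K g (FArr ?K h c)"
    if h: "h \<in> Hom C X Y" and g: "g \<in> Hom C Y Z" and c: "c \<in> carrier (FObj ?K X)" for g h c X Y Z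
  proof -
    obtain x where x: "x \<in> Hom C (Dom C f) X" "c = coker_class C f X x"
      using c by (auto simp: carrier_coker_fun)
    show ?thesis
      using coker_fun_map[OF f x(1) comp[OF h g]] coker_fun_map[OF f x(1) h]
        coker_fun_map[OF f comp[OF x(1) h] g] comp_assoc[OF x(1) h g] x(2) by simp
  qed
  have add: "FArr ?K (Add C g h) c =
      FArr ?K g c \<otimes>\<^bsub>FObj ?K Y\<^esub> FArr ?K h c"
    if g: "g \<in> Hom C X Y" and h: "h \<in> Hom C X Y" and c: "c \<in> carrier (FObj ?K X)" for g h c X Y
  proof -
    obtain x where x: "x \<in> Hom C (Dom C f) X" "c = coker_class C f X x"
      using c by (auto simp: carrier_coker_fun)
    show ?thesis
      using coker_fun_map[OF f x(1) add_closed[OF g h]] coker_fun_map[OF f x(1) g]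
        coker_fun_map[OF f x(1) h] coker_class_add[OF f comp[OF x(1) g] comp[OF x(1) h]]
        comp_add_left[OF x(1) g h] x(2) by simp
  qed
  show ?thesis
    unfolding is_abfun_def
  proof (intro conjI ballI allI impI)
    fix g h c assume "h \<in> Arr C" "g \<in> Arr C" "Dom C g = Cod C h" "c \<in> carrier (FObj ?K (Dom C h))"
    then show "FArr ?K (g \<bullet> h) c = FArr ?K g (FArr ?K h c)"
      by (intro cmp[of h "Dom C h" "Cod C h" g "Cod C g"]) (auto simp: Hom_def)
  qed (use grp id hom[OF Arr_Hom] add in auto)
qed

lemma trivial_coker_fun_iff:
  assumes f: "f \<in> Arr C" and X: "X \<in> Obj C"
  shows "trivial_group (FObj (coker_fun C f) X) \<longleftrightarrow> injective_wrt C f X"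
proof -
  have A: "Dom C f \<in> Obj C" using f dom_cod by blast
  have z: "Zero C (Dom C f) X \<in> Hom C (Dom C f) X" by (rule zero_closed[OF A X])
  have grp: "group (FObj (coker_fun C f) X)"
    using abfun_group[OF coker_fun_abfun[OF f] X] by (simp add: comm_group.axioms)
  have cls: "coker_class C f X x = \<one>\<^bsub>FObj (coker_fun C f) X\<^esub> \<longleftrightarrow> x \<in> factoring C f X"
    if x: "x \<in> Hom C (Dom C f) X" for x
    using coker_class_eq_iff[OF f x z] neg_zero[OF A X] add_zero(1)[OF x] one_coker_fun[OF f X] by simp
  have "trivial_group (FObj (coker_fun C f) X) \<longleftrightarrow>
      (\<forall>x \<in> Hom C (Dom C f) X. coker_class C f X x = \<one>\<^bsub>FObj (coker_fun C f) X\<^esub>)"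
    using grp z one_coker_fun[OF f X] unfolding trivial_group_def carrier_coker_fun by auto
  also have "\<dots> \<longleftrightarrow> injective_wrt C f X"
    using cls factoring_subset[OF f] unfolding injective_wrt_def by blast
  finally show ?thesis .
qed

end

context abelian_functor
begin

lemma presents_imp_universal_element:
  assumes "presents C f G"
  obtains \<xi> where "universal_element C f G \<xi>"
proof -
  obtain \<tau> where f: "f \<in> Arr C" and \<tau>: "is_abnat_iso C G (coker_fun C f) \<tau>"
    using assms by (auto simp: presents_def)
  let ?A = "Dom C f"
  have A: "?A \<in> Obj C" using f dom_cod by blast
  have iso: "\<tau> X \<in> iso (FObj G X) (FObj (coker_fun C f) X)" if "X \<in> Obj C" for X
    using \<tau> that by (simp add: is_abnat_iso_def)
  have bij: "bij_betw (\<tau> X) (carrier (FObj G X)) (coker_class C f X ` Hom C ?A X)" if "X \<in> Obj C" for X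
    using iso[OF that] by (simp add: iso_def flip: carrier_coker_fun)
  \<comment> \<open>The universal element is the one that the given natural isomorphism sends to the
    class of the identity.\<close>
  have "coker_class C f ?A (Ident C ?A) \<in> \<tau> ?A ` carrier (FObj G ?A)"
    using bij[OF A] ident[OF A] by (auto simp: bij_betw_def)
  then obtain \<xi> where \<xi>: "\<xi> \<in> carrier (FObj G ?A)" "\<tau> ?A \<xi> = coker_class C f ?A (Ident C ?A)" by auto
  have \<tau>_ev: "\<tau> X (FArr G x \<xi>) = coker_class C f X x" if x: "x \<in> Hom C ?A X" for x X
  proof -
    have "\<tau> X (FArr G x \<xi>) = FArr (coker_fun C f) x (\<tau> ?A \<xi>)"
      using \<tau> HomD[OF x] \<xi>(1) unfolding is_abnat_iso_def is_abnat_def by metis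
    then show ?thesis using coker_fun_map[OF f ident[OF A] x] comp_ident[OF x] \<xi>(2) by simp
  qed
  have "universal_element C f G \<xi>"
    unfolding universal_element_def
  proof (intro conjI ballI)
    show "\<xi> \<in> carrier (FObj G ?A)" by (rule \<xi>(1))
    fix X assume X: "X \<in> Obj C"
    have closed: "FArr G x \<xi> \<in> carrier (FObj G X)" if "x \<in> Hom C ?A X" for x
      using map_closed[OF that \<xi>(1)] .
    show "(\<lambda>x. FArr G x \<xi>) ` Hom C ?A X = carrier (FObj G X)"
    proof
      show "(\<lambda>x. FArr G x \<xi>) ` Hom C ?A X \<subseteq> carrier (FObj G X)" using closed by blast
      show "carrier (FObj G X) \<subseteq> (\<lambda>x. FArr G x \<xi>) ` Hom C ?A X"
      proof
        fix u assume u: "u \<in> carrier (FObj G X)"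
        then have "\<tau> X u \<in> coker_class C f X ` Hom C ?A X" using bij[OF X] by (rule bij_betw_apply[rotated])
        then obtain x where x: "x \<in> Hom C ?A X" "\<tau> X u = coker_class C f X x" by blast
        then have "u = FArr G x \<xi>"
          using bij[OF X] u closed \<tau>_ev by (auto simp: bij_betw_def inj_on_def)
        then show "u \<in> (\<lambda>x. FArr G x \<xi>) ` Hom C ?A X" using x(1) by blast
      qed
    qed
    interpret GX: comm_group "FObj G X" by (rule group[OF X])
    have grp: "group (FObj (coker_fun C f) X)"
      using abfun_group[OF coker_fun_abfun[OF f] X] by (simp add: comm_group.axioms)
    have \<tau>_one: "\<tau> X \<one>\<^bsub>FObj G X\<^esub> = coker_class C f X (Zero C ?A X)"
      using hom_one[OF iso_imp_homomorphism[OF iso[OF X]] GX.is_group grp] one_coker_fun[OF f X] by simp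
    fix x assume x: "x \<in> Hom C ?A X"
    have "FArr G x \<xi> = \<one>\<^bsub>FObj G X\<^esub> \<longleftrightarrow> \<tau> X (FArr G x \<xi>) = \<tau> X \<one>\<^bsub>FObj G X\<^esub>"
      using bij[OF X] closed[OF x] GX.one_closed by (auto simp: bij_betw_def inj_on_def)
    also have "\<dots> \<longleftrightarrow> x \<in> factoring C f X"
      using coker_class_eq_iff[OF f x zero_closed[OF A X]] neg_zero[OF A X] add_zero(1)[OF x]
        \<tau>_ev[OF x] \<tau>_one by simp
    finally show "FArr G x \<xi> = \<one>\<^bsub>FObj G X\<^esub> \<longleftrightarrow> x \<in> factoring C f X" .
  qed
  then show ?thesis by (rule that)
qed

lemma universal_element_imp_presents:
  assumes f: "f \<in> Arr C" and u: "universal_element C f G \<xi>"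
  shows "presents C f G"
proof -
  let ?A = "Dom C f"
  have A: "?A \<in> Obj C" using f dom_cod by blast
  have \<xi>: "\<xi> \<in> carrier (FObj G ?A)" using u by (simp add: universal_element_def)
  have surj: "\<exists>x \<in> Hom C ?A X. c = FArr G x \<xi>" if "X \<in> Obj C" "c \<in> carrier (FObj G X)" for X c
    using u that unfolding universal_element_def by blast
  have eq_iff: "FArr G x \<xi> = FArr G y \<xi> \<longleftrightarrow> coker_class C f X x = coker_class C f X y"
    if xy: "x \<in> Hom C ?A X" "y \<in> Hom C ?A X" for x y X
    using evaluation_eq_iff[OF xy \<xi>] coker_class_eq_iff[OF f xy] u Hom_Obj[OF xy(1)]
      add_closed[OF xy(1) neg_closed[OF xy(2)]] unfolding universal_element_def by blast
  \<comment> \<open>The chosen preimage does not matter: by \<open>eq_iff\<close>, maps with the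
    same value at \<open>\<xi>\<close> have the same class.\<close>
  define \<tau> where "\<tau> X c = coker_class C f X (SOME x. x \<in> Hom C ?A X \<and> FArr G x \<xi> = c)" for X c
  have \<tau>: "\<tau> X (FArr G x \<xi>) = coker_class C f X x" if x: "x \<in> Hom C ?A X" for x X
  proof -
    have "(SOME y. y \<in> Hom C ?A X \<and> FArr G y \<xi> = FArr G x \<xi>) \<in> Hom C ?A X \<and>
        FArr G (SOME y. y \<in> Hom C ?A X \<and> FArr G y \<xi> = FArr G x \<xi>) \<xi> = FArr G x \<xi>"
      by (rule someI) (use x in simp)
    then show ?thesis unfolding \<tau>_def using eq_iff x by blast
  qed
  have hom: "\<tau> X \<in> hom (FObj G X) (FObj (coker_fun C f) X)" if X: "X \<in> Obj C" for X
  proof (rule homI)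
    fix c d assume "c \<in> carrier (FObj G X)" "d \<in> carrier (FObj G X)"
    then obtain x y where xy: "x \<in> Hom C ?A X" "y \<in> Hom C ?A X" "c = FArr G x \<xi>" "d = FArr G y \<xi>"
      using surj[OF X] by metis
    have "c \<otimes>\<^bsub>FObj G X\<^esub> d = FArr G (Add C x y) \<xi>" using map_add[OF xy(1,2) \<xi>] xy(3,4) by simp
    then show "\<tau> X (c \<otimes>\<^bsub>FObj G X\<^esub> d) = \<tau> X c \<otimes>\<^bsub>FObj (coker_fun C f) X\<^esub> \<tau> X d"
      using \<tau>[OF add_closed[OF xy(1,2)]] \<tau>[OF xy(1)] \<tau>[OF xy(2)] coker_class_add[OF f xy(1,2)] xy(3,4) by simp
  next
    fix c assume "c \<in> carrier (FObj G X)"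
    then show "\<tau> X c \<in> carrier (FObj (coker_fun C f) X)"
      using surj[OF X] \<tau> unfolding carrier_coker_fun by blast
  qed
  have inj: "inj_on (\<tau> X) (carrier (FObj G X))" if X: "X \<in> Obj C" for X
  proof (rule inj_onI)
    fix c d assume "c \<in> carrier (FObj G X)" "d \<in> carrier (FObj G X)" and eq: "\<tau> X c = \<tau> X d"
    then obtain x y where xy: "x \<in> Hom C ?A X" "y \<in> Hom C ?A X" "c = FArr G x \<xi>" "d = FArr G y \<xi>"
      using surj[OF X] by metis
    then show "c = d" using eq \<tau> eq_iff by simp
  qed
  have img: "\<tau> X ` carrier (FObj G X) = carrier (FObj (coker_fun C f) X)" if X: "X \<in> Obj C" for X
  proof
    show "\<tau> X ` carrier (FObj G X) \<subseteq> carrier (FObj (coker_fun C f) X)"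
      using hom[OF X] by (auto simp: hom_def)
    show "carrier (FObj (coker_fun C f) X) \<subseteq> \<tau> X ` carrier (FObj G X)"
      unfolding carrier_coker_fun using \<tau> map_closed[OF _ \<xi>] by (auto intro!: rev_image_eqI)
  qed
  have nat: "FArr (coker_fun C f) h (\<tau> (Dom C h) c) = \<tau> (Cod C h) (FArr G h c)"
    if h: "h \<in> Arr C" and c: "c \<in> carrier (FObj G (Dom C h))" for h c
  proof -
    have h': "h \<in> Hom C (Dom C h) (Cod C h)" using h by (rule Arr_Hom)
    obtain x where x: "x \<in> Hom C ?A (Dom C h)" "c = FArr G x \<xi>" using surj[OF Hom_Obj(1)[OF h'] c] by blast
    show ?thesis
      using coker_fun_map[OF f x(1) h'] \<tau>[OF x(1)] \<tau>[OF comp[OF x(1) h']] map_comp[OF x(1) h' \<xi>] x(2) by simp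
  qed
  have "is_abnat_iso C G (coker_fun C f) \<tau>"
    using hom inj img nat by (simp add: is_abnat_iso_def is_abnat_def iso_iff)
  then show ?thesis using f by (auto simp: presents_def)
qed

end

text \<open>Two presentations \<open>f\<close>, \<open>f'\<close> of one functor have domains related by maps \<open>\<alpha>\<close>, \<open>\<alpha>'\<close> with
  \<open>\<alpha>\<alpha>' - 1\<close> factoring through \<open>f\<close> and \<open>f'\<alpha>'\<close> factoring through \<open>f\<close>. These relations make sense
  in the ambient category as well.\<close>

lemma injective_wrt_presentation:
  fixes T :: "('o, 'm, 'z) precat_scheme"
  assumes T: "preadditive_category T" and S: "S \<subseteq> Obj T" and G: "is_abfun (full_sub T S) G"
    and f: "f \<in> Arr (full_sub T S)" "universal_element (full_sub T S) f G \<xi>"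
    and f': "f' \<in> Arr (full_sub T S)" "universal_element (full_sub T S) f' G \<xi>'"
    and X: "X \<in> Obj T" and inj: "injective_wrt T f' X"
  shows "injective_wrt T f X"
proof -
  interpret T: preadditive_category T by fact
  interpret C: abelian_functor "full_sub T S" G
    using T.full_sub_preadditive[OF S] G by (simp add: abelian_functor_def abelian_functor_axioms_def)
  let ?C = "full_sub T S"
  define A B A' B' where AB: "A = Dom T f" "B = Cod T f" "A' = Dom T f'" "B' = Cod T f'"
  have fH: "f \<in> Hom ?C A B" "f' \<in> Hom ?C A' B'"
    using f(1) f'(1) by (simp_all add: Hom_def AB)
  note fT = fH[unfolded Hom_full_sub, THEN conjunct1]
  have AS: "A \<in> S" "A' \<in> S" using f(1) f'(1) by (simp_all add: AB)
  have \<xi>: "\<xi> \<in> carrier (FObj G A)" "\<xi>' \<in> carrier (FObj G A')"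
    using f(2) f'(2) by (simp_all add: universal_element_def AB)
  obtain \<alpha> where \<alpha>: "\<alpha> \<in> Hom ?C A' A" "\<xi> = FArr G \<alpha> \<xi>'"
    using universal_elementE[OF f'(2), of A \<xi>] \<xi>(1) AS by (auto simp: AB)
  obtain \<alpha>' where \<alpha>': "\<alpha>' \<in> Hom ?C A A'" "\<xi>' = FArr G \<alpha>' \<xi>"
    using universal_elementE[OF f(2), of A' \<xi>'] \<xi>(2) AS by (auto simp: AB)
  have \<alpha>T: "\<alpha> \<in> Hom T A' A" "\<alpha>' \<in> Hom T A A'" using \<alpha>(1) \<alpha>'(1) by (simp_all add: Hom_full_sub)
  have aa: "\<alpha> \<bullet>\<^bsub>?C\<^esub> \<alpha>' \<in> Hom ?C A A" by (rule C.comp[OF \<alpha>'(1) \<alpha>(1)])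
  have idA: "Ident ?C A \<in> Hom ?C A A" using AS(1) by (intro C.ident) simp
  \<comment> \<open>The composite and the identity of \<open>A\<close> have the same value at
    \<open>\<xi>\<close>, so their difference is in the kernel of evaluation and factors through
    \<open>f\<close>, by the map \<open>\<gamma>\<close> below.\<close>
  have "FArr G (\<alpha> \<bullet>\<^bsub>?C\<^esub> \<alpha>') \<xi> = FArr G \<alpha> (FArr G \<alpha>' \<xi>)"
    by (rule C.map_comp[OF \<alpha>'(1) \<alpha>(1) \<xi>(1)])
  also have "\<dots> = \<xi>" by (simp only: \<alpha>(2)[symmetric] \<alpha>'(2)[symmetric])
  also have "\<dots> = FArr G (Ident ?C A) \<xi>" using C.map_ident[of A \<xi>] \<xi>(1) AS(1) by simp
  finally have "FArr G (Add ?C (\<alpha> \<bullet>\<^bsub>?C\<^esub> \<alpha>') (Neg ?C (Ident ?C A))) \<xi> = \<one>\<^bsub>FObj G A\<^esub>"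
    using C.evaluation_eq_iff[OF aa idA \<xi>(1)] by blast
  then have "Add ?C (\<alpha> \<bullet>\<^bsub>?C\<^esub> \<alpha>') (Neg ?C (Ident ?C A)) \<in> factoring ?C f A"
    using f(2) C.add_closed[OF aa C.neg_closed[OF idA]] AS(1) by (auto simp: universal_element_def AB)
  then obtain \<gamma> where \<gamma>: "\<gamma> \<in> Hom ?C B A" "Add ?C (\<alpha> \<bullet>\<^bsub>?C\<^esub> \<alpha>') (Neg ?C (Ident ?C A)) = \<gamma> \<bullet>\<^bsub>?C\<^esub> f"
    by (auto simp: factoring_def AB)
  have \<gamma>T: "\<gamma> \<in> Hom T B A" using \<gamma>(1) by (simp add: Hom_full_sub)
  have "Add ?C (\<gamma> \<bullet>\<^bsub>?C\<^esub> f) (Ident ?C A) = \<alpha> \<bullet>\<^bsub>?C\<^esub> \<alpha>'"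
    unfolding \<gamma>(2)[symmetric]
    using C.add_assoc[OF aa C.neg_closed[OF idA] idA] C.add_neg(2)[OF idA] C.add_zero(1)[OF aa] by simp
  then have aa_eq: "Add T (\<gamma> \<bullet>\<^bsub>T\<^esub> f) (Ident T A) = \<alpha> \<bullet>\<^bsub>T\<^esub> \<alpha>'" by simp
  \<comment> \<open>\<open>f'\<close> kills \<open>\<xi>'\<close>, the image of \<open>\<xi>\<close>
    under \<open>\<alpha>'\<close>. Hence the composite of \<open>\<alpha>'\<close> and
    \<open>f'\<close> kills \<open>\<xi>\<close> and factors through \<open>f\<close>, by the map
    \<open>\<beta>\<close> below.\<close>
  have "f' \<in> factoring ?C f' B'"
    using C.ident_comp[OF fH(2)] C.ident[of B'] f'(1) unfolding factoring_def AB by force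
  then have "FArr G f' \<xi>' = \<one>\<^bsub>FObj G B'\<^esub>"
    using f' fH(2) by (auto simp: universal_element_def AB)
  then have "FArr G (f' \<bullet>\<^bsub>?C\<^esub> \<alpha>') \<xi> = \<one>\<^bsub>FObj G B'\<^esub>"
    using C.map_comp[OF \<alpha>'(1) fH(2) \<xi>(1)] by (simp only: \<alpha>'(2)[symmetric])
  then have "f' \<bullet>\<^bsub>?C\<^esub> \<alpha>' \<in> factoring ?C f B'"
    using f(2) C.comp[OF \<alpha>'(1) fH(2)] f'(1) by (auto simp: universal_element_def AB)
  then obtain \<beta> where \<beta>: "\<beta> \<in> Hom T B B'" "f' \<bullet>\<^bsub>T\<^esub> \<alpha>' = \<beta> \<bullet>\<^bsub>T\<^esub> f"
    by (auto simp: factoring_def AB Hom_full_sub)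
  \<comment> \<open>Injectivity along \<open>f'\<close> gives x \<alpha> = z f'. Then x \<gamma> f +
    x = x \<alpha> \<alpha>' = z f' \<alpha>' = z \<beta> f, and therefore x = (z \<beta> - x
    \<gamma>) f.\<close>
  have "x \<in> factoring T f X" if x: "x \<in> Hom T A X" for x
  proof -
    have "x \<bullet>\<^bsub>T\<^esub> \<alpha> \<in> factoring T f' X"
      using inj T.comp[OF \<alpha>T(1) x] by (simp add: injective_wrt_def AB)
    then obtain z where z: "z \<in> Hom T B' X" "x \<bullet>\<^bsub>T\<^esub> \<alpha> = z \<bullet>\<^bsub>T\<^esub> f'" by (auto simp: factoring_def AB)
    have zb: "z \<bullet>\<^bsub>T\<^esub> \<beta> \<in> Hom T B X" by (rule T.comp[OF \<beta>(1) z(1)])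
    have xg: "x \<bullet>\<^bsub>T\<^esub> \<gamma> \<in> Hom T B X" by (rule T.comp[OF \<gamma>T x])
    have xgf: "(x \<bullet>\<^bsub>T\<^esub> \<gamma>) \<bullet>\<^bsub>T\<^esub> f \<in> Hom T A X" by (rule T.comp[OF fT(1) xg])
    have idT: "Ident T A \<in> Hom T A A" using AS(1) S by (intro T.ident) auto
    have "Add T ((x \<bullet>\<^bsub>T\<^esub> \<gamma>) \<bullet>\<^bsub>T\<^esub> f) x = x \<bullet>\<^bsub>T\<^esub> (\<alpha> \<bullet>\<^bsub>T\<^esub> \<alpha>')"
      using T.comp_add_right[OF T.comp[OF fT(1) \<gamma>T] idT x] T.comp_assoc[OF fT(1) \<gamma>T x]
        T.comp_ident[OF x] aa_eq by simp
    also have "\<dots> = (z \<bullet>\<^bsub>T\<^esub> \<beta>) \<bullet>\<^bsub>T\<^esub> f"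
      using T.comp_assoc[OF \<alpha>T(2,1) x] T.comp_assoc[OF \<alpha>T(2) fT(2) z(1)] T.comp_assoc[OF fT(1) \<beta>(1) z(1)]
        z(2) \<beta>(2) by simp
    finally have eq: "Add T ((x \<bullet>\<^bsub>T\<^esub> \<gamma>) \<bullet>\<^bsub>T\<^esub> f) x = (z \<bullet>\<^bsub>T\<^esub> \<beta>) \<bullet>\<^bsub>T\<^esub> f" .
    have "x = Add T (Neg T ((x \<bullet>\<^bsub>T\<^esub> \<gamma>) \<bullet>\<^bsub>T\<^esub> f)) ((z \<bullet>\<^bsub>T\<^esub> \<beta>) \<bullet>\<^bsub>T\<^esub> f)"
      unfolding eq[symmetric]
      using T.add_assoc[OF T.neg_closed[OF xgf] xgf x] T.add_neg(2)[OF xgf] T.add_zero(2)[OF x] by simp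
    also have "\<dots> = Add T (Neg T (x \<bullet>\<^bsub>T\<^esub> \<gamma>)) (z \<bullet>\<^bsub>T\<^esub> \<beta>) \<bullet>\<^bsub>T\<^esub> f"
      using T.comp_add_left[OF fT(1) T.neg_closed[OF xg] zb] T.neg_comp[OF fT(1) xg] by simp
    finally show ?thesis
      using T.add_closed[OF T.neg_closed[OF xg] zb] unfolding factoring_def AB by blast
  qed
  then show ?thesis
    using T.factoring_subset[of f X] f(1) unfolding injective_wrt_def AB by auto
qed

text \<open>\<open>tilde\<close> fixes a presentation by choice. Two applications of
  \<open>injective_wrt_presentation\<close>, with the roles exchanged, replace it by whatever
  presentation is at hand.\<close>

lemma trivial_tilde_iff:
  fixes T :: "('o, 'm, 'z) precat_scheme"
  assumes T: "preadditive_category T" and G: "is_abfun (cpt u T) G"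
    and f: "presents (cpt u T) f G" and X: "X \<in> Obj T"
  shows "trivial_group (FObj (tilde u T G) X) \<longleftrightarrow> injective_wrt T f X"
proof -
  interpret T: preadditive_category T by fact
  interpret C: abelian_functor "cpt u T" G
    using T.cpt_preadditive G by (simp add: abelian_functor_def abelian_functor_axioms_def)
  define f' where "f' = (SOME f. presents (cpt u T) f G)"
  have f': "presents (cpt u T) f' G" unfolding f'_def using f by (rule someI)
  obtain \<xi> \<xi>' where \<xi>: "universal_element (cpt u T) f G \<xi>" "universal_element (cpt u T) f' G \<xi>'"
    using C.presents_imp_universal_element f f' by metis
  have Arr: "f \<in> Arr (cpt u T)" "f' \<in> Arr (cpt u T)" using f f' by (simp_all add: presents_def)
  have "injective_wrt T f' X \<longleftrightarrow> injective_wrt T f X"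
    using injective_wrt_presentation[OF T compacts_subset_Obj G[unfolded cpt_def]] Arr \<xi> X
    unfolding cpt_def by metis
  moreover have "trivial_group (FObj (tilde u T G) X) \<longleftrightarrow> injective_wrt T f' X"
    using T.trivial_coker_fun_iff[OF _ X, of f'] Arr(2) by (simp add: tilde_def f'_def cpt_def)
  ultimately show ?thesis by blast
qed

text \<open>The cokernel of Hom(f, -) has cosets of maps as elements, whereas
  \<open>annihilator\<close> ranges over functors with values carried by subsets of
  \<open>'u\<close>. Smallness of the Hom sets permits a transport of structure along injections
  \<open>j X\<close>. Without such a functor a map \<open>f\<close> would impose no condition on the
  dual definable category.\<close>

lemma (in preadditive_category) ex_small_presented:
  fixes f :: 'm
  assumes f: "f \<in> Arr C" and small: "\<And>X. X \<in> Obj C \<Longrightarrow> small TYPE('u) (Hom C (Dom C f) X)"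
  obtains G :: "('o, 'm, 'u) abfun" where "is_small_abfun TYPE('u) C G" "presents C f G"
proof -
  let ?K = "coker_fun C f"
  note K = coker_fun_abfun[OF f]
  have "\<exists>j :: 'm set \<Rightarrow> 'u. inj_on j (carrier (FObj ?K X)) \<and> small TYPE('u) (j ` carrier (FObj ?K X))"
    if X: "X \<in> Obj C" for X
  proof -
    have "carrier (FObj ?K X) \<lesssim> Hom C (Dom C f) X"
      unfolding carrier_coker_fun by (rule image_lepoll)
    then have less: "carrier (FObj ?K X) \<prec> (UNIV :: 'u set)"
      using small[OF X] unfolding small_def by (rule lesspoll_trans1)
    then obtain j :: "'m set \<Rightarrow> 'u" where j: "inj_on j (carrier (FObj ?K X))"
      unfolding lesspoll_def lepoll_def by blast
    have "j ` carrier (FObj ?K X) \<prec> (UNIV :: 'u set)"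
      using image_lepoll less by (rule lesspoll_trans1)
    then show ?thesis using j by (auto simp: small_def)
  qed
  then obtain j :: "'o \<Rightarrow> 'm set \<Rightarrow> 'u"
    where inj: "\<And>X. X \<in> Obj C \<Longrightarrow> inj_on (j X) (carrier (FObj ?K X))"
    and smallj: "\<And>X. X \<in> Obj C \<Longrightarrow> small TYPE('u) (j X ` carrier (FObj ?K X))" by metis
  define i where "i X = inv_into (carrier (FObj ?K X)) (j X)" for X
  define G :: "('o, 'm, 'u) abfun" where
    "G = \<lparr>FObj = (\<lambda>X. \<lparr>carrier = j X ` carrier (FObj ?K X),
          monoid.mult = (\<lambda>a b. j X (i X a \<otimes>\<^bsub>FObj ?K X\<^esub> i X b)), one = j X \<one>\<^bsub>FObj ?K X\<^esub>\<rparr>),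
        FArr = (\<lambda>h a. j (Cod C h) (FArr ?K h (i (Dom C h) a)))\<rparr>"
  have ij: "i X (j X c) = c" if "X \<in> Obj C" "c \<in> carrier (FObj ?K X)" for X c
    using inv_into_f_f[OF inj[OF that(1)] that(2)] by (simp add: i_def)
  have GX: "carrier (FObj G X) = j X ` carrier (FObj ?K X)"
    "a \<otimes>\<^bsub>FObj G X\<^esub> b = j X (i X a \<otimes>\<^bsub>FObj ?K X\<^esub> i X b)" "\<one>\<^bsub>FObj G X\<^esub> = j X \<one>\<^bsub>FObj ?K X\<^esub>" for X a b
    by (simp_all add: G_def)
  have Gmap: "FArr G h (j X c) = j Y (FArr ?K h c)"
    if "h \<in> Hom C X Y" "c \<in> carrier (FObj ?K X)" for h X Y c
    using that(2) HomD[OF that(1)] Hom_Obj[OF that(1)] by (simp add: G_def ij)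
  have jiso: "j X \<in> iso (FObj ?K X) (FObj G X)" if X: "X \<in> Obj C" for X
    using inj[OF X] ij[OF X] by (auto simp: iso_iff hom_def GX)
  have grp: "comm_group (FObj G X)" if X: "X \<in> Obj C" for X
    using comm_group.iso_imp_img_comm_group[OF abfun_group[OF K X] jiso[OF X]] by (simp add: G_def)
  have mult: "j X (c \<otimes>\<^bsub>FObj ?K X\<^esub> d) = j X c \<otimes>\<^bsub>FObj G X\<^esub> j X d"
    if "X \<in> Obj C" "c \<in> carrier (FObj ?K X)" "d \<in> carrier (FObj ?K X)" for X c d
    using that by (simp add: GX ij)
  have "is_abfun C G"
    unfolding is_abfun_def
  proof (intro conjI ballI allI impI)
    fix X assume X: "X \<in> Obj C"
    show "comm_group (FObj G X)" by (rule grp[OF X])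
    show "FArr G (Ident C X) a = a" if "a \<in> carrier (FObj G X)" for a
      using that Gmap[OF ident[OF X]] abfun_ident[OF K X] by (auto simp: GX)
  next
    fix h assume "h \<in> Arr C"
    then have h: "h \<in> Hom C (Dom C h) (Cod C h)" by (rule Arr_Hom)
    show "FArr G h \<in> hom (FObj G (Dom C h)) (FObj G (Cod C h))"
    proof (rule homI)
      fix a b assume "a \<in> carrier (FObj G (Dom C h))" "b \<in> carrier (FObj G (Dom C h))"
      then obtain c d where cd: "c \<in> carrier (FObj ?K (Dom C h))" "d \<in> carrier (FObj ?K (Dom C h))"
        "a = j (Dom C h) c" "b = j (Dom C h) d" by (auto simp: GX)
      have "c \<otimes>\<^bsub>FObj ?K (Dom C h)\<^esub> d \<in> carrier (FObj ?K (Dom C h))"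
        using abfun_group[OF K Hom_Obj(1)[OF h]] cd(1,2)
        by (simp add: comm_group.axioms group.is_monoid monoid.m_closed)
      then show "FArr G h (a \<otimes>\<^bsub>FObj G (Dom C h)\<^esub> b) = FArr G h a \<otimes>\<^bsub>FObj G (Cod C h)\<^esub> FArr G h b"
        using cd Gmap[OF h] mult[OF Hom_Obj(1)[OF h] cd(1,2), symmetric] hom_mult[OF abfun_hom[OF K h] cd(1,2)]
          mult[OF Hom_Obj(2)[OF h] abfun_closed[OF K h cd(1)] abfun_closed[OF K h cd(2)]] by simp
    next
      show "FArr G h a \<in> carrier (FObj G (Cod C h))" if "a \<in> carrier (FObj G (Dom C h))" for a
        using that Gmap[OF h] abfun_closed[OF K h] by (auto simp: GX)
    qed
  next
    fix h g a assume "h \<in> Arr C" "g \<in> Arr C" "Dom C g = Cod C h" and a: "a \<in> carrier (FObj G (Dom C h))"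
    then have h: "h \<in> Hom C (Dom C h) (Cod C h)" and g: "g \<in> Hom C (Cod C h) (Cod C g)"
      by (auto simp: Hom_def)
    obtain c where c: "c \<in> carrier (FObj ?K (Dom C h))" "a = j (Dom C h) c" using a by (auto simp: GX)
    show "FArr G (g \<bullet> h) a = FArr G g (FArr G h a)"
      using Gmap[OF comp[OF h g] c(1)] Gmap[OF h c(1)] Gmap[OF g abfun_closed[OF K h c(1)]]
        abfun_comp[OF K h g c(1)] c(2) by simp
  next
    fix X Y g h a assume g: "g \<in> Hom C X Y" and h: "h \<in> Hom C X Y" and a: "a \<in> carrier (FObj G X)"
    obtain c where c: "c \<in> carrier (FObj ?K X)" "a = j X c" using a by (auto simp: GX)
    show "FArr G (Add C g h) a = FArr G g a \<otimes>\<^bsub>FObj G Y\<^esub> FArr G h a"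
      using Gmap[OF add_closed[OF g h] c(1)] Gmap[OF g c(1)] Gmap[OF h c(1)]
        abfun_add[OF K g h c(1)] c(2)
        mult[OF Hom_Obj(2)[OF g] abfun_closed[OF K g c(1)] abfun_closed[OF K h c(1)]] by simp
  qed
  then have "is_small_abfun TYPE('u) C G" using smallj by (simp add: is_small_abfun_def GX)
  moreover have "presents C f G"
  proof -
    have "i X \<in> iso (FObj G X) (FObj ?K X)" if X: "X \<in> Obj C" for X
      using group.iso_set_sym[OF _ jiso[OF X]] abfun_group[OF K X]
      by (simp add: i_def comm_group.axioms)
    moreover have "FArr ?K h (i (Dom C h) a) = i (Cod C h) (FArr G h a)"
      if "h \<in> Arr C" and a: "a \<in> carrier (FObj G (Dom C h))" for h a
    proof -
      have h: "h \<in> Hom C (Dom C h) (Cod C h)" using that(1) by (rule Arr_Hom)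
      obtain c where c: "c \<in> carrier (FObj ?K (Dom C h))" "a = j (Dom C h) c" using a by (auto simp: GX)
      show ?thesis
        using Gmap[OF h c(1)] ij[OF Hom_Obj(1)[OF h] c(1)]
          ij[OF Hom_Obj(2)[OF h] abfun_closed[OF K h c(1)]] c(2) by simp
    qed
    ultimately have "is_abnat_iso C G ?K i"
      by (simp add: is_abnat_iso_def is_abnat_def iso_imp_homomorphism)
    then show ?thesis using f by (auto simp: presents_def)
  qed
  ultimately show ?thesis by (rule that)
qed

section \<open>The duality of finitely presented functors\<close>

locale abelian_functors = G: abelian_functor C G + H: abelian_functor C H
  for C :: "('o, 'm, 'z) precat_scheme" (structure)
    and G :: "('o, 'm, 'g) abfun" and H :: "('o, 'm, 'h) abfun"
begin

lemma nat_groupD: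
  assumes "\<tau> \<in> carrier (nat_group C G H)"
  shows nat_hom: "A \<in> Obj C \<Longrightarrow> \<tau> A \<in> hom (FObj G A) (FObj H A)"
    and nat_closed: "A \<in> Obj C \<Longrightarrow> x \<in> carrier (FObj G A) \<Longrightarrow> \<tau> A x \<in> carrier (FObj H A)"
    and nat_mult: "A \<in> Obj C \<Longrightarrow> x \<in> carrier (FObj G A) \<Longrightarrow> y \<in> carrier (FObj G A) \<Longrightarrow>
      \<tau> A (x \<otimes>\<^bsub>FObj G A\<^esub> y) = \<tau> A x \<otimes>\<^bsub>FObj H A\<^esub> \<tau> A y"
    and nat_natural: "f \<in> Hom C A B \<Longrightarrow> x \<in> carrier (FObj G A) \<Longrightarrow>
      FArr H f (\<tau> A x) = \<tau> B (FArr G f x)"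
  using assms by (auto simp: nat_group_def is_abnat_def hom_def Hom_def)

lemma nat_group_eqI:
  assumes "\<sigma> \<in> carrier (nat_group C G H)" "\<tau> \<in> carrier (nat_group C G H)"
    and "\<And>A x. A \<in> Obj C \<Longrightarrow> x \<in> carrier (FObj G A) \<Longrightarrow> \<sigma> A x = \<tau> A x"
  shows "\<sigma> = \<tau>"
proof
  fix A
  show "\<sigma> A = \<tau> A"
  proof (cases "A \<in> Obj C")
    case True
    then show ?thesis
      using assms by (intro extensionalityI[of _ "carrier (FObj G A)"]) (auto simp: nat_group_def)
  next
    case False
    then show ?thesis using assms(1,2) by (auto simp: nat_group_def extensional_def)
  qed
qed

lemma nat_group_restrictI:
  assumes "\<And>A x. A \<in> Obj C \<Longrightarrow> x \<in> carrier (FObj G A) \<Longrightarrow> t A x \<in> carrier (FObj H A)"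
    and "\<And>A x y. A \<in> Obj C \<Longrightarrow> x \<in> carrier (FObj G A) \<Longrightarrow> y \<in> carrier (FObj G A) \<Longrightarrow>
      t A (x \<otimes>\<^bsub>FObj G A\<^esub> y) = t A x \<otimes>\<^bsub>FObj H A\<^esub> t A y"
    and "\<And>f A B x. f \<in> Hom C A B \<Longrightarrow> x \<in> carrier (FObj G A) \<Longrightarrow> FArr H f (t A x) = t B (FArr G f x)"
  shows "(\<lambda>A \<in> Obj C. \<lambda>x \<in> carrier (FObj G A). t A x) \<in> carrier (nat_group C G H)"
proof -
  have m: "x \<otimes>\<^bsub>FObj G A\<^esub> y \<in> carrier (FObj G A)"
    if "A \<in> Obj C" "x \<in> carrier (FObj G A)" "y \<in> carrier (FObj G A)" for A x y
    using G.group[OF that(1)] that(2,3) by (simp add: comm_group.axioms group.is_monoid monoid.m_closed)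
  have nat: "FArr H f ((\<lambda>A \<in> Obj C. \<lambda>x \<in> carrier (FObj G A). t A x) (Dom C f) x) =
      (\<lambda>A \<in> Obj C. \<lambda>x \<in> carrier (FObj G A). t A x) (Cod C f) (FArr G f x)"
    if f: "f \<in> Arr C" and x: "x \<in> carrier (FObj G (Dom C f))" for f x
    using G.map_closed[OF Arr_Hom[OF f] x] assms(3)[OF Arr_Hom[OF f] x] x G.dom_cod[OF f] by simp
  show ?thesis
    using nat m assms(1,2) by (auto simp: nat_group_def is_abnat_def hom_def)
qed

lemma nat_group_simps:
  "\<sigma> \<otimes>\<^bsub>nat_group C G H\<^esub> \<tau> = (\<lambda>A \<in> Obj C. \<lambda>x \<in> carrier (FObj G A). \<sigma> A x \<otimes>\<^bsub>FObj H A\<^esub> \<tau> A x)"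
  "\<one>\<^bsub>nat_group C G H\<^esub> = (\<lambda>A \<in> Obj C. \<lambda>x \<in> carrier (FObj G A). \<one>\<^bsub>FObj H A\<^esub>)"
  by (simp_all add: nat_group_def)

lemma comm_group_nat_group: "comm_group (nat_group C G H)"
proof (rule comm_groupI)
  fix \<sigma> \<tau> assume \<sigma>: "\<sigma> \<in> carrier (nat_group C G H)" and \<tau>: "\<tau> \<in> carrier (nat_group C G H)"
  show closed: "\<sigma> \<otimes>\<^bsub>nat_group C G H\<^esub> \<tau> \<in> carrier (nat_group C G H)"
    unfolding nat_group_simps
  proof (rule nat_group_restrictI)
    fix A x assume A: "A \<in> Obj C" and x: "x \<in> carrier (FObj G A)"
    interpret HA: comm_group "FObj H A" by (rule H.group[OF A])
    show "\<sigma> A x \<otimes>\<^bsub>FObj H A\<^esub> \<tau> A x \<in> carrier (FObj H A)"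
      using nat_closed[OF \<sigma> A x] nat_closed[OF \<tau> A x] by simp
    fix y assume y: "y \<in> carrier (FObj G A)"
    show "\<sigma> A (x \<otimes>\<^bsub>FObj G A\<^esub> y) \<otimes>\<^bsub>FObj H A\<^esub> \<tau> A (x \<otimes>\<^bsub>FObj G A\<^esub> y) =
        \<sigma> A x \<otimes>\<^bsub>FObj H A\<^esub> \<tau> A x \<otimes>\<^bsub>FObj H A\<^esub> (\<sigma> A y \<otimes>\<^bsub>FObj H A\<^esub> \<tau> A y)"
      using nat_closed[OF \<sigma> A x] nat_closed[OF \<tau> A x] nat_closed[OF \<sigma> A y] nat_closed[OF \<tau> A y]
      by (simp add: nat_mult[OF \<sigma> A x y] nat_mult[OF \<tau> A x y] HA.m_ac)
  next
    fix f A B x assume f: "f \<in> Hom C A B" and x: "x \<in> carrier (FObj G A)"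
    have A: "A \<in> Obj C" using G.Hom_Obj[OF f] by blast
    show "FArr H f (\<sigma> A x \<otimes>\<^bsub>FObj H A\<^esub> \<tau> A x) = \<sigma> B (FArr G f x) \<otimes>\<^bsub>FObj H B\<^esub> \<tau> B (FArr G f x)"
      using hom_mult[OF H.map_hom[OF f] nat_closed[OF \<sigma> A x] nat_closed[OF \<tau> A x]]
      by (simp add: nat_natural[OF \<sigma> f x] nat_natural[OF \<tau> f x])
  qed
next
  show one: "\<one>\<^bsub>nat_group C G H\<^esub> \<in> carrier (nat_group C G H)"
    unfolding nat_group_simps
  proof (rule nat_group_restrictI)
    fix A assume "A \<in> Obj C"
    then interpret HA: comm_group "FObj H A" by (rule H.group)
    show "\<one>\<^bsub>FObj H A\<^esub> \<in> carrier (FObj H A)" "\<one>\<^bsub>FObj H A\<^esub> = \<one>\<^bsub>FObj H A\<^esub> \<otimes>\<^bsub>FObj H A\<^esub> \<one>\<^bsub>FObj H A\<^esub>" by simp_all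
  qed (rule H.map_one)
next
  fix \<rho> \<sigma> \<tau> assume \<rho>: "\<rho> \<in> carrier (nat_group C G H)"
    and \<sigma>: "\<sigma> \<in> carrier (nat_group C G H)" and \<tau>: "\<tau> \<in> carrier (nat_group C G H)"
  have "\<rho> A x \<otimes>\<^bsub>FObj H A\<^esub> \<sigma> A x \<otimes>\<^bsub>FObj H A\<^esub> \<tau> A x = \<rho> A x \<otimes>\<^bsub>FObj H A\<^esub> (\<sigma> A x \<otimes>\<^bsub>FObj H A\<^esub> \<tau> A x)"
    if "A \<in> Obj C" "x \<in> carrier (FObj G A)" for A x
  proof -
    interpret HA: comm_group "FObj H A" by (rule H.group[OF that(1)])
    show ?thesis using nat_closed[OF \<rho> that] nat_closed[OF \<sigma> that] nat_closed[OF \<tau> that] by (rule HA.m_assoc)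
  qed
  then show "\<rho> \<otimes>\<^bsub>nat_group C G H\<^esub> \<sigma> \<otimes>\<^bsub>nat_group C G H\<^esub> \<tau> = \<rho> \<otimes>\<^bsub>nat_group C G H\<^esub> (\<sigma> \<otimes>\<^bsub>nat_group C G H\<^esub> \<tau>)"
    unfolding nat_group_simps by (auto intro!: restrict_ext)
next
  fix \<sigma> \<tau> assume \<sigma>: "\<sigma> \<in> carrier (nat_group C G H)" and \<tau>: "\<tau> \<in> carrier (nat_group C G H)"
  have "\<sigma> A x \<otimes>\<^bsub>FObj H A\<^esub> \<tau> A x = \<tau> A x \<otimes>\<^bsub>FObj H A\<^esub> \<sigma> A x"
    if "A \<in> Obj C" "x \<in> carrier (FObj G A)" for A x
  proof -
    interpret HA: comm_group "FObj H A" by (rule H.group[OF that(1)])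
    show ?thesis using nat_closed[OF \<sigma> that] nat_closed[OF \<tau> that] by (rule HA.m_comm)
  qed
  then show "\<sigma> \<otimes>\<^bsub>nat_group C G H\<^esub> \<tau> = \<tau> \<otimes>\<^bsub>nat_group C G H\<^esub> \<sigma>"
    unfolding nat_group_simps by (auto intro!: restrict_ext)
next
  fix \<tau> assume \<tau>: "\<tau> \<in> carrier (nat_group C G H)"
  have one: "\<one>\<^bsub>FObj H A\<^esub> \<otimes>\<^bsub>FObj H A\<^esub> \<tau> A x = \<tau> A x" "inv\<^bsub>FObj H A\<^esub> \<tau> A x \<otimes>\<^bsub>FObj H A\<^esub> \<tau> A x = \<one>\<^bsub>FObj H A\<^esub>"
    if "A \<in> Obj C" "x \<in> carrier (FObj G A)" for A x
  proof -
    interpret HA: comm_group "FObj H A" by (rule H.group[OF that(1)])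
    show "\<one>\<^bsub>FObj H A\<^esub> \<otimes>\<^bsub>FObj H A\<^esub> \<tau> A x = \<tau> A x" "inv\<^bsub>FObj H A\<^esub> \<tau> A x \<otimes>\<^bsub>FObj H A\<^esub> \<tau> A x = \<one>\<^bsub>FObj H A\<^esub>"
      using nat_closed[OF \<tau> that] by simp_all
  qed
  have "(\<lambda>A \<in> Obj C. \<lambda>x \<in> carrier (FObj G A). \<tau> A x) = \<tau>"
  proof (rule nat_group_eqI[OF _ \<tau>])
    show "(\<lambda>A \<in> Obj C. \<lambda>x \<in> carrier (FObj G A). \<tau> A x) \<in> carrier (nat_group C G H)"
      by (rule nat_group_restrictI[OF nat_closed[OF \<tau>] nat_mult[OF \<tau>] nat_natural[OF \<tau>]])
  qed simp
  moreover have "(\<lambda>A \<in> Obj C. \<lambda>x \<in> carrier (FObj G A). \<one>\<^bsub>FObj H A\<^esub> \<otimes>\<^bsub>FObj H A\<^esub> \<tau> A x) =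
      (\<lambda>A \<in> Obj C. \<lambda>x \<in> carrier (FObj G A). \<tau> A x)"
    using one(1) by (auto intro!: restrict_ext)
  ultimately show "\<one>\<^bsub>nat_group C G H\<^esub> \<otimes>\<^bsub>nat_group C G H\<^esub> \<tau> = \<tau>"
    unfolding nat_group_simps by (simp cong: restrict_cong)
  let ?n = "\<lambda>A \<in> Obj C. \<lambda>x \<in> carrier (FObj G A). inv\<^bsub>FObj H A\<^esub> \<tau> A x"
  have "?n \<in> carrier (nat_group C G H)"
  proof (rule nat_group_restrictI)
    fix A x assume A: "A \<in> Obj C" and x: "x \<in> carrier (FObj G A)"
    interpret HA: comm_group "FObj H A" by (rule H.group[OF A])
    show "inv\<^bsub>FObj H A\<^esub> \<tau> A x \<in> carrier (FObj H A)" using nat_closed[OF \<tau> A x] by simp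
    fix y assume y: "y \<in> carrier (FObj G A)"
    show "inv\<^bsub>FObj H A\<^esub> \<tau> A (x \<otimes>\<^bsub>FObj G A\<^esub> y) = inv\<^bsub>FObj H A\<^esub> \<tau> A x \<otimes>\<^bsub>FObj H A\<^esub> inv\<^bsub>FObj H A\<^esub> \<tau> A y"
      using nat_closed[OF \<tau> A x] nat_closed[OF \<tau> A y] by (simp add: nat_mult[OF \<tau> A x y] HA.inv_mult)
  next
    fix f A B x assume f: "f \<in> Hom C A B" and x: "x \<in> carrier (FObj G A)"
    have AB: "A \<in> Obj C" "B \<in> Obj C" using G.Hom_Obj[OF f] by auto
    interpret gh: group_hom "FObj H A" "FObj H B" "FArr H f"
      using H.group AB H.map_hom[OF f] by (simp add: group_hom_def group_hom_axioms_def comm_group.axioms)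
    show "FArr H f (inv\<^bsub>FObj H A\<^esub> \<tau> A x) = inv\<^bsub>FObj H B\<^esub> \<tau> B (FArr G f x)"
      using nat_closed[OF \<tau> AB(1) x] by (simp add: nat_natural[OF \<tau> f x])
  qed
  moreover have "?n \<otimes>\<^bsub>nat_group C G H\<^esub> \<tau> = \<one>\<^bsub>nat_group C G H\<^esub>"
    unfolding nat_group_simps using one(2) by (auto intro!: restrict_ext)
  ultimately show "\<exists>\<sigma> \<in> carrier (nat_group C G H). \<sigma> \<otimes>\<^bsub>nat_group C G H\<^esub> \<tau> = \<one>\<^bsub>nat_group C G H\<^esub>" by blast
qed

end

section \<open>The functor \<open>delta\<close> of a contravariant duality on compact
  objects\<close>

lemma (in preadditive_category) hom_fun_abfun:
  assumes "A \<in> Obj C"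
  shows "is_abfun C (hom_fun C A)"
  unfolding is_abfun_def hom_fun_def
  using assms dom_cod
  by (auto simp: hom_group ident_comp comp_add_left intro!: postcomp_hom[OF Arr_Hom])
    (auto intro!: comp_assoc simp: Hom_def)

text \<open>\<open>D_additive\<close> is what makes \<open>delta\<close> produce additive functors.
  For an AGJ duality triple it is supplied by \<open>duality_triple_D_additive\<close>.\<close>

locale compact_duality = T: preadditive_category T + U: preadditive_category U
  for u :: "'u itself" and T :: "('o, 'm, 'y) precat_scheme" and U :: "('p, 'n, 'z) precat_scheme"
    and D :: "('p, 'n, 'o, 'm) fctr" +
  assumes D_fctr: "is_fctr (opp (cpt u U)) (cpt u T) D"
    and D_additive: "v \<in> Hom (cpt u U) Y Y' \<Longrightarrow> w \<in> Hom (cpt u U) Y Y' \<Longrightarrow>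
      AM D (Add U v w) = Add T (AM D v) (AM D w)"
begin

sublocale C: preadditive_category "cpt u T"
  by (rule T.cpt_preadditive)

sublocale E: preadditive_category "cpt u U"
  by (rule U.cpt_preadditive)

lemma cpt_simps [simp]:
  "Obj (cpt u T) = compacts u T" "Comp (cpt u T) = Comp T" "Add (cpt u T) = Add T" "Zero (cpt u T) = Zero T"
  "Ident (cpt u T) = Ident T" "Dom (cpt u T) = Dom T" "Cod (cpt u T) = Cod T"
  "Obj (cpt u U) = compacts u U" "Comp (cpt u U) = Comp U" "Add (cpt u U) = Add U" "Zero (cpt u U) = Zero U"
  "Ident (cpt u U) = Ident U" "Dom (cpt u U) = Dom U" "Cod (cpt u U) = Cod U"
  by (simp_all add: cpt_def)

lemma D_Obj: "Y \<in> compacts u U \<Longrightarrow> OM D Y \<in> compacts u T"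
  using D_fctr by (simp add: is_fctr_def opp_def)

lemma D_ident: "Y \<in> compacts u U \<Longrightarrow> AM D (Ident U Y) = Ident T (OM D Y)"
  using D_fctr by (simp add: is_fctr_def opp_def)

lemma D_Hom:
  assumes "v \<in> Hom (cpt u U) Y Y'"
  shows "AM D v \<in> Hom (cpt u T) (OM D Y') (OM D Y)"
  using D_fctr HomD[OF assms] by (auto simp: is_fctr_def opp_def)

lemma D_comp:
  assumes "v \<in> Hom (cpt u U) Y Y'" "w \<in> Hom (cpt u U) Y' Y''"
  shows "AM D (w \<bullet>\<^bsub>U\<^esub> v) = AM D v \<bullet>\<^bsub>T\<^esub> AM D w"
  using D_fctr HomD[OF assms(1)] HomD[OF assms(2)] by (simp add: is_fctr_def opp_def)

lemma D_zero:
  assumes "Y \<in> compacts u U" "Y' \<in> compacts u U"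
  shows "AM D (Zero U Y Y') = Zero T (OM D Y') (OM D Y)"
proof -
  have z: "Zero U Y Y' \<in> Hom (cpt u U) Y Y'" using E.zero_closed assms by simp
  show ?thesis
    using D_additive[OF z z] E.add_zero(1)[OF z] by (intro C.add_idem_zero[OF D_Hom[OF z], simplified]) simp
qed

end

locale dual_functor = compact_duality u T U D + G: abelian_functor "cpt u T" G
  for u :: "'u itself" and T :: "('o, 'm, 'y) precat_scheme" and U :: "('p, 'n, 'z) precat_scheme"
    and D :: "('p, 'n, 'o, 'm) fctr" and G :: "('o, 'm, 'g) abfun"
begin

abbreviation NG :: "'p \<Rightarrow> ('o \<Rightarrow> 'g \<Rightarrow> 'm) monoid" where
  "NG Y \<equiv> nat_group (cpt u T) G (hom_fun (cpt u T) (OM D Y))"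

lemma nats: "Y \<in> compacts u U \<Longrightarrow> abelian_functors (cpt u T) G (hom_fun (cpt u T) (OM D Y))"
  using C.hom_fun_abfun[of "OM D Y"] D_Obj[of Y] G.abfun C.preadditive_category_axioms
  by (simp add: abelian_functors_def abelian_functor_def abelian_functor_axioms_def)

lemma hom_fun_simps [simp]:
  "FObj (hom_fun C A) X = homgrp C A X" "FArr (hom_fun C A) g x = g \<bullet>\<^bsub>C\<^esub> x"
  by (simp_all add: hom_fun_def)

lemma NG_Hom:
  assumes "Y \<in> compacts u U" "\<tau> \<in> carrier (NG Y)" "A \<in> compacts u T" "x \<in> carrier (FObj G A)"
  shows "\<tau> A x \<in> Hom (cpt u T) (OM D Y) A"
  using abelian_functors.nat_closed[OF nats[OF assms(1)] assms(2), of A x] assms(3,4) by simp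

lemma NG_mult:
  assumes "A \<in> compacts u T" "x \<in> carrier (FObj G A)"
  shows "(\<sigma> \<otimes>\<^bsub>NG Y\<^esub> \<tau>) A x = Add T (\<sigma> A x) (\<tau> A x)"
  using assms by (simp add: nat_group_def)

lemma NG_one:
  assumes "A \<in> compacts u T" "x \<in> carrier (FObj G A)"
  shows "\<one>\<^bsub>NG Y\<^esub> A x = Zero T (OM D Y) A"
  using assms by (simp add: nat_group_def)

lemma NG_eqI:
  assumes "Y \<in> compacts u U" "\<sigma> \<in> carrier (NG Y)" "\<tau> \<in> carrier (NG Y)"
    "\<And>A x. A \<in> compacts u T \<Longrightarrow> x \<in> carrier (FObj G A) \<Longrightarrow> \<sigma> A x = \<tau> A x"
  shows "\<sigma> = \<tau>"
  using abelian_functors.nat_group_eqI[OF nats[OF assms(1)] assms(2,3)] assms(4) by simp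

lemma delta_FObj: "FObj (delta u T D G) Y = NG Y"
  by (simp add: delta_def)

lemma delta_FArr:
  assumes "A \<in> compacts u T" "x \<in> carrier (FObj G A)"
  shows "FArr (delta u T D G) v \<tau> A x = \<tau> A x \<bullet>\<^bsub>T\<^esub> AM D v"
  using assms by (simp add: delta_def)

lemma delta_closed:
  assumes v: "v \<in> Hom (cpt u U) Y Y'" and \<tau>: "\<tau> \<in> carrier (NG Y)"
  shows "FArr (delta u T D G) v \<tau> \<in> carrier (NG Y')"
proof -
  have Y: "Y \<in> compacts u U" "Y' \<in> compacts u U" using E.Hom_Obj[OF v] by auto
  interpret N: abelian_functors "cpt u T" G "hom_fun (cpt u T) (OM D Y)" by (rule nats[OF Y(1)])
  interpret N': abelian_functors "cpt u T" G "hom_fun (cpt u T) (OM D Y')" by (rule nats[OF Y(2)])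
  note Dv = D_Hom[OF v]
  have "(\<lambda>A \<in> Obj (cpt u T). \<lambda>x \<in> carrier (FObj G A). \<tau> A x \<bullet>\<^bsub>T\<^esub> AM D v) \<in> carrier (NG Y')"
  proof (rule N'.nat_group_restrictI)
    fix A x assume A: "A \<in> Obj (cpt u T)" and x: "x \<in> carrier (FObj G A)"
    have \<tau>x: "\<tau> A x \<in> Hom (cpt u T) (OM D Y) A" using NG_Hom[OF Y(1) \<tau>] A x by simp
    show "\<tau> A x \<bullet>\<^bsub>T\<^esub> AM D v \<in> carrier (FObj (hom_fun (cpt u T) (OM D Y')) A)"
      using C.comp[OF Dv \<tau>x] by simp
    fix y assume y: "y \<in> carrier (FObj G A)"
    have \<tau>y: "\<tau> A y \<in> Hom (cpt u T) (OM D Y) A" using NG_Hom[OF Y(1) \<tau>] A y by simp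
    show "\<tau> A (x \<otimes>\<^bsub>FObj G A\<^esub> y) \<bullet>\<^bsub>T\<^esub> AM D v =
        \<tau> A x \<bullet>\<^bsub>T\<^esub> AM D v \<otimes>\<^bsub>FObj (hom_fun (cpt u T) (OM D Y')) A\<^esub> \<tau> A y \<bullet>\<^bsub>T\<^esub> AM D v"
      using N.nat_mult[OF \<tau> A x y] C.comp_add_left[OF Dv \<tau>x \<tau>y] by simp
  next
    fix g A B x assume g: "g \<in> Hom (cpt u T) A B" and x: "x \<in> carrier (FObj G A)"
    have \<tau>x: "\<tau> A x \<in> Hom (cpt u T) (OM D Y) A" using NG_Hom[OF Y(1) \<tau>] C.Hom_Obj[OF g] x by simp
    show "FArr (hom_fun (cpt u T) (OM D Y')) g (\<tau> A x \<bullet>\<^bsub>T\<^esub> AM D v) = \<tau> B (FArr G g x) \<bullet>\<^bsub>T\<^esub> AM D v"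
      using C.comp_assoc[OF Dv \<tau>x g] N.nat_natural[OF \<tau> g x] by simp
  qed
  then show ?thesis by (simp add: delta_def)
qed

lemma delta_abfun: "is_abfun (cpt u U) (delta u T D G)"
proof -
  let ?d = "delta u T D G"
  have grp: "comm_group (NG Y)" if "Y \<in> compacts u U" for Y
    using abelian_functors.comm_group_nat_group[OF nats[OF that]] .
  have NGm: "\<sigma> \<otimes>\<^bsub>NG Y\<^esub> \<tau> \<in> carrier (NG Y)"
    if "Y \<in> compacts u U" "\<sigma> \<in> carrier (NG Y)" "\<tau> \<in> carrier (NG Y)" for Y \<sigma> \<tau>
    using grp[OF that(1)] that(2,3) by (simp add: comm_group.axioms group.is_monoid monoid.m_closed)
  have id: "FArr ?d (Ident U Y) \<tau> = \<tau>" if Y: "Y \<in> compacts u U" and \<tau>: "\<tau> \<in> carrier (NG Y)" for Y \<tau>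
  proof (rule NG_eqI[OF Y delta_closed[OF _ \<tau>] \<tau>])
    show "Ident U Y \<in> Hom (cpt u U) Y Y" using E.ident[of Y] Y by simp
    show "FArr ?d (Ident U Y) \<tau> A x = \<tau> A x" if "A \<in> compacts u T" "x \<in> carrier (FObj G A)" for A x
      using delta_FArr[OF that] D_ident[OF Y] C.comp_ident[OF NG_Hom[OF Y \<tau> that]] by simp
  qed
  have hom: "FArr ?d v \<in> hom (NG Y) (NG Y')" if v: "v \<in> Hom (cpt u U) Y Y'" for v Y Y'
  proof (rule homI)
    have Y: "Y \<in> compacts u U" "Y' \<in> compacts u U" using E.Hom_Obj[OF v] by auto
    show "FArr ?d v \<tau> \<in> carrier (NG Y')" if "\<tau> \<in> carrier (NG Y)" for \<tau> by (rule delta_closed[OF v that])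
    fix \<sigma> \<tau> assume \<sigma>: "\<sigma> \<in> carrier (NG Y)" and \<tau>: "\<tau> \<in> carrier (NG Y)"
    show "FArr ?d v (\<sigma> \<otimes>\<^bsub>NG Y\<^esub> \<tau>) = FArr ?d v \<sigma> \<otimes>\<^bsub>NG Y'\<^esub> FArr ?d v \<tau>"
    proof (rule NG_eqI[OF Y(2)])
      show "FArr ?d v (\<sigma> \<otimes>\<^bsub>NG Y\<^esub> \<tau>) \<in> carrier (NG Y')" by (rule delta_closed[OF v NGm[OF Y(1) \<sigma> \<tau>]])
      show "FArr ?d v \<sigma> \<otimes>\<^bsub>NG Y'\<^esub> FArr ?d v \<tau> \<in> carrier (NG Y')"
        by (rule NGm[OF Y(2) delta_closed[OF v \<sigma>] delta_closed[OF v \<tau>]])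
      show "FArr ?d v (\<sigma> \<otimes>\<^bsub>NG Y\<^esub> \<tau>) A x = (FArr ?d v \<sigma> \<otimes>\<^bsub>NG Y'\<^esub> FArr ?d v \<tau>) A x"
        if "A \<in> compacts u T" "x \<in> carrier (FObj G A)" for A x
        using C.comp_add_left[OF D_Hom[OF v] NG_Hom[OF Y(1) \<sigma> that] NG_Hom[OF Y(1) \<tau> that]]
        by (simp add: delta_FArr[OF that] NG_mult[OF that])
    qed
  qed
  have cmp: "FArr ?d (w \<bullet>\<^bsub>U\<^esub> v) \<tau> = FArr ?d w (FArr ?d v \<tau>)"
    if v: "v \<in> Hom (cpt u U) Y Y'" and w: "w \<in> Hom (cpt u U) Y' Y''" and \<tau>: "\<tau> \<in> carrier (NG Y)"
    for v w Y Y' Y'' \<tau>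
  proof (rule NG_eqI)
    have Y: "Y \<in> compacts u U" using E.Hom_Obj[OF v] by simp
    show "Y'' \<in> compacts u U" using E.Hom_Obj[OF w] by simp
    show "FArr ?d (w \<bullet>\<^bsub>U\<^esub> v) \<tau> \<in> carrier (NG Y'')" using delta_closed[OF E.comp[OF v w] \<tau>] by simp
    show "FArr ?d w (FArr ?d v \<tau>) \<in> carrier (NG Y'')" by (rule delta_closed[OF w delta_closed[OF v \<tau>]])
    show "FArr ?d (w \<bullet>\<^bsub>U\<^esub> v) \<tau> A x = FArr ?d w (FArr ?d v \<tau>) A x"
      if "A \<in> compacts u T" "x \<in> carrier (FObj G A)" for A x
      using C.comp_assoc[OF D_Hom[OF w] D_Hom[OF v] NG_Hom[OF Y \<tau> that]]
      by (simp add: delta_FArr[OF that] D_comp[OF v w])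
  qed
  have add: "FArr ?d (Add U v w) \<tau> = FArr ?d v \<tau> \<otimes>\<^bsub>NG Y'\<^esub> FArr ?d w \<tau>"
    if v: "v \<in> Hom (cpt u U) Y Y'" and w: "w \<in> Hom (cpt u U) Y Y'" and \<tau>: "\<tau> \<in> carrier (NG Y)"
    for v w Y Y' \<tau>
  proof (rule NG_eqI)
    have Y: "Y \<in> compacts u U" using E.Hom_Obj[OF v] by simp
    show Y': "Y' \<in> compacts u U" using E.Hom_Obj[OF w] by simp
    show "FArr ?d (Add U v w) \<tau> \<in> carrier (NG Y')" using delta_closed[OF E.add_closed[OF v w] \<tau>] by simp
    show "FArr ?d v \<tau> \<otimes>\<^bsub>NG Y'\<^esub> FArr ?d w \<tau> \<in> carrier (NG Y')"
      by (rule NGm[OF Y' delta_closed[OF v \<tau>] delta_closed[OF w \<tau>]])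
    show "FArr ?d (Add U v w) \<tau> A x = (FArr ?d v \<tau> \<otimes>\<^bsub>NG Y'\<^esub> FArr ?d w \<tau>) A x"
      if "A \<in> compacts u T" "x \<in> carrier (FObj G A)" for A x
      using C.comp_add_right[OF D_Hom[OF v] D_Hom[OF w] NG_Hom[OF Y \<tau> that]]
      by (simp add: delta_FArr[OF that] NG_mult[OF that] D_additive[OF v w])
  qed
  show ?thesis
    unfolding is_abfun_def delta_FObj
  proof (intro conjI ballI allI impI)
    fix v w \<tau> assume "v \<in> Arr (cpt u U)" "w \<in> Arr (cpt u U)" "Dom (cpt u U) w = Cod (cpt u U) v"
      "\<tau> \<in> carrier (NG (Dom (cpt u U) v))"
    then show "FArr ?d (w \<bullet>\<^bsub>cpt u U\<^esub> v) \<tau> = FArr ?d w (FArr ?d v \<tau>)"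
      using cmp[of v "Dom U v" "Cod U v" w "Cod U w" \<tau>] by (simp add: Hom_def)
  qed (use grp id hom[OF Arr_Hom] add in auto)
qed

text \<open>By the Yoneda lemma the transformations from \<open>G\<close> to \<open>Hom(D Y, -)\<close> correspond to the maps
  \<open>g : D Y \<rightarrow> Dom f\<close> with \<open>f g = 0\<close>.\<close>

lemma delta_presented:
  assumes f: "f \<in> Hom (cpt u T) A B" and \<xi>: "universal_element (cpt u T) f G \<xi>"
    and h: "h \<in> Hom (cpt u U) M L" and g0: "g0 \<in> Hom (cpt u T) (OM D M) A"
    and fg0: "f \<bullet>\<^bsub>T\<^esub> g0 = Zero T (OM D M) B"
    and lift: "\<And>Y g. Y \<in> compacts u U \<Longrightarrow> g \<in> Hom (cpt u T) (OM D Y) A \<Longrightarrow>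
      f \<bullet>\<^bsub>T\<^esub> g = Zero T (OM D Y) B \<Longrightarrow> \<exists>v \<in> Hom (cpt u U) M Y. g = g0 \<bullet>\<^bsub>T\<^esub> AM D v"
    and ker: "\<And>Y v. v \<in> Hom (cpt u U) M Y \<Longrightarrow>
      g0 \<bullet>\<^bsub>T\<^esub> AM D v = Zero T (OM D Y) A \<longleftrightarrow> v \<in> factoring (cpt u U) h Y"
  shows "presents (cpt u U) h (delta u T D G)"
proof -
  let ?d = "delta u T D G" and ?C = "cpt u T" and ?E = "cpt u U"
  have DomCod: "Dom T f = A" "Cod T f = B" "Dom U h = M" using HomD[OF f] HomD[OF h] by simp_all
  have Obj: "A \<in> compacts u T" "B \<in> compacts u T" "M \<in> compacts u U"
    using C.Hom_Obj[OF f] E.Hom_Obj[OF h] by simp_all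
  have \<xi>A: "\<xi> \<in> carrier (FObj G A)" using \<xi> DomCod by (simp add: universal_element_def)
  have surj: "\<exists>x \<in> Hom ?C A X. c = FArr G x \<xi>" if "X \<in> compacts u T" "c \<in> carrier (FObj G X)" for X c
    using universal_elementE[OF \<xi>, of X c] that by (auto simp: DomCod)
  have kerG: "FArr G x \<xi> = \<one>\<^bsub>FObj G X\<^esub> \<longleftrightarrow> x \<in> factoring ?C f X" if "x \<in> Hom ?C A X" for x X
    using \<xi> C.Hom_Obj[OF that] that by (auto simp: universal_element_def DomCod)
  have eval: "\<tau> X (FArr G x \<xi>) = x \<bullet>\<^bsub>T\<^esub> \<tau> A \<xi>"
    if "Y \<in> compacts u U" "\<tau> \<in> carrier (NG Y)" "x \<in> Hom ?C A X" for Y \<tau> x X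
    using abelian_functors.nat_natural[OF nats[OF that(1)] that(2,3) \<xi>A] by simp
  have ftau: "f \<bullet>\<^bsub>T\<^esub> \<tau> A \<xi> = Zero T (OM D Y) B" if Y: "Y \<in> compacts u U" and \<tau>: "\<tau> \<in> carrier (NG Y)" for Y \<tau>
  proof -
    have idB: "Ident T B \<in> Hom ?C B B" using C.ident[of B] Obj by simp
    then have "f \<in> factoring ?C f B"
      using C.ident_comp[OF f] by (auto simp: factoring_def DomCod intro!: rev_image_eqI)
    then have "FArr G f \<xi> = \<one>\<^bsub>FObj G B\<^esub>" using kerG[OF f] by simp
    then have "f \<bullet>\<^bsub>T\<^esub> \<tau> A \<xi> = \<tau> B \<one>\<^bsub>FObj G B\<^esub>" using eval[OF Y \<tau> f] by simp
    also have "\<dots> = Zero T (OM D Y) B"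
      using hom_one[OF abelian_functors.nat_hom[OF nats[OF Y] \<tau>, of B]] G.group[of B]
        C.hom_group[of "OM D Y" B] D_Obj[OF Y] Obj by (simp add: comm_group.axioms)
    finally show ?thesis .
  qed
  \<comment> \<open>Every element of \<open>G\<close> arises from \<open>\<xi>\<close> by applying a
    map, so naturality determines a transformation from its value at \<open>\<xi>\<close>.\<close>
  have NG_determined: "\<sigma> = \<tau>"
    if Y: "Y \<in> compacts u U" and \<sigma>: "\<sigma> \<in> carrier (NG Y)" and \<tau>: "\<tau> \<in> carrier (NG Y)" and eq: "\<sigma> A \<xi> = \<tau> A \<xi>"
    for Y \<sigma> \<tau>
  proof (rule NG_eqI[OF Y \<sigma> \<tau>])
    fix X c assume "X \<in> compacts u T" "c \<in> carrier (FObj G X)"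
    then obtain x where x: "x \<in> Hom ?C A X" "c = FArr G x \<xi>" using surj by blast
    then show "\<sigma> X c = \<tau> X c" using eval[OF Y \<sigma> x(1)] eval[OF Y \<tau> x(1)] eq by simp
  qed
  have "\<exists>\<tau> \<in> carrier (NG M). \<tau> A \<xi> = g0"
  proof -
    interpret N: abelian_functors "cpt u T" G "hom_fun ?C (OM D M)" by (rule nats[OF Obj(3)])
    \<comment> \<open>Naturality forces the transformation with value \<open>g0\<close> at
      \<open>\<xi>\<close> to send the image of \<open>\<xi>\<close> under \<open>x\<close> to x g0.
      Two admissible \<open>x\<close> differ by some z f, and f g0 = 0 removes the
      ambiguity.\<close>
    define t where "t X c = (SOME x. x \<in> Hom ?C A X \<and> FArr G x \<xi> = c) \<bullet>\<^bsub>T\<^esub> g0" for X c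
    have t: "t X (FArr G x \<xi>) = x \<bullet>\<^bsub>T\<^esub> g0" if x: "x \<in> Hom ?C A X" for x X
    proof -
      define y where "y = (SOME y. y \<in> Hom ?C A X \<and> FArr G y \<xi> = FArr G x \<xi>)"
      have y: "y \<in> Hom ?C A X \<and> FArr G y \<xi> = FArr G x \<xi>"
        unfolding y_def by (rule someI[of _ x]) (use x in simp)
      have d: "Add ?C y (Neg ?C x) \<in> Hom ?C A X"
        using C.add_closed C.neg_closed x y by blast
      have "Add ?C y (Neg ?C x) \<in> factoring ?C f X"
        using kerG[OF d] G.evaluation_eq_iff[OF _ x \<xi>A, of y] y by blast
      then obtain z where z: "z \<in> Hom ?C B X" "Add ?C y (Neg ?C x) = z \<bullet>\<^bsub>T\<^esub> f"
        by (auto simp: factoring_def DomCod)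
      have "Add ?C y (Neg ?C x) \<bullet>\<^bsub>cpt u T\<^esub> g0 = Zero ?C (OM D M) X"
        using C.comp_assoc[OF g0 f z(1)] fg0 z C.comp_zero[OF z(1), of "OM D M"] D_Obj[OF Obj(3)] by simp
      then have "y \<bullet>\<^bsub>T\<^esub> g0 = x \<bullet>\<^bsub>T\<^esub> g0"
        using C.diff_comp_zero_iff[OF g0 _ x, of y] y by simp
      then show ?thesis by (simp add: t_def y_def)
    qed
    have "(\<lambda>X \<in> Obj ?C. \<lambda>c \<in> carrier (FObj G X). t X c) \<in> carrier (NG M)"
    proof (rule N.nat_group_restrictI)
      fix X c assume X: "X \<in> Obj ?C" and c: "c \<in> carrier (FObj G X)"
      then obtain x where x: "x \<in> Hom ?C A X" "c = FArr G x \<xi>" using surj by auto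
      show "t X c \<in> carrier (FObj (hom_fun ?C (OM D M)) X)"
        using t[OF x(1)] C.comp[OF g0 x(1)] x(2) by simp
      fix d assume d: "d \<in> carrier (FObj G X)"
      then obtain y where y: "y \<in> Hom ?C A X" "d = FArr G y \<xi>" using surj X by auto
      show "t X (c \<otimes>\<^bsub>FObj G X\<^esub> d) = t X c \<otimes>\<^bsub>FObj (hom_fun ?C (OM D M)) X\<^esub> t X d"
        using t[OF x(1)] t[OF y(1)] t[OF C.add_closed[OF x(1) y(1)]] G.map_add[OF x(1) y(1) \<xi>A]
          C.comp_add_left[OF g0 x(1) y(1)] x(2) y(2) by simp
    next
      fix p X Z c assume p: "p \<in> Hom ?C X Z" and c: "c \<in> carrier (FObj G X)"
      then obtain x where x: "x \<in> Hom ?C A X" "c = FArr G x \<xi>" using surj C.Hom_Obj[OF p] by auto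
      show "FArr (hom_fun ?C (OM D M)) p (t X c) = t Z (FArr G p c)"
        using t[OF x(1)] t[OF C.comp[OF x(1) p]] G.map_comp[OF x(1) p \<xi>A] C.comp_assoc[OF g0 x(1) p] x(2) by simp
    qed
    moreover have "t A \<xi> = g0"
      using t[of "Ident T A" A] C.ident[of A] G.map_ident[of A \<xi>] C.ident_comp[OF g0] Obj \<xi>A by simp
    ultimately show ?thesis using Obj(1) \<xi>A by (intro bexI) auto
  qed
  then obtain \<theta> where \<theta>: "\<theta> \<in> carrier (NG M)" "\<theta> A \<xi> = g0" by blast
  interpret d: abelian_functor ?E ?d
    using delta_abfun by unfold_locales
  have \<theta>v: "FArr ?d v \<theta> \<in> carrier (NG Y)" "FArr ?d v \<theta> A \<xi> = g0 \<bullet>\<^bsub>T\<^esub> AM D v"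
    if "v \<in> Hom ?E M Y" for v Y
    using delta_closed[OF that \<theta>(1)] delta_FArr[OF Obj(1) \<xi>A, of v \<theta>] \<theta>(2) by simp_all
  \<comment> \<open>The transformation with value \<open>g0\<close> is universal:
    \<open>lift\<close> makes evaluation at it onto, and \<open>ker\<close> identifies the kernel of
    this evaluation.\<close>
  have "universal_element ?E h ?d \<theta>"
    unfolding universal_element_def delta_FObj
  proof (intro conjI ballI)
    show "\<theta> \<in> carrier (NG (Dom ?E h))" using \<theta>(1) by (simp add: DomCod)
    fix Y assume "Y \<in> Obj ?E"
    then have Y: "Y \<in> compacts u U" by simp
    show "(\<lambda>v. FArr ?d v \<theta>) ` Hom ?E (Dom ?E h) Y = carrier (NG Y)"
    proof
      show "(\<lambda>v. FArr ?d v \<theta>) ` Hom ?E (Dom ?E h) Y \<subseteq> carrier (NG Y)"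
        using \<theta>v(1) by (auto simp: DomCod)
      show "carrier (NG Y) \<subseteq> (\<lambda>v. FArr ?d v \<theta>) ` Hom ?E (Dom ?E h) Y"
      proof
        fix \<tau> assume \<tau>: "\<tau> \<in> carrier (NG Y)"
        then obtain v where v: "v \<in> Hom ?E M Y" "\<tau> A \<xi> = g0 \<bullet>\<^bsub>T\<^esub> AM D v"
          using lift[OF Y NG_Hom[OF Y \<tau> Obj(1) \<xi>A] ftau[OF Y \<tau>]] by blast
        then have "\<tau> = FArr ?d v \<theta>"
          using \<theta>v[OF v(1)] by (intro NG_determined[OF Y \<tau>]) auto
        then show "\<tau> \<in> (\<lambda>v. FArr ?d v \<theta>) ` Hom ?E (Dom ?E h) Y"
          using v(1) by (simp add: DomCod)
      qed
    qed
    fix v assume "v \<in> Hom ?E (Dom ?E h) Y"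
    then have v: "v \<in> Hom ?E M Y" by (simp add: DomCod)
    have "\<one>\<^bsub>NG Y\<^esub> \<in> carrier (NG Y)"
      using d.group[of Y] Y by (simp add: delta_FObj comm_group.axioms group.is_monoid monoid.one_closed)
    then have "FArr ?d v \<theta> = \<one>\<^bsub>NG Y\<^esub> \<longleftrightarrow> FArr ?d v \<theta> A \<xi> = \<one>\<^bsub>NG Y\<^esub> A \<xi>"
      using NG_determined[OF Y \<theta>v(1)[OF v]] by metis
    also have "\<dots> \<longleftrightarrow> v \<in> factoring ?E h Y"
      using \<theta>v(2)[OF v] NG_one[OF Obj(1) \<xi>A, of Y] ker[OF v] by simp
    finally show "FArr ?d v \<theta> = \<one>\<^bsub>NG Y\<^esub> \<longleftrightarrow> v \<in> factoring ?E h Y" .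
  qed
  then show ?thesis using d.universal_element_imp_presents h HomD(1)[OF h] by blast
qed

end

section \<open>Closure properties of classes of injective objects\<close>

lemma Hom_opp [simp]: "Hom (opp C) A B = Hom C B A"
  by (auto simp: Hom_def opp_def)

lemma opp_simps [simp]:
  "Obj (opp C) = Obj C" "Arr (opp C) = Arr C" "Dom (opp C) = Cod C" "Cod (opp C) = Dom C"
  "Ident (opp C) = Ident C" "g \<bullet>\<^bsub>opp C\<^esub> f = f \<bullet>\<^bsub>C\<^esub> g" "Add (opp C) = Add C"
  "Zero (opp C) A B = Zero C B A"
  by (simp_all add: opp_def)

lemma homgrp_opp: "homgrp (opp C) A B = homgrp C B A"
  by (simp add: homgrp_def)

context preadditive_category
begin

lemma opp_preadditive: "preadditive_category (opp C)"
  by (unfold preadditive_category_def)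
    (auto simp: homgrp_opp hom_group comp_assoc comp_add_left comp_add_right dom_cod
      comp_ident ident_comp ident intro: comp)

lemma injective_wrtD:
  assumes "injective_wrt C f X" "f \<in> Hom C A B" "x \<in> Hom C A X"
  shows "\<exists>z \<in> Hom C B X. x = z \<bullet> f"
  using assms HomD[OF assms(2)] by (auto simp: injective_wrt_def factoring_def)

lemma injective_wrtI:
  assumes f: "f \<in> Hom C A B" and "\<And>x. x \<in> Hom C A X \<Longrightarrow> \<exists>z \<in> Hom C B X. x = z \<bullet> f"
  shows "injective_wrt C f X"
  using assms(2) HomD[OF f] factoring_subset[of f X] by (auto simp: injective_wrt_def factoring_def)

lemma injective_wrt_retract:
  assumes f: "f \<in> Hom C A B" and inj: "injective_wrt C f X"
    and s: "s \<in> Hom C Y X" and r: "r \<in> Hom C X Y" and rs: "r \<bullet> s = Ident C Y"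
  shows "injective_wrt C f Y"
proof (rule injective_wrtI[OF f])
  fix y assume y: "y \<in> Hom C A Y"
  obtain z where z: "z \<in> Hom C B X" "s \<bullet> y = z \<bullet> f"
    using injective_wrtD[OF inj f comp[OF y s]] by blast
  have "y = (r \<bullet> z) \<bullet> f"
    using comp_assoc[OF y s r] comp_assoc[OF f z(1) r] z(2) rs ident_comp[OF y] by simp
  then show "\<exists>z \<in> Hom C B Y. y = z \<bullet> f" using comp[OF z(1) r] by blast
qed

lemma injective_wrt_product:
  assumes f: "f \<in> Hom C A B" and prod: "is_product C I X P \<pi>"
    and inj: "\<And>i. i \<in> I \<Longrightarrow> injective_wrt C f (X i)"
  shows "injective_wrt C f P"
proof (rule injective_wrtI[OF f])
  interpret O: coproduct "opp C" I X P \<pi>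
    using opp_preadditive prod by (simp add: coproduct_def coproduct_axioms_def is_product_def)
  fix x assume x: "x \<in> Hom C A P"
  have \<pi>: "\<pi> i \<in> Hom C P (X i)" if "i \<in> I" for i using O.inj_Hom[OF that] by simp
  have "\<exists>z \<in> Hom C B (X i). \<pi> i \<bullet> x = z \<bullet> f" if "i \<in> I" for i
    using injective_wrtD[OF inj[OF that] f comp[OF x \<pi>[OF that]]] .
  then obtain z where z: "\<And>i. i \<in> I \<Longrightarrow> z i \<in> Hom C B (X i)" "\<And>i. i \<in> I \<Longrightarrow> \<pi> i \<bullet> x = z i \<bullet> f" by metis
  obtain w where w: "w \<in> Hom C B P" "\<And>i. i \<in> I \<Longrightarrow> \<pi> i \<bullet> w = z i"
    using O.ex_cotuple[of B z] z(1) Hom_Obj[OF f] by auto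
  have "x = w \<bullet> f"
  proof (rule O.cotuple_unique)
    show "x \<in> Hom (opp C) P A" "w \<bullet> f \<in> Hom (opp C) P A" using x comp[OF f w(1)] by simp_all
    show "x \<bullet>\<^bsub>opp C\<^esub> \<pi> i = (w \<bullet> f) \<bullet>\<^bsub>opp C\<^esub> \<pi> i" if "i \<in> I" for i
      using comp_assoc[OF f w(1) \<pi>[OF that]] w(2)[OF that] z(2)[OF that] by simp
  qed
  then show "\<exists>z \<in> Hom C B P. x = z \<bullet> f" using w(1) by blast
qed

lemma injective_wrt_finite_coproduct:
  assumes f: "f \<in> Hom C A B" and cop: "is_coproduct C I X P \<iota>" and fin: "finite I"
    and inj: "\<And>i. i \<in> I \<Longrightarrow> injective_wrt C f (X i)"
  shows "injective_wrt C f P"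
proof (rule injective_wrtI[OF f])
  interpret coproduct C I X P \<iota> using cop by unfold_locales
  fix x assume x: "x \<in> Hom C A P"
  have "\<exists>z \<in> Hom C B (X i). proj i \<bullet> x = z \<bullet> f" if "i \<in> I" for i
    using injective_wrtD[OF inj[OF that] f comp[OF x proj(1)[OF that]]] .
  then obtain z where z: "\<And>i. i \<in> I \<Longrightarrow> z i \<in> Hom C B (X i)" "\<And>i. i \<in> I \<Longrightarrow> proj i \<bullet> x = z i \<bullet> f" by metis
  have B: "B \<in> Obj C" and A: "A \<in> Obj C" using Hom_Obj[OF f] by auto
  interpret H: comm_group "homgrp C A P" by (rule hom_group[OF A P_Obj])
  have iz: "\<iota> i \<bullet> z i \<in> Hom C B P" if "i \<in> I" for i using comp[OF z(1) inj_Hom] that by blast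
  have ip: "\<iota> i \<bullet> proj i \<in> Hom C P P" if "i \<in> I" for i using comp[OF proj(1) inj_Hom] that by blast
  have eq: "(\<iota> i \<bullet> z i) \<bullet> f = (\<iota> i \<bullet> proj i) \<bullet> x" if "i \<in> I" for i
    using comp_assoc[OF f z(1)[OF that] inj_Hom[OF that]] comp_assoc[OF x proj(1)[OF that] inj_Hom[OF that]]
      z(2)[OF that] by simp
  let ?w = "gfinprod (homgrp C B P) (\<lambda>i. \<iota> i \<bullet> z i) I"
  have "?w \<bullet> f = gfinprod (homgrp C A P) (\<lambda>i. (\<iota> i \<bullet> z i) \<bullet> f) I"
    by (rule gfinprod_comp[OF f P_Obj iz]) (use fin in auto)
  also have "\<dots> = gfinprod (homgrp C A P) (\<lambda>i. (\<iota> i \<bullet> proj i) \<bullet> x) I"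
    using eq comp[OF x ip] by (intro H.gfinprod_cong) (simp_all add: simp_implies_def)
  also have "\<dots> = gfinprod (homgrp C P P) (\<lambda>i. \<iota> i \<bullet> proj i) I \<bullet> x"
    by (rule gfinprod_comp[OF x P_Obj ip, symmetric]) (use fin in auto)
  \<comment> \<open>For finite \<open>I\<close> the idempotents built from injections and
    projections add up to the truncation at \<open>I\<close>, the identity of \<open>P\<close>; so
    \<open>x\<close> is recovered from its components.\<close>
  also have "gfinprod (homgrp C P P) (\<lambda>i. \<iota> i \<bullet> proj i) I = trunc I"
    using trunc_eq_gfinprod[OF fin] by simp
  also have "trunc I = Ident C P"
    using ident_comp[OF inj_Hom] by (intro trunc_unique ident[OF P_Obj]) auto
  also have "Ident C P \<bullet> x = x" by (rule ident_comp[OF x])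
  finally have "x = ?w \<bullet> f" by simp
  moreover have "?w \<in> Hom C B P" by (rule gfinprod_Hom[OF B P_Obj iz])
  ultimately show "\<exists>z \<in> Hom C B P. x = z \<bullet> f" by (intro bexI[of _ ?w])
qed

text \<open>Both members of the duality pair will be written as classes of this form, one in
  \<open>T\<close> and one in \<open>U\<close>, so these three properties provide all the closure
  conditions of the theorem.\<close>

lemma injective_class_closed:
  assumes "F \<subseteq> Arr C"
  shows injective_class_finite_coproducts:
      "closed_under_finite_coproducts C {X \<in> Obj C. \<forall>f \<in> F. injective_wrt C f X}"
    and injective_class_retracts: "closed_under_retracts C {X \<in> Obj C. \<forall>f \<in> F. injective_wrt C f X}"
    and injective_class_products: "closed_under_products u C {X \<in> Obj C. \<forall>f \<in> F. injective_wrt C f X}"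
proof -
  have f: "f \<in> Hom C (Dom C f) (Cod C f)" if "f \<in> F" for f
    using that assms by (auto simp: Hom_def)
  show "closed_under_finite_coproducts C {X \<in> Obj C. \<forall>f \<in> F. injective_wrt C f X}"
    unfolding closed_under_finite_coproducts_def
  proof (intro allI impI)
    fix I :: "nat set" and X P \<iota>
    assume I: "finite I" "\<forall>i \<in> I. X i \<in> {X \<in> Obj C. \<forall>f \<in> F. injective_wrt C f X}"
      and cop: "is_coproduct C I X P \<iota>"
    have "P \<in> Obj C" using cop by (simp add: is_coproduct_def)
    then show "P \<in> {X \<in> Obj C. \<forall>f \<in> F. injective_wrt C f X}"
      using injective_wrt_finite_coproduct[OF f cop I(1)] I(2) by simp
  qed
  show "closed_under_retracts C {X \<in> Obj C. \<forall>f \<in> F. injective_wrt C f X}"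
    unfolding closed_under_retracts_def using injective_wrt_retract[OF f] by blast
  show "closed_under_products u C {X \<in> Obj C. \<forall>f \<in> F. injective_wrt C f X}"
    unfolding closed_under_products_def
  proof (intro allI impI)
    fix I and X P \<pi>
    assume X: "\<forall>i \<in> I. X i \<in> {X \<in> Obj C. \<forall>f \<in> F. injective_wrt C f X}" and P: "is_product C I X P \<pi>"
    have "P \<in> Obj C" using P by (simp add: is_product_def is_coproduct_def)
    then show "P \<in> {X \<in> Obj C. \<forall>f \<in> F. injective_wrt C f X}"
      using injective_wrt_product[OF f P] X by simp
  qed
qed

lemma injective_wrt_isomorphic:
  assumes f: "f \<in> Hom C A B" and f': "f' \<in> Hom C A' B'"
    and a: "a \<in> Hom C A A'" "isomorphism C a" and b: "b \<in> Hom C B B'"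
    and sq: "b \<bullet> f = f' \<bullet> a" and inj: "injective_wrt C f' X"
  shows "injective_wrt C f X"
proof (rule injective_wrtI[OF f])
  fix x assume x: "x \<in> Hom C A X"
  obtain a' where a': "a' \<in> Hom C A' A" "a' \<bullet> a = Ident C A"
    using isomorphismE[OF a(2,1)] by blast
  obtain z where z: "z \<in> Hom C B' X" "x \<bullet> a' = z \<bullet> f'"
    using injective_wrtD[OF inj f' comp[OF a'(1) x]] by blast
  have "x = (x \<bullet> a') \<bullet> a" using comp_assoc[OF a(1) a'(1) x] a'(2) comp_ident[OF x] by simp
  also have "\<dots> = (z \<bullet> b) \<bullet> f"
    using comp_assoc[OF a(1) f' z(1)] comp_assoc[OF f b z(1)] z(2) sq by simp
  finally show "\<exists>z \<in> Hom C B X. x = z \<bullet> f" using comp[OF b z(1)] by blast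
qed

lemma injective_wrt_isomorphic_iff:
  assumes f: "f \<in> Hom C A B" and f': "f' \<in> Hom C A' B'"
    and a: "a \<in> Hom C A A'" "isomorphism C a" and b: "b \<in> Hom C B B'" "isomorphism C b"
    and sq: "b \<bullet> f = f' \<bullet> a"
  shows "injective_wrt C f X \<longleftrightarrow> injective_wrt C f' X"
proof
  obtain a' where a': "a' \<in> Hom C A' A" "a' \<bullet> a = Ident C A" "a \<bullet> a' = Ident C A'"
    using isomorphismE[OF a(2,1)] by blast
  obtain b' where b': "b' \<in> Hom C B' B" "b' \<bullet> b = Ident C B"
    using isomorphismE[OF b(2,1)] by blast
  have iso: "isomorphism C a'" using a a' HomD[OF a(1)] HomD[OF a'(1)] by (auto simp: isomorphism_def)
  have "b' \<bullet> f' = b' \<bullet> ((f' \<bullet> a) \<bullet> a')"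
    using comp_assoc[OF a'(1) a(1) f'] a'(3) comp_ident[OF f'] by simp
  also have "\<dots> = f \<bullet> a'"
    using comp_assoc[OF a'(1) f b(1)] comp_assoc[OF comp[OF a'(1) f] b(1) b'(1)] sq b'(2)
      ident_comp[OF comp[OF a'(1) f]] by simp
  finally show "injective_wrt C f' X" if "injective_wrt C f X"
    using injective_wrt_isomorphic[OF f' f a'(1) iso b'(1)] that by blast
qed (rule injective_wrt_isomorphic[OF f f' a b(1) sq])

end

section \<open>Equivalences\<close>

locale equivalence = C: preadditive_category C + E: preadditive_category E
  for C :: "('o, 'm, 'y) precat_scheme" and E :: "('p, 'n, 'z) precat_scheme"
    and F :: "('o, 'm, 'p, 'n) fctr" and G :: "('p, 'n, 'o, 'm) fctr"
    and \<eta> :: "'o \<Rightarrow> 'm" and \<epsilon> :: "'p \<Rightarrow> 'n" +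
  assumes F: "is_fctr C E F" and G: "is_fctr E C G"
    and \<eta>: "is_nat_iso C C id_fctr (comp_fctr G F) \<eta>"
    and \<epsilon>: "is_nat_iso E E (comp_fctr F G) id_fctr \<epsilon>"
begin

lemma F_Obj: "A \<in> Obj C \<Longrightarrow> OM F A \<in> Obj E"
  using F by (simp add: is_fctr_def)

lemma F_Hom:
  assumes "f \<in> Hom C A B"
  shows "AM F f \<in> Hom E (OM F A) (OM F B)"
  using F HomD[OF assms] by (auto simp: is_fctr_def)

lemma G_Hom:
  assumes "f \<in> Hom E A B"
  shows "AM G f \<in> Hom C (OM G A) (OM G B)"
  using G HomD[OF assms] by (auto simp: is_fctr_def)

lemma unit_Hom: "A \<in> Obj C \<Longrightarrow> \<eta> A \<in> Hom C A (OM G (OM F A))"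
  using \<eta> by (simp add: is_nat_iso_def is_nat_def id_fctr_def comp_fctr_def)

lemma unit_isomorphism: "A \<in> Obj C \<Longrightarrow> isomorphism C (\<eta> A)"
  using \<eta> by (simp add: is_nat_iso_def)

lemma unit_natural: "f \<in> Hom C A B \<Longrightarrow> AM G (AM F f) \<bullet>\<^bsub>C\<^esub> \<eta> A = \<eta> B \<bullet>\<^bsub>C\<^esub> f"
  using \<eta> by (auto simp: is_nat_iso_def is_nat_def id_fctr_def comp_fctr_def Hom_def)

lemma counit_Hom: "Y \<in> Obj E \<Longrightarrow> \<epsilon> Y \<in> Hom E (OM F (OM G Y)) Y"
  using \<epsilon> by (simp add: is_nat_iso_def is_nat_def id_fctr_def comp_fctr_def)

lemma counit_isomorphism: "Y \<in> Obj E \<Longrightarrow> isomorphism E (\<epsilon> Y)"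
  using \<epsilon> by (simp add: is_nat_iso_def)

lemma counit_natural: "f \<in> Hom E A B \<Longrightarrow> f \<bullet>\<^bsub>E\<^esub> \<epsilon> A = \<epsilon> B \<bullet>\<^bsub>E\<^esub> AM F (AM G f)"
  using \<epsilon> by (auto simp: is_nat_iso_def is_nat_def id_fctr_def comp_fctr_def Hom_def)

lemma F_faithful:
  assumes f: "f \<in> Hom C A B" and g: "g \<in> Hom C A B" and eq: "AM F f = AM F g"
  shows "f = g"
proof -
  have B: "B \<in> Obj C" using C.Hom_Obj[OF f] by blast
  obtain e where e: "e \<in> Hom C (OM G (OM F B)) B" "e \<bullet>\<^bsub>C\<^esub> \<eta> B = Ident C B"
    using isomorphismE[OF unit_isomorphism[OF B] unit_Hom[OF B]] by blast
  have "k = e \<bullet>\<^bsub>C\<^esub> (AM G (AM F k) \<bullet>\<^bsub>C\<^esub> \<eta> A)" if k: "k \<in> Hom C A B" for k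
    using unit_natural[OF k] C.comp_assoc[OF k unit_Hom[OF B] e(1)] e(2) C.ident_comp[OF k] by simp
  then show ?thesis using f g eq by metis
qed

lemma G_faithful:
  assumes f: "f \<in> Hom E A B" and g: "g \<in> Hom E A B" and eq: "AM G f = AM G g"
  shows "f = g"
proof -
  have A: "A \<in> Obj E" using E.Hom_Obj[OF f] by blast
  obtain e where e: "e \<in> Hom E A (OM F (OM G A))" "\<epsilon> A \<bullet>\<^bsub>E\<^esub> e = Ident E A"
    using isomorphismE[OF counit_isomorphism[OF A] counit_Hom[OF A]] by blast
  have "k = (\<epsilon> B \<bullet>\<^bsub>E\<^esub> AM F (AM G k)) \<bullet>\<^bsub>E\<^esub> e" if k: "k \<in> Hom E A B" for k
    using counit_natural[OF k] E.comp_assoc[OF e(1) counit_Hom[OF A] k] e(2) E.comp_ident[OF k] by simp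
  then show ?thesis using f g eq by metis
qed

text \<open>The preimage of \<open>t\<close> is its image under \<open>F\<close>, conjugated by the
  counit. Naturality of the counit shows that \<open>AM G e\<close> and \<open>t\<close> agree after
  \<open>F\<close>, which is faithful.\<close>

lemma G_full:
  assumes A: "A \<in> Obj E" and B: "B \<in> Obj E" and t: "t \<in> Hom C (OM G A) (OM G B)"
  obtains e where "e \<in> Hom E A B" "AM G e = t"
proof -
  obtain i where i: "i \<in> Hom E A (OM F (OM G A))" "i \<bullet>\<^bsub>E\<^esub> \<epsilon> A = Ident E (OM F (OM G A))"
    using isomorphismE[OF counit_isomorphism[OF A] counit_Hom[OF A]] by blast
  obtain j where j: "j \<in> Hom E B (OM F (OM G B))" "j \<bullet>\<^bsub>E\<^esub> \<epsilon> B = Ident E (OM F (OM G B))"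
    using isomorphismE[OF counit_isomorphism[OF B] counit_Hom[OF B]] by blast
  note Ft = F_Hom[OF t]
  have \<epsilon>F: "\<epsilon> B \<bullet>\<^bsub>E\<^esub> AM F t \<in> Hom E (OM F (OM G A)) B" by (rule E.comp[OF Ft counit_Hom[OF B]])
  define e where "e = (\<epsilon> B \<bullet>\<^bsub>E\<^esub> AM F t) \<bullet>\<^bsub>E\<^esub> i"
  have e: "e \<in> Hom E A B" unfolding e_def by (rule E.comp[OF i(1) \<epsilon>F])
  note FGe = F_Hom[OF G_Hom[OF e]]
  have "\<epsilon> B \<bullet>\<^bsub>E\<^esub> AM F (AM G e) = \<epsilon> B \<bullet>\<^bsub>E\<^esub> AM F t"
    using counit_natural[OF e] E.comp_assoc[OF counit_Hom[OF A] i(1) \<epsilon>F] i(2) E.comp_ident[OF \<epsilon>F]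
    by (simp add: e_def)
  then have "AM F (AM G e) = AM F t"
    using E.comp_assoc[OF FGe counit_Hom[OF B] j(1)] E.comp_assoc[OF Ft counit_Hom[OF B] j(1)] j(2)
      E.ident_comp[OF FGe] E.ident_comp[OF Ft] by simp
  then have "AM G e = t" by (rule F_faithful[OF G_Hom[OF e] t])
  then show ?thesis using e that by blast
qed

end

section \<open>The Auslander--Gruson--Jensen isomorphisms\<close>

lemma hom_group_mult_closed:
  assumes "comm_group G" "comm_group H" "\<phi> \<in> carrier (hom_group G H)" "\<psi> \<in> carrier (hom_group G H)"
  shows "\<phi> \<otimes>\<^bsub>hom_group G H\<^esub> \<psi> \<in> carrier (hom_group G H)"
proof -
  interpret G: comm_group G by fact
  interpret H: comm_group H by fact
  have "\<phi> x \<in> carrier H" "\<psi> x \<in> carrier H" if "x \<in> carrier G" for x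
    using assms(3,4) that by (auto simp: hom_group_def hom_def)
  moreover have "\<phi> (x \<otimes>\<^bsub>G\<^esub> y) = \<phi> x \<otimes>\<^bsub>H\<^esub> \<phi> y" "\<psi> (x \<otimes>\<^bsub>G\<^esub> y) = \<psi> x \<otimes>\<^bsub>H\<^esub> \<psi> y"
    if "x \<in> carrier G" "y \<in> carrier G" for x y
    using assms(3,4) that by (auto simp: hom_group_def hom_def)
  ultimately show ?thesis by (simp add: hom_group_def hom_def H.m_ac)
qed

text \<open>One direction of the duality with its natural isomorphism fixed. The theorem interprets
  it twice, the second time with the roles of \<open>T\<close> and \<open>U\<close>
  exchanged.\<close>

locale AGJ = T: preadditive_category T + U: preadditive_category U
  for u :: "'u itself" and T :: "('o, 'm, 'y) precat_scheme" and U :: "('p, 'n, 'z) precat_scheme"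
    and Q :: "('o, 'm, 'p, 'n) fctr" and D :: "('o, 'm, 'p, 'n) fctr" and \<Phi> +
  assumes Q: "is_fctr (opp T) U Q" and D: "is_fctr (opp (cpt u T)) (cpt u U) D"
    and \<Phi>_iso: "C \<in> compacts u T \<Longrightarrow> X \<in> Obj T \<Longrightarrow>
      \<Phi> C X \<in> iso (hom_group (homgrp T C X) QmodZ) (homgrp U (OM D C) (OM Q X))"
    and \<Phi>_natural: "C \<in> compacts u T \<Longrightarrow> C' \<in> compacts u T \<Longrightarrow> X \<in> Obj T \<Longrightarrow> X' \<in> Obj T \<Longrightarrow>
      c \<in> Hom T C C' \<Longrightarrow> a \<in> Hom T X X' \<Longrightarrow> \<phi> \<in> carrier (hom_group (homgrp T C X') QmodZ) \<Longrightarrow>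
      \<Phi> C' X (\<lambda>g \<in> Hom T C' X. \<phi> (a \<bullet>\<^bsub>T\<^esub> g \<bullet>\<^bsub>T\<^esub> c)) = AM Q a \<bullet>\<^bsub>U\<^esub> \<Phi> C X' \<phi> \<bullet>\<^bsub>U\<^esub> AM D c"
begin

lemma Q_Obj: "X \<in> Obj T \<Longrightarrow> OM Q X \<in> Obj U"
  using Q by (simp add: is_fctr_def)

lemma D_compact: "C \<in> compacts u T \<Longrightarrow> OM D C \<in> compacts u U"
  using D by (simp add: is_fctr_def cpt_def)

lemma D_Hom:
  assumes "c \<in> Hom T C C'" "C \<in> compacts u T" "C' \<in> compacts u T"
  shows "AM D c \<in> Hom U (OM D C') (OM D C)"
  using D HomD[OF assms(1)] assms(2,3) by (auto simp: is_fctr_def cpt_def Hom_full_sub)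

abbreviation dual :: "'o \<Rightarrow> 'o \<Rightarrow> ('m \<Rightarrow> rat set) monoid" where
  "dual C X \<equiv> hom_group (homgrp T C X) QmodZ"

text \<open>For c : C -> C' this is the Q/Z-dual of precomposition with \<open>c\<close>, from the
  dual of Hom(C, X) to that of Hom(C', X). Restricting the function puts it into the extensional
  carrier of \<open>hom_group\<close>.\<close>

definition restr :: "'m \<Rightarrow> 'o \<Rightarrow> ('m \<Rightarrow> rat set) \<Rightarrow> 'm \<Rightarrow> rat set" where
  "restr c X \<phi> = (\<lambda>g \<in> Hom T (Cod T c) X. \<phi> (g \<bullet>\<^bsub>T\<^esub> c))"

lemma dual_iff: "\<phi> \<in> carrier (dual C X) \<longleftrightarrow> \<phi> \<in> hom (homgrp T C X) QmodZ \<and> \<phi> \<in> extensional (Hom T C X)"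
  by (auto simp: hom_group_def)

lemma dual_eqI:
  assumes "\<phi> \<in> carrier (dual C X)" "\<psi> \<in> carrier (dual C X)" "\<And>g. g \<in> Hom T C X \<Longrightarrow> \<phi> g = \<psi> g"
  shows "\<phi> = \<psi>"
  using assms by (intro extensionalityI[of _ "Hom T C X"]) (auto simp: dual_iff)

lemma compact_Obj: "C \<in> compacts u T \<Longrightarrow> C \<in> Obj T"
  by (simp add: compacts_def)

lemma restr_dual:
  assumes c: "c \<in> Hom T C C'" and X: "X \<in> Obj T" and \<phi>: "\<phi> \<in> carrier (dual C X)"
  shows "restr c X \<phi> \<in> carrier (dual C' X)"
proof -
  have "\<phi> \<circ> (\<lambda>g. g \<bullet>\<^bsub>T\<^esub> c) \<in> hom (homgrp T C' X) QmodZ"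
    using T.precomp_hom[OF c X] \<phi> by (intro hom_compose) (auto simp: dual_iff)
  then have "restr c X \<phi> \<in> hom (homgrp T C' X) QmodZ"
    using group.hom_eq[of "homgrp T C' X" _ QmodZ "restr c X \<phi>"] T.hom_group[of C' X] T.Hom_Obj[OF c] X HomD[OF c]
    by (simp add: restr_def comm_group.axioms)
  then show ?thesis using HomD[OF c] by (simp add: dual_iff restr_def)
qed

text \<open>Naturality in the compact variable, extracted by taking the identity for the map in the
  other variable. It turns the dual of precomposition with \<open>c\<close> into precomposition with
  \<open>AM D c\<close>.\<close>

lemma \<Phi>_restr:
  assumes c: "c \<in> Hom T C C'" "C \<in> compacts u T" "C' \<in> compacts u T" and X: "X \<in> Obj T"
    and \<phi>: "\<phi> \<in> carrier (dual C X)"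
  shows "\<Phi> C' X (restr c X \<phi>) = \<Phi> C X \<phi> \<bullet>\<^bsub>U\<^esub> AM D c"
proof -
  have id: "Ident T X \<in> Hom T X X" using X by (rule T.ident)
  have \<Phi>: "\<Phi> C X \<phi> \<in> Hom U (OM D C) (OM Q X)"
    using \<Phi>_iso[OF c(2) X] \<phi> by (auto simp: iso_def hom_def)
  have "restr c X \<phi> = (\<lambda>g \<in> Hom T C' X. \<phi> (Ident T X \<bullet>\<^bsub>T\<^esub> g \<bullet>\<^bsub>T\<^esub> c))"
    using T.ident_comp[OF T.comp[OF c(1)]] HomD[OF c(1)] by (auto simp: restr_def intro!: restrict_ext)
  moreover have "AM Q (Ident T X) = Ident U (OM Q X)" using Q X by (simp add: is_fctr_def)
  ultimately show ?thesis
    using \<Phi>_natural[OF c(2,3) X X c(1) id \<phi>] U.ident_comp[OF U.comp[OF D_Hom[OF c] \<Phi>]] by simp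
qed

lemma \<Phi>_bij: "C \<in> compacts u T \<Longrightarrow> X \<in> Obj T \<Longrightarrow>
    bij_betw (\<Phi> C X) (carrier (dual C X)) (Hom U (OM D C) (OM Q X))"
  using \<Phi>_iso[of C X] by (simp add: iso_def)

lemma \<Phi>_Hom: "C \<in> compacts u T \<Longrightarrow> X \<in> Obj T \<Longrightarrow> \<phi> \<in> carrier (dual C X) \<Longrightarrow>
    \<Phi> C X \<phi> \<in> Hom U (OM D C) (OM Q X)"
  using \<Phi>_bij[of C X] by (rule bij_betw_apply)

lemma \<Phi>_mult: "C \<in> compacts u T \<Longrightarrow> X \<in> Obj T \<Longrightarrow> \<phi> \<in> carrier (dual C X) \<Longrightarrow> \<psi> \<in> carrier (dual C X) \<Longrightarrow>
    \<Phi> C X (\<phi> \<otimes>\<^bsub>dual C X\<^esub> \<psi>) = Add U (\<Phi> C X \<phi>) (\<Phi> C X \<psi>)"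
  using hom_mult[OF iso_imp_homomorphism[OF \<Phi>_iso[of C X]], of \<phi> \<psi>] by simp

lemma one_dual:
  assumes "C \<in> Obj T" "X \<in> Obj T"
  shows "\<one>\<^bsub>dual C X\<^esub> \<in> carrier (dual C X)"
proof -
  interpret E: comm_group QmodZ by (rule comm_group_QmodZ)
  show ?thesis
    using T.add_closed by (auto simp: hom_group_def hom_def)
qed

lemma \<Phi>_one:
  assumes "C \<in> compacts u T" "X \<in> Obj T"
  shows "\<Phi> C X \<one>\<^bsub>dual C X\<^esub> = Zero U (OM D C) (OM Q X)"
proof (rule U.add_idem_zero)
  interpret E: comm_group QmodZ by (rule comm_group_QmodZ)
  have one: "\<one>\<^bsub>dual C X\<^esub> \<in> carrier (dual C X)" using one_dual assms compact_Obj by blast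
  show "\<Phi> C X \<one>\<^bsub>dual C X\<^esub> \<in> Hom U (OM D C) (OM Q X)" by (rule \<Phi>_Hom[OF assms one])
  have "\<one>\<^bsub>dual C X\<^esub> \<otimes>\<^bsub>dual C X\<^esub> \<one>\<^bsub>dual C X\<^esub> = \<one>\<^bsub>dual C X\<^esub>"
    by (auto simp: hom_group_def intro!: restrict_ext)
  then show "Add U (\<Phi> C X \<one>\<^bsub>dual C X\<^esub>) (\<Phi> C X \<one>\<^bsub>dual C X\<^esub>) = \<Phi> C X \<one>\<^bsub>dual C X\<^esub>"
    using \<Phi>_mult[OF assms one one] by simp
qed

lemma \<Phi>_zero_iff:
  assumes "C \<in> compacts u T" "X \<in> Obj T" "\<phi> \<in> carrier (dual C X)"
  shows "\<Phi> C X \<phi> = Zero U (OM D C) (OM Q X) \<longleftrightarrow> (\<forall>g \<in> Hom T C X. \<phi> g = \<one>\<^bsub>QmodZ\<^esub>)"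
proof -
  have one: "\<one>\<^bsub>dual C X\<^esub> \<in> carrier (dual C X)" using one_dual assms compact_Obj by blast
  have "\<Phi> C X \<phi> = Zero U (OM D C) (OM Q X) \<longleftrightarrow> \<phi> = \<one>\<^bsub>dual C X\<^esub>"
    using inj_onD[OF bij_betw_imp_inj_on[OF \<Phi>_bij[OF assms(1,2)]] _ assms(3) one] \<Phi>_one[OF assms(1,2)]
    by auto
  also have "\<dots> \<longleftrightarrow> (\<forall>g \<in> Hom T C X. \<phi> g = \<one>\<^bsub>QmodZ\<^esub>)"
    using dual_eqI[OF assms(3) one] by (auto simp: hom_group_def)
  finally show ?thesis .
qed

lemma restrict_dual:
  assumes "C \<in> Obj T" "X \<in> Obj T" "\<phi> \<in> hom (homgrp T C X) QmodZ"
  shows "restrict \<phi> (Hom T C X) \<in> carrier (dual C X)"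
  using group.hom_eq[OF _ assms(3), of "restrict \<phi> (Hom T C X)"] T.hom_group[OF assms(1,2)]
  by (simp add: dual_iff comm_group.axioms)

text \<open>Surjectivity of Hom(f, X) is injectivity of its Q/Z-dual, and \<open>\<Phi>\<close>
  carries this dual to precomposition with D f on maps D A -> Q X.\<close>

lemma injective_iff_dual_separated:
  assumes f: "f \<in> Hom T A B" "A \<in> compacts u T" "B \<in> compacts u T" and X: "X \<in> Obj T"
  shows "injective_wrt T f X \<longleftrightarrow> separated_wrt U (AM D f) (OM Q X)"
proof -
  note Obj = compact_Obj[OF f(2)] compact_Obj[OF f(3)]
  note Df = D_Hom[OF f]
  have "injective_wrt T f X \<longleftrightarrow> (\<lambda>g. g \<bullet>\<^bsub>T\<^esub> f) ` carrier (homgrp T B X) = carrier (homgrp T A X)"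
    using HomD[OF f(1)] by (simp add: injective_wrt_def factoring_def)
  also have "\<dots> \<longleftrightarrow> (\<forall>\<phi> \<in> hom (homgrp T A X) QmodZ.
      (\<forall>g \<in> Hom T B X. \<phi> (g \<bullet>\<^bsub>T\<^esub> f) = \<one>\<^bsub>QmodZ\<^esub>) \<longrightarrow> (\<forall>g \<in> Hom T A X. \<phi> g = \<one>\<^bsub>QmodZ\<^esub>))"
    using QmodZ_dual_inj_iff_surj[OF T.hom_group T.hom_group T.precomp_hom[OF f(1) X]] Obj X by simp
  also have "\<dots> \<longleftrightarrow> (\<forall>\<phi> \<in> carrier (dual A X).
      (\<forall>g \<in> Hom T B X. \<phi> (g \<bullet>\<^bsub>T\<^esub> f) = \<one>\<^bsub>QmodZ\<^esub>) \<longrightarrow> (\<forall>g \<in> Hom T A X. \<phi> g = \<one>\<^bsub>QmodZ\<^esub>))"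
    (is "?l \<longleftrightarrow> ?r")
  proof
    show ?r if ?l using that by (auto simp: dual_iff)
    show ?l if r: ?r
    proof (intro ballI impI)
      fix \<phi> g assume \<phi>: "\<phi> \<in> hom (homgrp T A X) QmodZ"
        and z: "\<forall>g \<in> Hom T B X. \<phi> (g \<bullet>\<^bsub>T\<^esub> f) = \<one>\<^bsub>QmodZ\<^esub>" and g: "g \<in> Hom T A X"
      have "\<forall>g \<in> Hom T B X. restrict \<phi> (Hom T A X) (g \<bullet>\<^bsub>T\<^esub> f) = \<one>\<^bsub>QmodZ\<^esub>"
        using z T.comp[OF f(1)] by simp
      then have "\<forall>g \<in> Hom T A X. restrict \<phi> (Hom T A X) g = \<one>\<^bsub>QmodZ\<^esub>"
        using r restrict_dual[OF Obj(1) X \<phi>] by blast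
      then show "\<phi> g = \<one>\<^bsub>QmodZ\<^esub>" using g by simp
    qed
  qed
  also have "\<dots> \<longleftrightarrow> (\<forall>\<phi> \<in> carrier (dual A X). \<Phi> A X \<phi> \<bullet>\<^bsub>U\<^esub> AM D f = Zero U (OM D B) (OM Q X) \<longrightarrow>
      \<Phi> A X \<phi> = Zero U (OM D A) (OM Q X))"
  proof -
    have "(\<forall>g \<in> Hom T B X. \<phi> (g \<bullet>\<^bsub>T\<^esub> f) = \<one>\<^bsub>QmodZ\<^esub>) \<longleftrightarrow>
        \<Phi> A X \<phi> \<bullet>\<^bsub>U\<^esub> AM D f = Zero U (OM D B) (OM Q X)" if "\<phi> \<in> carrier (dual A X)" for \<phi>
      using \<Phi>_zero_iff[OF f(3) X restr_dual[OF f(1) X that]] \<Phi>_restr[OF f X that] HomD[OF f(1)]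
      by (simp add: restr_def)
    then show ?thesis using \<Phi>_zero_iff[OF f(2) X] by simp
  qed
  also have "\<dots> \<longleftrightarrow> (\<forall>y \<in> \<Phi> A X ` carrier (dual A X). y \<bullet>\<^bsub>U\<^esub> AM D f = Zero U (OM D B) (OM Q X) \<longrightarrow>
      y = Zero U (OM D A) (OM Q X))" by blast
  also have "\<dots> \<longleftrightarrow> separated_wrt U (AM D f) (OM Q X)"
    using bij_betw_imp_surj_on[OF \<Phi>_bij[OF f(2) X]] HomD[OF Df] by (simp add: separated_wrt_def)
  finally show ?thesis .
qed

text \<open>Injectivity of Hom(f, X) is surjectivity of its Q/Z-dual; through \<open>\<Phi>\<close>
  this says that every map D B -> Q X extends along D f : D B -> D A.\<close>

lemma separated_iff_dual_injective:
  assumes f: "f \<in> Hom T A B" "A \<in> compacts u T" "B \<in> compacts u T" and X: "X \<in> Obj T"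
  shows "separated_wrt T f X \<longleftrightarrow> injective_wrt U (AM D f) (OM Q X)"
proof -
  note Obj = compact_Obj[OF f(2)] compact_Obj[OF f(3)]
  note Df = D_Hom[OF f]
  have "separated_wrt T f X \<longleftrightarrow> inj_on (\<lambda>g. g \<bullet>\<^bsub>T\<^esub> f) (carrier (homgrp T B X))"
    using T.separated_wrt_iff_inj[OF f(1) X] by simp
  also have "\<dots> \<longleftrightarrow> (\<forall>\<phi> \<in> hom (homgrp T B X) QmodZ. \<exists>\<psi> \<in> hom (homgrp T A X) QmodZ.
      \<forall>g \<in> Hom T B X. \<psi> (g \<bullet>\<^bsub>T\<^esub> f) = \<phi> g)"
    using QmodZ_dual_surj_iff_inj[OF T.hom_group T.hom_group T.precomp_hom[OF f(1) X]] Obj X by simp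
  also have "\<dots> \<longleftrightarrow> (\<forall>\<phi> \<in> carrier (dual B X). \<exists>\<psi> \<in> carrier (dual A X). restr f X \<psi> = \<phi>)"
    (is "?l \<longleftrightarrow> ?r")
  proof
    assume l: ?l
    show ?r
    proof
      fix \<phi> assume \<phi>: "\<phi> \<in> carrier (dual B X)"
      then obtain \<psi> where \<psi>: "\<psi> \<in> hom (homgrp T A X) QmodZ" "\<forall>g \<in> Hom T B X. \<psi> (g \<bullet>\<^bsub>T\<^esub> f) = \<phi> g"
        using l by (auto simp: dual_iff)
      note r = restrict_dual[OF Obj(1) X \<psi>(1)]
      have "restr f X (restrict \<psi> (Hom T A X)) = \<phi>"
        using \<psi>(2) T.comp[OF f(1)] HomD[OF f(1)]
        by (intro dual_eqI[OF restr_dual[OF f(1) X r] \<phi>]) (simp add: restr_def)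
      then show "\<exists>\<psi> \<in> carrier (dual A X). restr f X \<psi> = \<phi>" using r by blast
    qed
  next
    assume r: ?r
    show ?l
    proof
      fix \<phi> assume "\<phi> \<in> hom (homgrp T B X) QmodZ"
      then obtain \<psi> where \<psi>: "\<psi> \<in> carrier (dual A X)" "restr f X \<psi> = restrict \<phi> (Hom T B X)"
        using r restrict_dual[OF Obj(2) X] by blast
      have "\<psi> (g \<bullet>\<^bsub>T\<^esub> f) = \<phi> g" if "g \<in> Hom T B X" for g
        using fun_cong[OF \<psi>(2), of g] that HomD[OF f(1)] by (simp add: restr_def)
      then show "\<exists>\<psi> \<in> hom (homgrp T A X) QmodZ. \<forall>g \<in> Hom T B X. \<psi> (g \<bullet>\<^bsub>T\<^esub> f) = \<phi> g"
        using \<psi>(1) by (auto simp: dual_iff)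
    qed
  qed
  also have "\<dots> \<longleftrightarrow> (\<forall>\<phi> \<in> carrier (dual B X). \<exists>\<psi> \<in> carrier (dual A X). \<Phi> B X \<phi> = \<Phi> A X \<psi> \<bullet>\<^bsub>U\<^esub> AM D f)"
  proof -
    have "restr f X \<psi> = \<phi> \<longleftrightarrow> \<Phi> B X \<phi> = \<Phi> A X \<psi> \<bullet>\<^bsub>U\<^esub> AM D f"
      if "\<phi> \<in> carrier (dual B X)" "\<psi> \<in> carrier (dual A X)" for \<phi> \<psi>
      using inj_onD[OF bij_betw_imp_inj_on[OF \<Phi>_bij[OF f(3) X]] _ restr_dual[OF f(1) X that(2)] that(1)]
        \<Phi>_restr[OF f X that(2)] by auto
    then show ?thesis by simp
  qed
  also have "\<dots> \<longleftrightarrow> (\<forall>x \<in> \<Phi> B X ` carrier (dual B X). \<exists>z \<in> \<Phi> A X ` carrier (dual A X). x = z \<bullet>\<^bsub>U\<^esub> AM D f)"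
    by blast
  also have "\<dots> \<longleftrightarrow> (\<forall>x \<in> Hom U (OM D B) (OM Q X). \<exists>z \<in> Hom U (OM D A) (OM Q X). x = z \<bullet>\<^bsub>U\<^esub> AM D f)"
    by (simp only: bij_betw_imp_surj_on[OF \<Phi>_bij[OF f(2) X]] bij_betw_imp_surj_on[OF \<Phi>_bij[OF f(3) X]])
  also have "\<dots> \<longleftrightarrow> injective_wrt U (AM D f) (OM Q X)"
    using U.injective_wrtI[OF Df] U.injective_wrtD[OF _ Df] by metis
  finally show ?thesis .
qed

text \<open>Additivity of \<open>D\<close> is not part of the definition of an AGJ duality triple. For \<open>y\<close> one can take
  the map \<open>i\<close> on \<open>D C\<close>: as a pure monomorphism it detects maps out of compact objects.\<close>

lemma D_additive:
  assumes c: "c \<in> Hom T C C'" "C \<in> compacts u T" "C' \<in> compacts u T" and c': "c' \<in> Hom T C C'"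
    and X: "X \<in> Obj T" and y: "y \<in> Hom U (OM D C) (OM Q X)"
    and inj: "inj_on (\<lambda>g. y \<bullet>\<^bsub>U\<^esub> g) (Hom U (OM D C') (OM D C))"
  shows "AM D (Add T c c') = Add U (AM D c) (AM D c')"
proof -
  note s = T.add_closed[OF c(1) c']
  note Dc = D_Hom[OF c] and Dc' = D_Hom[OF c' c(2,3)] and Ds = D_Hom[OF s c(2,3)]
  obtain \<phi> where \<phi>: "\<phi> \<in> carrier (dual C X)" "y = \<Phi> C X \<phi>"
    using bij_betw_imp_surj_on[OF \<Phi>_bij[OF c(2) X]] y by blast
  \<comment> \<open>Additivity of \<open>\<phi>\<close> makes restriction along a sum the sum of the
    restrictions. Transported by \<open>\<Phi>\<close>, this is the desired equation composed with
    \<open>y\<close>, which \<open>inj\<close> cancels.\<close>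
  have "restr (Add T c c') X \<phi> = restr c X \<phi> \<otimes>\<^bsub>dual C' X\<^esub> restr c' X \<phi>"
  proof (rule dual_eqI)
    show "restr (Add T c c') X \<phi> \<in> carrier (dual C' X)" by (rule restr_dual[OF s X \<phi>(1)])
    show "restr c X \<phi> \<otimes>\<^bsub>dual C' X\<^esub> restr c' X \<phi> \<in> carrier (dual C' X)"
      using T.hom_group[of C' X] X compact_Obj[OF c(3)]
      by (intro hom_group_mult_closed comm_group_QmodZ restr_dual[OF c(1) X \<phi>(1)] restr_dual[OF c' X \<phi>(1)]) blast
    show "restr (Add T c c') X \<phi> g = (restr c X \<phi> \<otimes>\<^bsub>dual C' X\<^esub> restr c' X \<phi>) g" if g: "g \<in> Hom T C' X" for g
      using hom_mult[of \<phi> "homgrp T C X" QmodZ "g \<bullet>\<^bsub>T\<^esub> c" "g \<bullet>\<^bsub>T\<^esub> c'"] \<phi>(1) T.comp[OF c(1) g] T.comp[OF c' g]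
        T.comp_add_right[OF c(1) c' g] g HomD[OF s] HomD[OF c(1)] HomD[OF c']
      by (simp add: dual_iff restr_def) (simp add: hom_group_def)
  qed
  then have "y \<bullet>\<^bsub>U\<^esub> AM D (Add T c c') = Add U (y \<bullet>\<^bsub>U\<^esub> AM D c) (y \<bullet>\<^bsub>U\<^esub> AM D c')"
    using \<Phi>_restr[OF s c(2,3) X \<phi>(1)] \<Phi>_restr[OF c X \<phi>(1)] \<Phi>_restr[OF c' c(2,3) X \<phi>(1)]
      \<Phi>_mult[OF c(3) X restr_dual[OF c(1) X \<phi>(1)] restr_dual[OF c' X \<phi>(1)]] \<phi>(2) by simp
  also have "\<dots> = y \<bullet>\<^bsub>U\<^esub> Add U (AM D c) (AM D c')"
    using U.comp_add_right[OF Dc Dc' y] by simp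
  finally show ?thesis by (rule inj_onD[OF inj _ Ds U.add_closed[OF Dc Dc']])
qed

end

section \<open>The dual definable category\<close>

lemma pure_mono_inj:
  assumes "pure_mono u T f" "f \<in> Hom T A B" "K \<in> compacts u T"
  shows "inj_on (\<lambda>g. f \<bullet>\<^bsub>T\<^esub> g) (Hom T K A)"
  using assms HomD[OF assms(2)]
  by (auto simp: pure_mono_def is_short_exact_def yoneda_map_def yoneda_def hom_fun_def cpt_def)

text \<open>By exactness of Hom(\<Sigma> X, W) -> Hom(Z, W) -> Hom(Y, W) -> Hom(X, W), the kernel of
  Hom(f, W) is isomorphic to the cokernel of Hom(h, W).\<close>

lemma (in triangulated_category) triangle_separated_iff:
  assumes tri: "(f, g, h) \<in> Tri T" and f: "f \<in> Hom T X Y" and g: "g \<in> Hom T Y Z"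
    and h: "h \<in> Hom T Z (ShO T X)" and W: "W \<in> Obj T"
  shows "separated_wrt T f W \<longleftrightarrow> injective_wrt T h W"
proof
  note rot = triangle_rotate[OF tri f g h]
  have gf: "g \<bullet> f = Zero T X Z" by (rule triangle_comp_zero[OF tri f g])
  have hg: "h \<bullet> g = Zero T Y (ShO T X)" by (rule triangle_comp_zero[OF rot g h])
  have Obj: "X \<in> Obj T" "Y \<in> Obj T" using Hom_Obj[OF f] by auto
  show "injective_wrt T h W" if sep: "separated_wrt T f W"
  proof (rule injective_wrtI[OF h])
    fix x assume x: "x \<in> Hom T Z W"
    have "(x \<bullet> g) \<bullet> f = Zero T X W"
      using comp_assoc[OF f g x] gf comp_zero[OF x Obj(1)] by simp
    then have "x \<bullet> g = Zero T Y W"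
      using sep comp[OF g x] HomD[OF f] by (simp add: separated_wrt_def)
    then show "\<exists>z \<in> Hom T (ShO T X) W. x = z \<bullet> h"
      using triangle_extend[OF rot g h x] by metis
  qed
  show "separated_wrt T f W" if inj: "injective_wrt T h W"
    unfolding separated_wrt_def HomD(2,3)[OF f]
  proof (intro ballI impI)
    fix y assume y: "y \<in> Hom T Y W" "y \<bullet> f = Zero T X W"
    obtain x where x: "x \<in> Hom T Z W" "x \<bullet> g = y"
      using triangle_extend[OF tri f g y] by blast
    obtain z where z: "z \<in> Hom T (ShO T X) W" "x = z \<bullet> h"
      using injective_wrtD[OF inj h x(1)] by blast
    show "y = Zero T Y W"
      using x(2) z(2) comp_assoc[OF g h z(1)] hg comp_zero[OF z(1) Obj(2)] by simp
  qed
qed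

text \<open>One map \<open>h\<close>, chosen before \<open>G\<close>, has to serve twice: its
  injective objects are the separated objects of D f, and it presents the dual of every functor
  presented by \<open>f\<close>. The connecting map of the triangle on D f does both.\<close>

lemma delta_presented_by_cone:
  fixes T :: "('o, 'm, 'y) precat_scheme" and U :: "('p, 'n, 'z) tricat_scheme"
  assumes "triangulated_category U" and "compact_duality TYPE('u) T U DU"
    and "equivalence (cpt TYPE('u) T) (opp (cpt TYPE('u) U)) DT DU \<eta> \<epsilon>"
    and f: "f \<in> Arr (cpt TYPE('u) T)"
  obtains h where "h \<in> Arr (cpt TYPE('u) U)"
    "\<And>Y. Y \<in> Obj U \<Longrightarrow> separated_wrt U (AM DT f) Y \<longleftrightarrow> injective_wrt U h Y"
    "\<And>G :: ('o, 'm, 'g) abfun. is_abfun (cpt TYPE('u) T) G \<Longrightarrow> presents (cpt TYPE('u) T) f G \<Longrightarrow>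
      presents (cpt TYPE('u) U) h (delta TYPE('u) T DU G)"
proof -
  interpret U: triangulated_category U by fact
  interpret d: compact_duality "TYPE('u)" T U DU by fact
  let ?C = "cpt TYPE('u) T" and ?E = "cpt TYPE('u) U"
  interpret eq: equivalence ?C "opp ?E" DT DU \<eta> \<epsilon> by fact
  define A B where AB: "A = Dom T f" "B = Cod T f"
  have fH: "f \<in> Hom ?C A B" using f by (simp add: Hom_def AB)
  have Obj: "A \<in> compacts TYPE('u) T" "B \<in> compacts TYPE('u) T"
    using d.C.Hom_Obj[OF fH] by simp_all
  have unit: "\<eta> K \<in> Hom ?C K (OM DU (OM DT K))" if "K \<in> compacts TYPE('u) T" for K
    using eq.unit_Hom[of K] that by simp
  let ?X = "OM DT B" and ?Y = "OM DT A" and ?Df = "AM DT f"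
  have DObj: "?X \<in> compacts TYPE('u) U" "?Y \<in> compacts TYPE('u) U"
    using eq.F_Obj[of A] eq.F_Obj[of B] Obj by simp_all
  have DfE: "?Df \<in> Hom ?E ?X ?Y" using eq.F_Hom[OF fH] by simp
  have Hom_E: "v \<in> Hom ?E K L \<longleftrightarrow> v \<in> Hom U K L \<and> K \<in> compacts TYPE('u) U \<and> L \<in> compacts TYPE('u) U" for v K L
    by (simp add: cpt_def Hom_full_sub)
  have Df: "?Df \<in> Hom U ?X ?Y" using DfE by (simp add: Hom_E)
  obtain m h where tri: "(?Df, m, h) \<in> Tri U" using U.TR1_cone HomD(1)[OF Df] by blast
  then obtain M where m: "m \<in> Hom U ?Y M" and h: "h \<in> Hom U M (ShO U ?X)"
    using U.triangle_maps[OF tri] HomD[OF Df] by (auto simp: HomD)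
  note rot = U.triangle_rotate[OF tri Df m h]
  \<comment> \<open>Both ends of \<open>h\<close> must be compact for \<open>h\<close> to present a
    functor on the compacts of \<open>U\<close>.\<close>
  have SX: "ShO U ?X \<in> compacts TYPE('u) U" by (rule U.compacts_shift[OF DObj(1)])
  have M: "M \<in> compacts TYPE('u) U" by (rule U.compacts_coneI[OF tri Df m h DObj(2) SX])
  have mE: "m \<in> Hom ?E ?Y M" and hE: "h \<in> Hom ?E M (ShO U ?X)" using m h DObj SX M by (simp_all add: Hom_E)
  have "presents ?E h (delta TYPE('u) T DU G)"
    if abfun: "is_abfun ?C G" and pres: "presents ?C f G" for G :: "('o, 'm, 'g) abfun"
  proof -
    interpret G: dual_functor "TYPE('u)" T U DU G
      using abfun by unfold_locales
    obtain \<xi> where \<xi>: "universal_element ?C f G \<xi>" using G.G.presents_imp_universal_element[OF pres] by blast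
    obtain a where a: "a \<in> Hom ?C (OM DU ?Y) A" "a \<bullet>\<^bsub>T\<^esub> \<eta> A = Ident T A" "\<eta> A \<bullet>\<^bsub>T\<^esub> a = Ident T (OM DU ?Y)"
      using isomorphismE[OF eq.unit_isomorphism unit, of A] Obj by auto
    obtain b where b: "b \<in> Hom ?C (OM DU ?X) B" "b \<bullet>\<^bsub>T\<^esub> \<eta> B = Ident T B"
      using isomorphismE[OF eq.unit_isomorphism unit, of B] Obj by auto
    have unit_nat: "AM DU ?Df \<bullet>\<^bsub>T\<^esub> \<eta> A = \<eta> B \<bullet>\<^bsub>T\<^esub> f" using eq.unit_natural[OF fH] by simp
    note Dm = d.D_Hom[OF mE] and DDf = d.D_Hom[OF DfE]
    \<comment> \<open>Naturality of the unit, rewritten in terms of the inverses \<open>a\<close>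
      and \<open>b\<close> of its components.\<close>
    have fa: "f \<bullet>\<^bsub>T\<^esub> a = b \<bullet>\<^bsub>T\<^esub> AM DU ?Df"
    proof -
      have "f \<bullet>\<^bsub>T\<^esub> a = b \<bullet>\<^bsub>T\<^esub> ((\<eta> B \<bullet>\<^bsub>T\<^esub> f) \<bullet>\<^bsub>T\<^esub> a)"
        using d.C.comp_assoc[OF a(1) fH unit[OF Obj(2)]] d.C.ident_comp[OF d.C.comp[OF a(1) fH]] b(2)
          d.C.comp_assoc[OF d.C.comp[OF a(1) fH] unit[OF Obj(2)] b(1)] by simp
      also have "\<dots> = b \<bullet>\<^bsub>T\<^esub> AM DU ?Df"
        using unit_nat d.C.comp_assoc[OF a(1) unit[OF Obj(1)] DDf] a(3) d.C.comp_ident[OF DDf] by simp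
      finally show ?thesis .
    qed
    \<comment> \<open>Up to the inverse unit this is the image of the cone map \<open>m\<close>
      under \<open>DU\<close>. The claim is that maps from objects \<open>OM DU Y\<close> to
      \<open>A\<close> killed by \<open>f\<close> are exactly those obtained from it by
      precomposition.\<close>
    let ?g0 = "a \<bullet>\<^bsub>T\<^esub> AM DU m"
    have g0: "?g0 \<in> Hom ?C (OM DU M) A" using d.C.comp[OF Dm a(1)] by simp
    show ?thesis
    proof (rule G.delta_presented[OF fH \<xi> hE g0])
      have "AM DU ?Df \<bullet>\<^bsub>T\<^esub> AM DU m = Zero T (OM DU M) (OM DU ?X)"
        using d.D_comp[OF DfE mE] U.triangle_comp_zero[OF tri Df m] d.D_zero[OF DObj(1) M] by simp
      then show "f \<bullet>\<^bsub>T\<^esub> ?g0 = Zero T (OM DU M) B"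
        using d.C.comp_assoc[OF Dm a(1) fH] fa d.C.comp_assoc[OF Dm DDf b(1)]
          d.C.comp_zero[OF b(1), of "OM DU M"] d.D_Obj[OF M] by simp
    next
      fix Y g assume Y: "Y \<in> compacts TYPE('u) U" and g: "g \<in> Hom ?C (OM DU Y) A"
        and fg: "f \<bullet>\<^bsub>T\<^esub> g = Zero T (OM DU Y) B"
      \<comment> \<open>Fullness in the opposite category turns \<open>g\<close> into a map
        \<open>y\<close> from D A to \<open>Y\<close>. Faithfulness translates f g = 0 into the
        vanishing of \<open>y\<close> on D f, so \<open>y\<close> extends over the cone to the
        required \<open>v\<close>.\<close>
      have "\<eta> A \<bullet>\<^bsub>T\<^esub> g \<in> Hom ?C (OM DU Y) (OM DU ?Y)" using d.C.comp[OF g unit[OF Obj(1)]] by simp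
      then obtain y where y: "y \<in> Hom ?E ?Y Y" "AM DU y = \<eta> A \<bullet>\<^bsub>T\<^esub> g"
        using eq.G_full[of Y ?Y] Y DObj by auto
      have yU: "y \<in> Hom U ?Y Y" using y(1) by (simp add: Hom_E)
      have yDf: "y \<bullet>\<^bsub>U\<^esub> ?Df \<in> Hom ?E ?X Y" using d.E.comp[OF DfE y(1)] by simp
      have zE: "Zero U ?X Y \<in> Hom ?E ?X Y" using d.E.zero_closed[of ?X Y] DObj Y by simp
      have "AM DU (y \<bullet>\<^bsub>U\<^esub> ?Df) = AM DU ?Df \<bullet>\<^bsub>T\<^esub> (\<eta> A \<bullet>\<^bsub>T\<^esub> g)"
        using d.D_comp[OF DfE y(1)] y(2) by simp
      also have "\<dots> = \<eta> B \<bullet>\<^bsub>T\<^esub> (f \<bullet>\<^bsub>T\<^esub> g)"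
        using d.C.comp_assoc[OF g unit[OF Obj(1)] DDf] d.C.comp_assoc[OF g fH unit[OF Obj(2)]] unit_nat by simp
      also have "\<dots> = AM DU (Zero U ?X Y)"
        using fg d.C.comp_zero[OF unit[OF Obj(2)], of "OM DU Y"] d.D_Obj[OF Y] d.D_zero[OF DObj(1) Y] by simp
      finally have "y \<bullet>\<^bsub>U\<^esub> ?Df = Zero U ?X Y"
        using eq.G_faithful[of "y \<bullet>\<^bsub>U\<^esub> ?Df" Y ?X "Zero U ?X Y"] yDf zE by simp
      then obtain v where v: "v \<in> Hom U M Y" "v \<bullet>\<^bsub>U\<^esub> m = y"
        using U.triangle_extend[OF tri Df m yU] by blast
      have vE: "v \<in> Hom ?E M Y" using v(1) M Y by (simp add: Hom_E)
      have "g = a \<bullet>\<^bsub>T\<^esub> (\<eta> A \<bullet>\<^bsub>T\<^esub> g)"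
        using d.C.comp_assoc[OF g unit[OF Obj(1)] a(1)] a(2) d.C.ident_comp[OF g] by simp
      also have "\<dots> = ?g0 \<bullet>\<^bsub>T\<^esub> AM DU v"
        using y(2) d.D_comp[OF mE vE] v(2) d.C.comp_assoc[OF d.D_Hom[OF vE] Dm a(1)] by simp
      finally show "\<exists>v \<in> Hom ?E M Y. g = ?g0 \<bullet>\<^bsub>T\<^esub> AM DU v" using vE by blast
    next
      fix Y v assume vE: "v \<in> Hom ?E M Y"
      then have v: "v \<in> Hom U M Y" and Y: "Y \<in> compacts TYPE('u) U" by (simp_all add: Hom_E)
      have vm: "v \<bullet>\<^bsub>U\<^esub> m \<in> Hom ?E ?Y Y" using d.E.comp[OF mE vE] by simp
      have zE: "Zero U ?Y Y \<in> Hom ?E ?Y Y" using d.E.zero_closed[of ?Y Y] DObj Y by simp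
      note Dv = d.D_Hom[OF vE] and Dvm = d.D_Hom[OF vm]
      have eq1: "?g0 \<bullet>\<^bsub>T\<^esub> AM DU v = a \<bullet>\<^bsub>T\<^esub> AM DU (v \<bullet>\<^bsub>U\<^esub> m)"
        using d.D_comp[OF mE vE] d.C.comp_assoc[OF Dv Dm a(1)] by simp
      \<comment> \<open>\<open>a\<close> is invertible and \<open>DU\<close> is faithful, so the
        vanishing amounts to v m = 0; exactness of the rotated triangle turns this into a
        factorization of \<open>v\<close> through \<open>h\<close>.\<close>
      have "?g0 \<bullet>\<^bsub>T\<^esub> AM DU v = Zero T (OM DU Y) A \<longleftrightarrow> AM DU (v \<bullet>\<^bsub>U\<^esub> m) = Zero T (OM DU Y) (OM DU ?Y)"
      proof
        assume z: "?g0 \<bullet>\<^bsub>T\<^esub> AM DU v = Zero T (OM DU Y) A"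
        have "AM DU (v \<bullet>\<^bsub>U\<^esub> m) = \<eta> A \<bullet>\<^bsub>T\<^esub> (a \<bullet>\<^bsub>T\<^esub> AM DU (v \<bullet>\<^bsub>U\<^esub> m))"
          using d.C.comp_assoc[OF Dvm a(1) unit[OF Obj(1)]] a(3) d.C.ident_comp[OF Dvm] by simp
        then show "AM DU (v \<bullet>\<^bsub>U\<^esub> m) = Zero T (OM DU Y) (OM DU ?Y)"
          using eq1 z d.C.comp_zero[OF unit[OF Obj(1)], of "OM DU Y"] d.D_Obj[OF Y] by simp
      next
        assume "AM DU (v \<bullet>\<^bsub>U\<^esub> m) = Zero T (OM DU Y) (OM DU ?Y)"
        then show "?g0 \<bullet>\<^bsub>T\<^esub> AM DU v = Zero T (OM DU Y) A"
          using eq1 d.C.comp_zero[OF a(1), of "OM DU Y"] d.D_Obj[OF Y] by simp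
      qed
      also have "\<dots> \<longleftrightarrow> v \<bullet>\<^bsub>U\<^esub> m = Zero U ?Y Y"
        using eq.G_faithful[of "v \<bullet>\<^bsub>U\<^esub> m" Y ?Y "Zero U ?Y Y"] vm zE d.D_zero[OF DObj(2) Y] by auto
      also have "\<dots> \<longleftrightarrow> v \<in> factoring ?E h Y"
      proof
        assume "v \<bullet>\<^bsub>U\<^esub> m = Zero U ?Y Y"
        then obtain z where z: "z \<in> Hom U (ShO U ?X) Y" "z \<bullet>\<^bsub>U\<^esub> h = v"
          using U.triangle_extend[OF rot m h v] by blast
        then have "z \<in> Hom ?E (ShO U ?X) Y" using SX Y by (simp add: Hom_E)
        then show "v \<in> factoring ?E h Y" using z(2) HomD[OF h] by (auto simp: factoring_def)
      next
        assume "v \<in> factoring ?E h Y"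
        then obtain z where z: "z \<in> Hom U (ShO U ?X) Y" "v = z \<bullet>\<^bsub>U\<^esub> h"
          using HomD[OF h] by (auto simp: factoring_def Hom_E)
        show "v \<bullet>\<^bsub>U\<^esub> m = Zero U ?Y Y"
          using z(2) U.comp_assoc[OF m h z(1)] U.triangle_comp_zero[OF rot m h]
            U.comp_zero[OF z(1)] U.Hom_Obj[OF m] by simp
      qed
      finally show "?g0 \<bullet>\<^bsub>T\<^esub> AM DU v = Zero T (OM DU Y) A \<longleftrightarrow> v \<in> factoring ?E h Y" .
    qed
  qed
  then show ?thesis
    using that[of h] HomD(1)[OF hE] U.triangle_separated_iff[OF tri Df m h] by blast
qed

lemma duality_triple_D_additive:
  fixes T :: "('o, 'm) tricat" and U :: "('p, 'n) tricat"
  assumes dt: "duality_triple TYPE('u) T U QT QU"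
    and agj: "AGJ TYPE('u) U T QU DU \<Phi>"
    and v: "v \<in> Hom (cpt TYPE('u) U) Y Y'" and w: "w \<in> Hom (cpt TYPE('u) U) Y Y'"
  shows "AM DU (Add U v w) = Add T (AM DU v) (AM DU w)"
proof -
  interpret agj: AGJ "TYPE('u)" U T QU DU \<Phi> by fact
  obtain iT where iT: "is_nat T T id_fctr (comp_fctr QU QT) iT" "\<forall>X \<in> Obj T. pure_mono TYPE('u) T (iT X)"
    using dt unfolding duality_triple_def by blast
  have QT: "is_fctr (opp T) U QT"
    using dt by (simp add: duality_triple_def is_contra_exact_def is_additive_fctr_def)
  have H: "v \<in> Hom U Y Y'" "w \<in> Hom U Y Y'" "Y \<in> compacts TYPE('u) U" "Y' \<in> compacts TYPE('u) U"
    using v w by (simp_all add: cpt_def Hom_full_sub)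
  let ?K = "OM DU Y"
  have K: "?K \<in> Obj T" "OM DU Y' \<in> compacts TYPE('u) T"
    using agj.D_compact[OF H(3)] agj.D_compact[OF H(4)] by (simp_all add: compacts_def)
  \<comment> \<open>This map has the shape D C -> Q X required by \<open>D_additive\<close>, with
    \<open>OM QT ?K\<close> for X; purity makes it cancellable against maps out of the compact
    object \<open>OM DU Y'\<close>.\<close>
  have i: "iT ?K \<in> Hom T ?K (OM QU (OM QT ?K))"
    using iT(1) K(1) by (simp add: is_nat_def id_fctr_def comp_fctr_def)
  have QK: "OM QT ?K \<in> Obj U" using QT K(1) by (simp add: is_fctr_def)
  show ?thesis
    by (rule agj.D_additive[OF H(1,3,4,2) QK i pure_mono_inj[OF _ i K(2)]]) (use iT(2) K(1) in blast)
qed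

theorem theorem6p17:
  fixes T :: "('o, 'm) tricat" and U :: "('p, 'n) tricat"
    and QT DT :: "('o, 'm, 'p, 'n) fctr" and QU DU :: "('p, 'n, 'o, 'm) fctr"
    and \<D> :: "'o set"
  assumes "AGJ_duality_triple TYPE('u) T U QT QU DT DU"
    and "definable TYPE('u) T \<D>"
  shows "symmetric_duality_pair T U QT QU \<D> (dual_definable TYPE('u) T U DU \<D>) \<and>
    product_closed_duality_pair TYPE('u) T U QT \<D> (dual_definable TYPE('u) T U DU \<D>)"
proof -
  let ?u = "TYPE('u)"
  let ?C = "cpt ?u T" and ?E = "cpt ?u U"
  let ?Dd = "dual_definable ?u T U DU \<D>"
  have dt: "duality_triple ?u T U QT QU"
    and DT: "is_fctr (opp ?C) ?E DT" and DU: "is_fctr (opp ?E) ?C DU"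
    and adj: "adjoint_equivalence ?C (opp ?E) DT DU"
    and agjT: "AGJ_isos ?u T U QT DT" and agjU: "AGJ_isos ?u U T QU DU"
    using assms(1) by (simp_all add: AGJ_duality_triple_def)
  have "triangulated_category T" and triU: "triangulated_category U" and ls: "locally_small ?u T"
    and Q: "is_fctr (opp T) U QT" "is_fctr (opp U) T QU"
    using dt by (simp_all add: duality_triple_def compactly_generated_def is_contra_exact_def is_additive_fctr_def)
  then interpret T: triangulated_category T by simp
  interpret U: triangulated_category U by (rule triU)
  have preT: "preadditive_category T" and preU: "preadditive_category U" by unfold_locales
  obtain \<Phi> where "AGJ ?u T U QT DT \<Phi>"
    using agjT preT preU Q(1) DT unfolding AGJ_isos_def AGJ_def AGJ_axioms_def by blast
  then interpret T: AGJ ?u T U QT DT \<Phi> .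
  obtain \<Psi> where agjU': "AGJ ?u U T QU DU \<Psi>"
    using agjU preT preU Q(2) DU unfolding AGJ_isos_def AGJ_def AGJ_axioms_def by blast
  then interpret U: AGJ ?u U T QU DU \<Psi> .
  have cd: "compact_duality ?u T U DU"
    using duality_triple_D_additive[OF dt agjU'] preT preU DU
    unfolding compact_duality_def compact_duality_axioms_def by blast
  obtain \<eta> \<epsilon> where eqv: "equivalence ?C (opp ?E) DT DU \<eta> \<epsilon>"
    using adj T.cpt_preadditive[of ?u] preadditive_category.opp_preadditive[OF U.cpt_preadditive[of ?u]]
    unfolding adjoint_equivalence_def equivalence_def equivalence_axioms_def by blast
  interpret eqv: equivalence ?C "opp ?E" DT DU \<eta> \<epsilon> by (rule eqv)
  have Obj_C: "Obj ?C = compacts ?u T" "Obj ?E = compacts ?u U" by (simp_all add: cpt_def)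
  have Hom_C: "f \<in> Hom ?C A B \<longleftrightarrow> f \<in> Hom T A B \<and> A \<in> compacts ?u T \<and> B \<in> compacts ?u T" for f A B
    by (simp add: cpt_def Hom_full_sub)

  \<comment> \<open>\<open>S\<close> saturates a defining set of \<D>. It still cuts out \<D>, and
    it contains every presentation of every functor in the annihilator, so the annihilator can be
    described map by map.\<close>
  define S where "S = {f \<in> Arr ?C. \<forall>X \<in> \<D>. injective_wrt T f X}"
  have S: "f \<in> Hom T (Dom T f) (Cod T f)" "Dom T f \<in> compacts ?u T" "Cod T f \<in> compacts ?u T" if "f \<in> S" for f
    using that by (auto simp: S_def cpt_def Hom_def)
  have \<D>_eq: "\<D> = {X \<in> Obj T. \<forall>f \<in> S. injective_wrt T f X}"
  proof -
    obtain F where F: "F \<subseteq> Arr ?C" "\<D> = {X \<in> Obj T. \<forall>f \<in> F. injective_wrt T f X}"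
      using assms(2) unfolding definable_def injective_wrt_def factoring_def by blast
    then have "F \<subseteq> S" by (auto simp: S_def)
    then show ?thesis using F(2) by (auto simp: S_def)
  qed
  have "\<forall>f \<in> S. \<exists>h \<in> Arr ?E. (\<forall>Y \<in> Obj U. separated_wrt U (AM DT f) Y \<longleftrightarrow> injective_wrt U h Y) \<and>
      (\<forall>G :: ('o, 'm, 'u) abfun. is_abfun ?C G \<longrightarrow> presents ?C f G \<longrightarrow> presents ?E h (delta ?u T DU G))"
  proof
    fix f assume "f \<in> S"
    then have "f \<in> Arr ?C" by (simp add: S_def)
    from delta_presented_by_cone[OF triU cd eqv this, where ?'g = 'u]
    show "\<exists>h \<in> Arr ?E. (\<forall>Y \<in> Obj U. separated_wrt U (AM DT f) Y \<longleftrightarrow> injective_wrt U h Y) \<and>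
      (\<forall>G :: ('o, 'm, 'u) abfun. is_abfun ?C G \<longrightarrow> presents ?C f G \<longrightarrow> presents ?E h (delta ?u T DU G))"
      by metis
  qed
  then obtain h where h: "\<And>f. f \<in> S \<Longrightarrow> h f \<in> Arr ?E"
    and h_sep: "\<And>f Y. f \<in> S \<Longrightarrow> Y \<in> Obj U \<Longrightarrow> separated_wrt U (AM DT f) Y \<longleftrightarrow> injective_wrt U (h f) Y"
    and h_delta: "\<And>f (G :: ('o, 'm, 'u) abfun). f \<in> S \<Longrightarrow> is_abfun ?C G \<Longrightarrow> presents ?C f G \<Longrightarrow>
      presents ?E (h f) (delta ?u T DU G)" by metis
  have trivial_delta: "trivial_group (FObj (tilde ?u U (delta ?u T DU G)) Y) \<longleftrightarrow> injective_wrt U (h f) Y"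
    if "f \<in> S" "is_abfun ?C G" "presents ?C f G" "Y \<in> Obj U" for f Y and G :: "('o, 'm, 'u) abfun"
  proof -
    interpret dual_functor ?u T U DU G
      using cd that(2) T.cpt_preadditive[of ?u]
      by (simp add: dual_functor_def abelian_functor_def abelian_functor_axioms_def)
    show ?thesis by (rule trivial_tilde_iff[OF preU delta_abfun h_delta[OF that(1-3)] that(4)])
  qed
  have Dd_eq: "?Dd = {Y \<in> Obj U. \<forall>f \<in> S. injective_wrt U (h f) Y}"
  proof (intro equalityI subsetI)
    fix Y assume Y: "Y \<in> ?Dd"
    then have YU: "Y \<in> Obj U" by (simp add: dual_definable_def)
    \<comment> \<open>\<open>f\<close> presents a functor with values in \<open>'u\<close>, which
      vanishes on \<D> and so lies in the annihilator. Its dual is presented by \<open>h f\<close>,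
      and vanishing of the extended dual on \<open>Y\<close> is injectivity along
      \<open>h f\<close>.\<close>
    have "injective_wrt U (h f) Y" if f: "f \<in> S" for f
    proof -
      have fC: "f \<in> Arr ?C" and f\<D>: "\<And>X. X \<in> \<D> \<Longrightarrow> injective_wrt T f X" using f by (auto simp: S_def)
      have "small ?u (Hom ?C (Dom ?C f) X)" if X: "X \<in> Obj ?C" for X
      proof -
        have "Hom ?C (Dom ?C f) X = Hom T (Dom T f) X"
          using S(2)[OF f] X by (auto simp: Hom_C Obj_C cpt_def Hom_full_sub)
        then show ?thesis
          using ls S(2)[OF f] X compacts_subset_Obj[of ?u T] by (auto simp: locally_small_def Obj_C)
      qed
      then obtain G :: "('o, 'm, 'u) abfun" where G: "is_small_abfun ?u ?C G" "presents ?C f G"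
        using preadditive_category.ex_small_presented[OF T.cpt_preadditive fC] by metis
      have abfun: "is_abfun ?C G" using G(1) by (simp add: is_small_abfun_def)
      have "G \<in> fp_funs ?u ?C" using G unfolding fp_funs_def by blast
      moreover have "trivial_group (FObj (tilde ?u T G) X)" if "X \<in> \<D>" for X
        using trivial_tilde_iff[OF preT abfun G(2), of X] f\<D>[OF that] that \<D>_eq by auto
      ultimately have "G \<in> annihilator ?u T \<D>" by (simp add: annihilator_def)
      then have "trivial_group (FObj (tilde ?u U (delta ?u T DU G)) Y)"
        using Y by (simp add: dual_definable_def)
      then show ?thesis using trivial_delta[OF f abfun G(2) YU] by blast
    qed
    then show "Y \<in> {Y \<in> Obj U. \<forall>f \<in> S. injective_wrt U (h f) Y}" using YU by blast
  next
    fix Y assume Y: "Y \<in> {Y \<in> Obj U. \<forall>f \<in> S. injective_wrt U (h f) Y}"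
    \<comment> \<open>Any presentation of \<open>G\<close> belongs to \<open>S\<close>, because
      vanishing of the extension of \<open>G\<close> on \<D> is injectivity of \<D> along that
      presentation.\<close>
    have "trivial_group (FObj (tilde ?u U (delta ?u T DU G)) Y)" if G: "G \<in> annihilator ?u T \<D>" for G
    proof -
      have abfun: "is_abfun ?C G" using G by (simp add: annihilator_def fp_funs_def is_small_abfun_def)
      obtain f where f: "presents ?C f G" using G by (auto simp: annihilator_def fp_funs_def)
      have "injective_wrt T f X" if "X \<in> \<D>" for X
        using trivial_tilde_iff[OF preT abfun f, of X] G that \<D>_eq by (auto simp: annihilator_def)
      then have "f \<in> S" using f by (simp add: S_def presents_def)
      then show ?thesis using trivial_delta[OF _ abfun f] Y by blast
    qed
    then show "Y \<in> ?Dd" using Y by (simp add: dual_definable_def)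
  qed
  have Q\<D>: "X \<in> \<D> \<longleftrightarrow> OM QT X \<in> ?Dd" if X: "X \<in> Obj T" for X
  proof -
    have "injective_wrt T f X \<longleftrightarrow> injective_wrt U (h f) (OM QT X)" if "f \<in> S" for f
      using T.injective_iff_dual_separated[OF S[OF that] X] h_sep[OF that T.Q_Obj[OF X]] by simp
    then show ?thesis using X T.Q_Obj[OF X] unfolding Dd_eq by (subst \<D>_eq) simp
  qed
  have QDd: "Y \<in> ?Dd \<longleftrightarrow> OM QU Y \<in> \<D>" if Y: "Y \<in> Obj U" for Y
  proof -
    \<comment> \<open>The isomorphisms starting from \<open>U\<close> lead to injectivity along the
      double dual of \<open>f\<close>. The components of the unit form an isomorphism between
      \<open>f\<close> and this double dual, so injectivity along one is injectivity along the
      other.\<close>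
    have "injective_wrt U (h f) Y \<longleftrightarrow> injective_wrt T f (OM QU Y)" if f: "f \<in> S" for f
    proof -
      let ?A = "Dom T f" and ?B = "Cod T f"
      have fC: "f \<in> Hom ?C ?A ?B" using S[OF f] by (simp add: Hom_C)
      have DDf: "AM DU (AM DT f) \<in> Hom T (OM DU (OM DT ?A)) (OM DU (OM DT ?B))"
        using eqv.G_Hom[OF eqv.F_Hom[OF fC]] by (simp add: Hom_C)
      have unit: "\<eta> K \<in> Hom T K (OM DU (OM DT K))" "isomorphism T (\<eta> K)" if K: "K \<in> compacts ?u T" for K
      proof -
        have uH: "\<eta> K \<in> Hom ?C K (OM DU (OM DT K))" and uI: "isomorphism ?C (\<eta> K)"
          using eqv.unit_Hom[of K] eqv.unit_isomorphism[of K] K by (simp_all add: Obj_C)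
        show u: "\<eta> K \<in> Hom T K (OM DU (OM DT K))" using uH by (simp add: Hom_C)
        obtain e where "e \<in> Hom ?C (OM DU (OM DT K)) K" "e \<bullet>\<^bsub>?C\<^esub> \<eta> K = Ident ?C K"
          "\<eta> K \<bullet>\<^bsub>?C\<^esub> e = Ident ?C (OM DU (OM DT K))" using isomorphismE[OF uI uH] by blast
        \<comment> \<open>The unit is invertible in the subcategory of compacts; its inverse there
          is an inverse in \<open>T\<close>.\<close>
        then show "isomorphism T (\<eta> K)"
          using HomD[OF u] by (auto simp: isomorphism_def Hom_C cpt_def Hom_full_sub)
      qed
      have sq: "\<eta> ?B \<bullet>\<^bsub>T\<^esub> f = AM DU (AM DT f) \<bullet>\<^bsub>T\<^esub> \<eta> ?A"
        using eqv.unit_natural[OF fC] by (simp add: cpt_def)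
      have "injective_wrt U (h f) Y \<longleftrightarrow> separated_wrt U (AM DT f) Y" using h_sep[OF f Y] by simp
      also have "\<dots> \<longleftrightarrow> injective_wrt T (AM DU (AM DT f)) (OM QU Y)"
        by (rule U.separated_iff_dual_injective[OF T.D_Hom[OF S[OF f]] T.D_compact[OF S(3)[OF f]]
              T.D_compact[OF S(2)[OF f]] Y])
      also have "\<dots> \<longleftrightarrow> injective_wrt T f (OM QU Y)"
        using T.injective_wrt_isomorphic_iff[OF S(1)[OF f] DDf unit[OF S(2)[OF f]] unit[OF S(3)[OF f]] sq] by simp
      finally show ?thesis .
    qed
    then show ?thesis using Y U.Q_Obj[OF Y] unfolding Dd_eq by (subst \<D>_eq) simp
  qed
  have "S \<subseteq> Arr T" by (auto simp: S_def cpt_def)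
  note clT = T.injective_class_closed[OF this, folded \<D>_eq]
  have hS: "h ` S \<subseteq> Arr U" using h by (auto simp: cpt_def)
  \<comment> \<open>The maps \<open>h f\<close> replace separatedness by injectivity, so the dual
    class too falls under \<open>injective_class_closed\<close>.\<close>
  have Dd_eq': "?Dd = {Y \<in> Obj U. \<forall>f \<in> h ` S. injective_wrt U f Y}" unfolding Dd_eq by simp
  note clU = U.injective_class_closed[OF hS, folded Dd_eq']
  have sub: "\<D> \<subseteq> Obj T" "?Dd \<subseteq> Obj U" using \<D>_eq Dd_eq by auto
  have "duality_pair T U QT \<D> ?Dd" using sub Q\<D> clU(1,2) by (simp add: duality_pair_def)
  moreover have "duality_pair U T QU ?Dd \<D>" using sub QDd clT(1,2) by (simp add: duality_pair_def)
  ultimately show ?thesis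
    using clT(3) by (simp add: symmetric_duality_pair_def product_closed_duality_pair_def)
qed

end
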